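(* Let $N$ be a manifold of dimension $n$. Let $f$ be an immersion of $N$ into an open subset $U$ of $\mathbb{R}^m$. Let $F:U\to\mathbb{R}^\ell$ be a mapping. If $X$ is an $\mathcal{A}^1$-invariant submanifold of $J^1(n,\ell)$, then there exists a subset $\Sigma$ of $\mathcal{L}(\mathbb{R}^m,\mathbb{R}^\ell)$ with Lebesgue measure zero such that for any $\pi\in\mathcal{L}(\mathbb{R}^m,\mathbb{R}^\ell)-\Sigma$, the mapping $j^1(F_\pi\circ f):N\to J^1(N,\mathbb{R}^\ell)$ is transverse to the submanifold $X(N,\mathbb{R}^\ell)$.
   Context: Conventions: $\ell,m,n$ are positive integers; all manifolds and mappings are of class $C^\infty$ and all manifolds are without boundary. $\mathcal{L}(\mathbb{R}^m,\mathbb{R}^\ell)$ is the space of all linear mappings $\mathbb{R}^m\to\mathbb{R}^\ell$, identified with $(\mathbb{R}^m)^\ell$ (via matrices), which gives it Lebesgue measure. For $\pi\in\mathcal{L}(\mathbb{R}^m,\mathbb{R}^\ell)$ and $F:U\to\mathbb{R}^\ell$, $F_\pi=F+\pi|_U:U\to\mathbb{R}^\ell$. Transversality: for a submanifold $W$ of a manifold $P$, a mapping $g:N\to P$ is transverse to $W$ if for every $q\in N$ either $g(q)\notin W$, or $g(q)\in W$ and $dg_q(T_qN)+T_{g(q)}W=T_{g(q)}P$. Jets: $J^1(N,\mathbb{R}^\ell)$ is the manifold of $1$-jets of mappings of $N$ into $\mathbb{R}^\ell$; for $g:N\to\mathbb{R}^\ell$, $j^1g:N\to J^1(N,\mathbb{R}^\ell)$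 is the $1$-jet extension $q\mapsto j^1g(q)$. $J^1(n,\ell)=\{j^1g(0)\mid g:(\mathbb{R}^n,0)\to(\mathbb{R}^\ell,0)\}$. A subset $X$ of $J^1(n,\ell)$ is $\mathcal{A}^1$-invariant if for any $j^1g(0)\in X$ and any two germs of diffeomorphisms $H:(\mathbb{R}^\ell,0)\to(\mathbb{R}^\ell,0)$ and $h:(\mathbb{R}^n,0)\to(\mathbb{R}^n,0)$, we have $j^1(H\circ g\circ h^{-1})(0)\in X$. Let $\{(U_\lambda,\varphi_\lambda)\}_{\lambda\in\Lambda}$ be a coordinate neighborhood system of $N$, and let $\Pi:J^1(N,\mathbb{R}^\ell)\to N\times\mathbb{R}^\ell$, $\Pi(j^1g(q))=(q,g(q))$. Let $\Phi_\lambda:\Pi^{-1}(U_\lambda\times\mathbb{R}^\ell)\to\varphi_\lambda(U_\lambda)\times\mathbb{R}^\ell\times J^1(n,\ell)$ be given by $\Phi_\lambda(j^1g(q))=\left(\varphi_\lambda(q),g(q),j^1(\psi_\lambda\circ g\circ\varphi_\lambda^{-1}\circ\widetilde{\varphi}_\lambda)(0)\right)$, where $\widetilde{\varphi}_\lambda:\mathbb{R}^n\to\mathbb{R}^n$ is the translation with $\widetilde{\varphi}_\lambda(0)=\varphi_\lambda(q)$ and $\psi_\lambda:\mathbb{R}^\ell\to\mathbb{R}^\ell$ is the translation with $\psi_\lambda(g(q))=0$. These are the charts of $J^1(N,\mathbb{R}^\ell)$. For an $\mathcal{A}^1$-invariant submanifold $X$ of $J^1(n,\ell)$, set $X(N,\mathbb{R}^\ell)=\bigcup_{\lambda\in\Lambda}\Phi_\lambda^{-1}\left(\varphi_\lambda(U_\lambda)\times\mathbb{R}^\ell\times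 X\right)$; it is a subfiber-bundle of $J^1(N,\mathbb{R}^\ell)$ with fiber $X$. *)

theory Defs
  imports "HOL-Analysis.Analysis"
begin

section \<open>Smooth maps and diffeomorphisms between open subsets of Euclidean spaces\<close>

text \<open>Meaningful for open sets only: \<^term>\<open>C_k_on k S f\<close> says that f is of class C^k on S.\<close>

primrec C_k_on ::
    "nat \<Rightarrow> 'a::real_normed_vector set \<Rightarrow> ('a \<Rightarrow> 'b::real_normed_vector) \<Rightarrow> bool" where
  "C_k_on 0 S f \<longleftrightarrow> continuous_on S f"
| "C_k_on (Suc k) S f \<longleftrightarrow>
     (\<forall>x\<in>S. f differentiable (at x)) \<and>
     (\<forall>v. C_k_on k S (\<lambda>x. frechet_derivative f (at x) v))"

definition smooth_on ::
    "'a::real_normed_vector set \<Rightarrow> ('a \<Rightarrow> 'b::real_normed_vector) \<Rightarrow> bool" where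
  "smooth_on S f \<longleftrightarrow> (\<forall>k. C_k_on k S f)"

definition diffeomorphism ::
    "'a::real_normed_vector set \<Rightarrow> 'b::real_normed_vector set \<Rightarrow> ('a \<Rightarrow> 'b) \<Rightarrow> ('b \<Rightarrow> 'a) \<Rightarrow> bool"
  where
  "diffeomorphism S T h h' \<longleftrightarrow>
     open S \<and> open T \<and> homeomorphism S T h h' \<and> smooth_on S h \<and> smooth_on T h'"


section \<open>Manifolds\<close>

text \<open>A chart is a pair of its domain and a total function; the values of the function outside the
  domain are irrelevant. Manifolds are modelled on a Euclidean space \<^typ>\<open>'e::euclidean_space\<close> and are
  given by an atlas (not necessarily maximal), which also determines the topology.\<close>

type_synonym ('p, 'e) chart = "'p set \<times> ('p \<Rightarrow> 'e)"
type_synonym ('p, 'e) atlas = "('p, 'e) chart set"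

definition carrier_of :: "('p, 'e) atlas \<Rightarrow> 'p set" where
  "carrier_of A = (\<Union>(V, \<psi>)\<in>A. V)"

definition smooth_atlas :: "('p, 'e::euclidean_space) atlas \<Rightarrow> bool" where
  "smooth_atlas A \<longleftrightarrow>
     (\<forall>(V, \<psi>)\<in>A. inj_on \<psi> V \<and> open (\<psi> ` V)) \<and>
     (\<forall>(V, \<psi>)\<in>A. \<forall>(V', \<psi>')\<in>A.
        open (\<psi> ` (V \<inter> V')) \<and> smooth_on (\<psi> ` (V \<inter> V')) (\<psi>' \<circ> inv_into V \<psi>))"

definition atlas_topology :: "('p, 'e::euclidean_space) atlas \<Rightarrow> 'p topology" where
  "atlas_topology A = topology_generated_by {V \<inter> \<psi> -` S |V \<psi> S. (V, \<psi>) \<in> A \<and> open S}"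

definition manifold :: "('p, 'e::euclidean_space) atlas \<Rightarrow> bool" where
  "manifold A \<longleftrightarrow>
     smooth_atlas A \<and> Hausdorff_space (atlas_topology A) \<and> second_countable (atlas_topology A)"

definition euclidean_atlas :: "'e set \<Rightarrow> ('e::euclidean_space, 'e) atlas" where
  "euclidean_atlas U = {(U, id)}"

text \<open>Smoothness near a point of a map with values in a normed space. The map is only required to be
  meaningful near the point, so this is a property of its germ.\<close>

definition smooth_at ::
    "('p, 'e::euclidean_space) atlas \<Rightarrow> ('p \<Rightarrow> 'f::real_normed_vector) \<Rightarrow> 'p \<Rightarrow> bool" where
  "smooth_at A g q \<longleftrightarrow>
     (\<exists>(V, \<psi>)\<in>A. q \<in> V \<and>
        (\<exists>S. open S \<and> \<psi> q \<in> S \<and> S \<subseteq> \<psi> ` V \<and> smooth_on S (g \<circ> inv_into V \<psi>)))"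


section \<open>Tangent spaces, differentials, immersions\<close>

definition smooth_curve :: "('p, 'e::euclidean_space) atlas \<Rightarrow> (real \<Rightarrow> 'p) \<Rightarrow> 'p \<Rightarrow> bool" where
  "smooth_curve A c p \<longleftrightarrow>
     c 0 = p \<and>
     (\<exists>\<epsilon>>0. \<exists>(V, \<psi>)\<in>A. c ` {-\<epsilon><..<\<epsilon>} \<subseteq> V \<and> smooth_on {-\<epsilon><..<\<epsilon>} (\<psi> \<circ> c))"

text \<open>A tangent vector at p is the family of its coordinate vectors in all charts of the atlas around p
  (and 0 at all other arguments). Vector space operations are pointwise.\<close>

type_synonym ('p, 'e) tangent = "('p, 'e) chart \<Rightarrow> 'e"

definition velocity ::
    "('p, 'e::euclidean_space) atlas \<Rightarrow> (real \<Rightarrow> 'p) \<Rightarrow> ('p, 'e) tangent" where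
  "velocity A c = (\<lambda>(V, \<psi>).
     if (V, \<psi>) \<in> A \<and> c 0 \<in> V then vector_derivative (\<psi> \<circ> c) (at 0) else 0)"

definition tangent_space ::
    "('p, 'e::euclidean_space) atlas \<Rightarrow> 'p \<Rightarrow> ('p, 'e) tangent set" where
  "tangent_space A p = {velocity A c |c. smooth_curve A c p}"

text \<open>The tangent space of a submanifold W of the manifold A, as a subspace of \<^term>\<open>tangent_space A p\<close>.\<close>

definition tangent_subspace ::
    "('p, 'e::euclidean_space) atlas \<Rightarrow> 'p set \<Rightarrow> 'p \<Rightarrow> ('p, 'e) tangent set" where
  "tangent_subspace A W p =
     {velocity A c |c. smooth_curve A c p \<and> (\<exists>\<epsilon>>0. c ` {-\<epsilon><..<\<epsilon>} \<subseteq> W)}"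

text \<open>For smooth g the choice of the curve representing the tangent vector is irrelevant.\<close>

definition differential ::
    "('p, 'e::euclidean_space) atlas \<Rightarrow> ('r, 'f::euclidean_space) atlas \<Rightarrow> ('p \<Rightarrow> 'r) \<Rightarrow> 'p
      \<Rightarrow> ('p, 'e) tangent \<Rightarrow> ('r, 'f) tangent" where
  "differential A B g q v = velocity B (g \<circ> (SOME c. smooth_curve A c q \<and> velocity A c = v))"

definition immersion_into ::
    "('p, 'e::euclidean_space) atlas \<Rightarrow> 'f::euclidean_space set \<Rightarrow> ('p \<Rightarrow> 'f) \<Rightarrow> bool" where
  "immersion_into A U f \<longleftrightarrow>
     (\<forall>q\<in>carrier_of A. f q \<in> U \<and> smooth_at A f q \<and>
        inj_on (differential A (euclidean_atlas U) f q) (tangent_space A q))"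


section \<open>Submanifolds and transversality\<close>

text \<open>Submanifolds are embedded: they are locally flattened to k-dimensional linear subspaces.\<close>

definition euclidean_submanifold :: "nat \<Rightarrow> 'e::euclidean_space set \<Rightarrow> bool" where
  "euclidean_submanifold k M \<longleftrightarrow>
     (\<forall>x\<in>M. \<exists>S (T :: 'e set) h h' L.
        x \<in> S \<and> diffeomorphism S T h h' \<and> subspace L \<and> dim L = k \<and> h ` (S \<inter> M) = T \<inter> L)"

definition submanifold :: "('p, 'e::euclidean_space) atlas \<Rightarrow> nat \<Rightarrow> 'p set \<Rightarrow> bool" where
  "submanifold A k W \<longleftrightarrow>
     W \<subseteq> carrier_of A \<and> (\<forall>(V, \<psi>)\<in>A. euclidean_submanifold k (\<psi> ` (W \<inter> V)))"

definition transverse ::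
    "('p, 'e::euclidean_space) atlas \<Rightarrow> ('r, 'f::euclidean_space) atlas \<Rightarrow> ('p \<Rightarrow> 'r) \<Rightarrow> 'r set \<Rightarrow> bool"
  where
  "transverse A B g W \<longleftrightarrow>
     (\<forall>q\<in>carrier_of A. g q \<notin> W \<or>
        (g q \<in> W \<and>
         {\<lambda>\<kappa>. u \<kappa> + w \<kappa> |u w. u \<in> differential A B g q ` tangent_space A q \<and>
                                w \<in> tangent_subspace B W (g q)} = tangent_space B (g q)))"


section \<open>1-jets\<close>

text \<open>A 1-jet consists of its source q and the class of all maps that are smooth near q and agree with
  the given one at q to first order.\<close>

type_synonym ('p, 'f) jet = "'p \<times> ('p \<Rightarrow> 'f) set"

definition jet1 ::
    "('p, 'e::euclidean_space) atlas \<Rightarrow> ('p \<Rightarrow> 'f::real_normed_vector) \<Rightarrow> 'p \<Rightarrow> ('p, 'f) jet" where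
  "jet1 A g q = (q, {h. smooth_at A h q \<and> h q = g q \<and>
     (\<forall>(V, \<psi>)\<in>A. q \<in> V \<longrightarrow>
        frechet_derivative (h \<circ> inv_into V \<psi>) (at (\<psi> q)) =
        frechet_derivative (g \<circ> inv_into V \<psi>) (at (\<psi> q)))})"

definition jet_rep :: "('p, 'f) jet \<Rightarrow> 'p \<Rightarrow> 'f" where
  "jet_rep z = (SOME g. g \<in> snd z)"

definition jet_space ::
    "('p, 'e::euclidean_space) atlas \<Rightarrow> ('p, 'f::real_normed_vector) jet set" where
  "jet_space A = {jet1 A g q |g q. q \<in> carrier_of A \<and> smooth_at A g q}"

abbreviation jet1_euclidean ::
    "('e::euclidean_space \<Rightarrow> 'f::real_normed_vector) \<Rightarrow> 'e \<Rightarrow> ('e, 'f) jet" where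
  "jet1_euclidean \<equiv> jet1 (euclidean_atlas UNIV)"

text \<open>The space J^1(n,l) of 1-jets of map germs (R^n,0) \<rightarrow> (R^l,0), with its identification with matrices
  as global chart.\<close>

definition jet_fiber :: "(real^'n, real^'l) jet set" where
  "jet_fiber = {jet1_euclidean g 0 |g. smooth_at (euclidean_atlas UNIV) g 0 \<and> g 0 = 0}"

definition jet_matrix :: "(real^'n, real^'l) jet \<Rightarrow> real^'n^'l" where
  "jet_matrix z = matrix (frechet_derivative (jet_rep z) (at 0))"

definition jet_fiber_atlas :: "((real^'n, real^'l) jet, real^'n^'l) atlas" where
  "jet_fiber_atlas = {(jet_fiber, jet_matrix)}"

text \<open>\<^term>\<open>diffeo_germ h h'\<close> says that h is a germ of a diffeomorphism at 0 fixing 0, with inverse h'.\<close>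

definition diffeo_germ :: "('e::euclidean_space \<Rightarrow> 'e) \<Rightarrow> ('e \<Rightarrow> 'e) \<Rightarrow> bool" where
  "diffeo_germ h h' \<longleftrightarrow> h 0 = 0 \<and> (\<exists>S T. 0 \<in> S \<and> diffeomorphism S T h h')"

definition A1_invariant :: "(real^'n, real^'l) jet set \<Rightarrow> bool" where
  "A1_invariant X \<longleftrightarrow>
     X \<subseteq> jet_fiber \<and>
     (\<forall>g H H' h h'. smooth_at (euclidean_atlas UNIV) g 0 \<and> g 0 = 0 \<and> jet1_euclidean g 0 \<in> X \<and>
        diffeo_germ H H' \<and> diffeo_germ h h' \<longrightarrow> jet1_euclidean (H \<circ> g \<circ> h') 0 \<in> X)"

text \<open>The charts of J^1(N,R^l): \<^term>\<open>jet_triv \<kappa>\<close> is the local trivialization \<open>\<Phi>\<close> belonging to the chart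
  \<open>\<kappa>\<close> of N. Its last component is a jet in J^1(n,l), which is turned into a matrix to obtain a chart
  with values in a Euclidean space.\<close>

definition jet_dom :: "('p, real^'n) atlas \<Rightarrow> ('p, real^'n) chart \<Rightarrow> ('p, real^'l) jet set" where
  "jet_dom A \<kappa> = {z \<in> jet_space A. fst z \<in> fst \<kappa>}"

definition jet_triv ::
    "('p, real^'n) chart \<Rightarrow> ('p, real^'l) jet \<Rightarrow> (real^'n) \<times> (real^'l) \<times> (real^'n, real^'l) jet" where
  "jet_triv \<kappa> z =
     (let U = fst \<kappa>; \<phi> = snd \<kappa>; q = fst z; g = jet_rep z
      in (\<phi> q, g q,
          jet1_euclidean ((\<lambda>y. y - g q) \<circ> g \<circ> inv_into U \<phi> \<circ> (\<lambda>x. x + \<phi> q)) 0))"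

definition jet_chart ::
    "('p, real^'n) chart \<Rightarrow> ('p, real^'l) jet \<Rightarrow> (real^'n) \<times> (real^'l) \<times> (real^'n^'l)" where
  "jet_chart \<kappa> z = (case jet_triv \<kappa> z of (x, y, j) \<Rightarrow> (x, y, jet_matrix j))"

definition jet_atlas ::
    "('p, real^'n) atlas \<Rightarrow> (('p, real^'l) jet, (real^'n) \<times> (real^'l) \<times> (real^'n^'l)) atlas" where
  "jet_atlas A = {(jet_dom A \<kappa>, jet_chart \<kappa>) |\<kappa>. \<kappa> \<in> A}"

definition jet_subbundle ::
    "('p, real^'n) atlas \<Rightarrow> (real^'n, real^'l) jet set \<Rightarrow> ('p, real^'l) jet set" where
  "jet_subbundle A X =
     (\<Union>(U, \<phi>)\<in>A. {z \<in> jet_dom A (U, \<phi>). jet_triv (U, \<phi>) z \<in> (\<phi> ` U) \<times> UNIV \<times> X})"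


section \<open>Linear perturbations\<close>

definition perturb :: "('a \<Rightarrow> 'b::plus) \<Rightarrow> ('a \<Rightarrow> 'b) \<Rightarrow> 'a \<Rightarrow> 'b" where
  "perturb F \<pi> = (\<lambda>x. F x + \<pi> x)"

end

theory Submission
  imports Defs
begin

text \<open>
  Transversality of the jet extension is a local condition, and only the matrix component of a jet
  matters for it: in the bundle chart over a chart \<open>\<phi>\<close> of \<open>N\<close> the subbundle is all of source times
  target times the set \<open>M\<close> of matrices of the jets in \<open>X\<close>. With \<open>G = F \<circ> f \<circ> \<phi>\<inverse>\<close>, and \<open>f\<close> read in the
  chart, the perturbed map has derivative matrix \<open>\<mu>\<^sub>\<pi>(x) = DG(x) + \<pi> Df(x)\<close>, and transversality at \<open>x\<close>
  says that the image of \<open>D\<mu>\<^sub>\<pi>(x)\<close> and the tangent vectors of \<open>M\<close> together span all matrices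
  (\<open>jet_extension_transverse_at\<close>). Invariance of \<open>X\<close> makes membership in the subbundle independent of
  the chart (\<open>jet1_in_subbundle_iff\<close>), so countably many charts suffice to test it, and a null set of
  bad parameters has to be found for one chart only.

  If \<open>h\<close> flattens \<open>M\<close> to a linear subspace \<open>L\<close>, the condition \<open>\<mu>\<^sub>\<pi>(x) \<in> M\<close> becomes the equation
  \<open>\<Psi>((x, y), \<pi>) = \<mu>\<^sub>\<pi>(x) - h\<inverse>(y) = 0\<close> with \<open>y \<in> L\<close>, and \<open>\<mu>\<^sub>\<pi>\<close> is transverse to \<open>M\<close> at \<open>x\<close> if the
  derivative of \<open>\<Psi>\<close> in \<open>(x, y)\<close> is onto. Since \<open>f\<close> is an immersion, \<open>Df(x)\<close> has a left inverse, so
  the derivative \<open>\<delta> \<mapsto> \<delta> Df(x)\<close> of \<open>\<Psi>\<close> in the parameter is onto. Parametric transversality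
  (\<open>parametric_transversality\<close>) then says that the parameters with a degenerate zero form a null set.

  Parametric transversality rests on Sard's theorem, and the dimension of the zero set may exceed that
  of the parameter space, so a Lipschitz argument is not enough. Only real-valued functions are
  needed, however. Near a zero where the derivative in the unknowns has rank \<open>r\<close>, one can solve \<open>r\<close>
  equations for \<open>r\<close> of the unknowns and one further equation for one coordinate of the parameter. At
  all nearby zeros of the same rank this coordinate, as a function of the remaining unknowns, has
  derivative zero. Hence every line in the direction of that coordinate meets the bad parameters
  within the critical values of a real-valued function, and Fubini's theorem applies. Sard's theorem
  for real-valued functions (\<open>sard_real_valued\<close>) is proved by induction on the dimension: critical
  points where some iterated derivative vanishes and has a nonzero gradient lie on a hypersurface, and
  near the others the function varies by less than the volume of a cube of the same size.
\<close>

section \<open>Calculus of smooth maps between Euclidean spaces\<close>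

abbreviation dir_deriv ::
    "('a::real_normed_vector \<Rightarrow> 'b::real_normed_vector) \<Rightarrow> 'a \<Rightarrow> 'a \<Rightarrow> 'b" where
  "dir_deriv f v \<equiv> \<lambda>x. frechet_derivative f (at x) v"

lemma has_derivative_eq_on_open:
  assumes "open S" "x \<in> S" "\<And>y. y \<in> S \<Longrightarrow> f y = g y"
  shows "(f has_derivative f') (at x) \<longleftrightarrow> (g has_derivative f') (at x)"
  using assms has_derivative_transform_within_open[of f f' x UNIV S g]
    has_derivative_transform_within_open[of g f' x UNIV S f] by auto

lemma frechet_derivative_eq_on_open:
  assumes "open S" "x \<in> S" "\<And>y. y \<in> S \<Longrightarrow> f y = g y"
  shows "frechet_derivative f (at x) = frechet_derivative g (at x)"
  unfolding frechet_derivative_def using has_derivative_eq_on_open[OF assms] by simp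

lemma differentiable_eq_on_open:
  assumes "open S" "x \<in> S" "\<And>y. y \<in> S \<Longrightarrow> f y = g y"
  shows "f differentiable (at x) \<longleftrightarrow> g differentiable (at x)"
  unfolding differentiable_def using has_derivative_eq_on_open[OF assms] by simp

lemma frechet_derivative_eqI:
  "(f has_derivative f') (at x) \<Longrightarrow> frechet_derivative f (at x) = f'"
  using frechet_derivative_at by metis

lemma C_k_on_cong:
  assumes "open S" "\<And>x. x \<in> S \<Longrightarrow> f x = g x"
  shows "C_k_on k S f \<longleftrightarrow> C_k_on k S g"
  using assms(2)
proof (induction k arbitrary: f g)
  case 0
  then show ?case using continuous_on_cong by (simp cong: continuous_on_cong)
next
  case (Suc k)
  have "C_k_on k S (dir_deriv f v) \<longleftrightarrow> C_k_on k S (dir_deriv g v)" for v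
    by (rule Suc.IH) (simp add: frechet_derivative_eq_on_open[OF assms(1) _ Suc.prems])
  then show ?case
    by (simp add: differentiable_eq_on_open[OF assms(1) _ Suc.prems])
qed

lemma C_k_on_subset: "C_k_on k S f \<Longrightarrow> T \<subseteq> S \<Longrightarrow> C_k_on k T f"
  by (induction k arbitrary: f) (auto intro: continuous_on_subset)

text \<open>
  The class is a local notion: this glues the statements obtained in neighbourhoods, where charts and
  local inverses live.
\<close>

lemma C_k_on_local:
  assumes "\<And>x. x \<in> S \<Longrightarrow> \<exists>T. open T \<and> x \<in> T \<and> C_k_on k T f"
  shows "C_k_on k S f"
  using assms
proof (induction k arbitrary: f)
  case 0
  then have "\<And>x. x \<in> S \<Longrightarrow> isCont f x"
    by (metis C_k_on.simps(1) continuous_on_eq_continuous_at)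
  then show ?case by (simp add: continuous_at_imp_continuous_on)
next
  case (Suc k)
  then show ?case by simp meson
qed

lemma C_k_on_Suc_continuous: "C_k_on (Suc k) S f \<Longrightarrow> continuous_on S f"
  by (auto intro!: continuous_at_imp_continuous_on differentiable_imp_continuous_within)

lemma C_k_on_SucD: "C_k_on (Suc k) S f \<Longrightarrow> C_k_on k S f"
proof (induction k arbitrary: f)
  case 0
  then show ?case using C_k_on_Suc_continuous[OF 0] by simp
next
  case (Suc k)
  from Suc.prems have d: "\<forall>x\<in>S. f differentiable (at x)"
    and s: "\<And>v. C_k_on (Suc k) S (dir_deriv f v)" by (simp_all only: C_k_on.simps) auto
  have "C_k_on k S (dir_deriv f v)" for v by (rule Suc.IH[OF s])
  with d show ?case by simp
qed

lemma C_k_on_SucI: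
  assumes "open S" "\<And>x. x \<in> S \<Longrightarrow> (f has_derivative f' x) (at x)"
    "\<And>v. C_k_on k S (\<lambda>x. f' x v)"
  shows "C_k_on (Suc k) S f"
proof -
  have "C_k_on k S (dir_deriv f v)" for v
    using C_k_on_cong[OF assms(1), of "dir_deriv f v" "\<lambda>x. f' x v"] assms(3)[of v]
      frechet_derivative_eqI[OF assms(2)] by simp
  with assms(2) show ?thesis by (auto simp: differentiable_def)
qed

lemma C_k_on_SucE:
  assumes "C_k_on (Suc k) S f"
  shows "x \<in> S \<Longrightarrow> (f has_derivative frechet_derivative f (at x)) (at x)"
    and "C_k_on k S (dir_deriv f v)"
  using assms by (auto simp: frechet_derivative_works)

lemma C_k_on_const: "C_k_on k S (\<lambda>x. c)"
  by (induction k arbitrary: c) (auto simp: frechet_derivative_const)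

lemma C_k_on_add:
  assumes "open S"
  shows "C_k_on k S f \<Longrightarrow> C_k_on k S g \<Longrightarrow> C_k_on k S (\<lambda>x. f x + g x)"
proof (induction k arbitrary: f g)
  case 0
  then show ?case by (auto intro: continuous_intros)
next
  case (Suc k)
  note f = C_k_on_SucE[OF Suc.prems(1)] and g = C_k_on_SucE[OF Suc.prems(2)]
  show ?case
    by (rule C_k_on_SucI[OF assms has_derivative_add[OF f(1) g(1)]]) (auto intro: Suc.IH f(2) g(2))
qed

lemma C_k_on_bounded_linear:
  assumes "open S" "bounded_linear l"
  shows "C_k_on k S f \<Longrightarrow> C_k_on k S (\<lambda>x. l (f x))"
proof (induction k arbitrary: f)
  case 0
  then show ?case using bounded_linear.continuous_on[OF assms(2)] by auto
next
  case (Suc k)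
  note f = C_k_on_SucE[OF Suc.prems(1)]
  show ?case
    by (rule C_k_on_SucI[OF assms(1) bounded_linear.has_derivative[OF assms(2) f(1)]])
      (auto intro: Suc.IH f(2))
qed

lemma C_k_on_bounded_bilinear:
  assumes "open S" "bounded_bilinear p"
  shows "C_k_on k S f \<Longrightarrow> C_k_on k S g \<Longrightarrow> C_k_on k S (\<lambda>x. p (f x) (g x))"
proof (induction k arbitrary: f g)
  case 0
  then show ?case using bounded_bilinear.continuous_on[OF assms(2)] by auto
next
  case (Suc k)
  note f = C_k_on_SucE[OF Suc.prems(1)] and g = C_k_on_SucE[OF Suc.prems(2)]
  show ?case
    by (rule C_k_on_SucI[OF assms(1) bounded_bilinear.FDERIV[OF assms(2) f(1) g(1)]])
      (auto intro!: C_k_on_add[OF assms(1)] Suc.IH f(2) g(2)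
        C_k_on_SucD[OF Suc.prems(1)] C_k_on_SucD[OF Suc.prems(2)])
qed

lemma C_k_on_sum:
  assumes "open S" "\<And>i. i \<in> I \<Longrightarrow> C_k_on k S (f i)"
  shows "C_k_on k S (\<lambda>x. \<Sum>i\<in>I. f i x)"
  using assms(2)
  by (induction I rule: infinite_finite_induct) (auto intro: C_k_on_const C_k_on_add[OF assms(1)])

text \<open>
  The chain rule is written in coordinates, as a sum of coordinates of a derivative of \<open>g\<close> times
  directional derivatives of \<open>f\<close> at \<open>g x\<close>: every factor is then a directional derivative or again a
  composition of class \<open>C\<^sup>k\<close>, as the induction requires.
\<close>

lemma C_k_on_compose:
  fixes g :: "'a::real_normed_vector \<Rightarrow> 'b::euclidean_space"
  assumes "open S" "open T" "g ` S \<subseteq> T"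
  shows "C_k_on k T f \<Longrightarrow> C_k_on k S g \<Longrightarrow> C_k_on k S (\<lambda>x. f (g x))"
proof (induction k arbitrary: f)
  case 0
  then show ?case using continuous_on_compose2 assms(3) by auto
next
  case (Suc k)
  note f = C_k_on_SucE[OF Suc.prems(1)] and g = C_k_on_SucE[OF Suc.prems(2)]
  have der: "((\<lambda>x. f (g x)) has_derivative
      (\<lambda>v. \<Sum>b\<in>Basis. (frechet_derivative g (at x) v \<bullet> b) *\<^sub>R frechet_derivative f (at (g x)) b)) (at x)"
    if "x \<in> S" for x
  proof -
    have gx: "g x \<in> T" using that assms(3) by auto
    have lin: "linear (frechet_derivative f (at (g x)))"
      using f(1)[OF gx] has_derivative_linear by blast
    have "(\<Sum>b\<in>Basis. (w \<bullet> b) *\<^sub>R frechet_derivative f (at (g x)) b)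
        = frechet_derivative f (at (g x)) w" for w
      using linear_sum[OF lin, of "\<lambda>b. (w \<bullet> b) *\<^sub>R b" Basis] linear_cmul[OF lin]
      by (simp add: euclidean_representation)
    then show ?thesis
      using has_derivative_compose[OF g(1)[OF that] f(1)[OF gx]] by simp
  qed
  have "C_k_on k S (\<lambda>x. \<Sum>b\<in>Basis. (frechet_derivative g (at x) v \<bullet> b) *\<^sub>R
      frechet_derivative f (at (g x)) b)" for v
    by (intro C_k_on_sum[OF assms(1)]
        C_k_on_bounded_bilinear[OF assms(1) bounded_bilinear_scaleR]
        C_k_on_bounded_linear[OF assms(1) bounded_linear_inner_left] g(2))
      (auto intro!: Suc.IH[OF f(2)] C_k_on_SucD[OF Suc.prems(2)])
  then show ?case using C_k_on_SucI[OF assms(1) der] by auto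
qed

lemma smooth_on_cong:
  "open S \<Longrightarrow> (\<And>x. x \<in> S \<Longrightarrow> f x = g x) \<Longrightarrow> smooth_on S f \<longleftrightarrow> smooth_on S g"
  unfolding smooth_on_def using C_k_on_cong by blast

lemma smooth_on_subset: "smooth_on S f \<Longrightarrow> T \<subseteq> S \<Longrightarrow> smooth_on T f"
  unfolding smooth_on_def using C_k_on_subset by blast

lemma smooth_on_local:
  "(\<And>x. x \<in> S \<Longrightarrow> \<exists>T. open T \<and> x \<in> T \<and> smooth_on T f) \<Longrightarrow> smooth_on S f"
  unfolding smooth_on_def by (intro allI C_k_on_local) meson

lemma smooth_on_imp_continuous_on: "smooth_on S f \<Longrightarrow> continuous_on S f"
  unfolding smooth_on_def by (metis C_k_on.simps(1))

lemma smooth_on_dir_deriv: "smooth_on S f \<Longrightarrow> smooth_on S (dir_deriv f v)"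
  unfolding smooth_on_def using C_k_on_SucE(2) by blast

lemma smooth_on_has_derivative:
  "smooth_on S f \<Longrightarrow> x \<in> S \<Longrightarrow> (f has_derivative frechet_derivative f (at x)) (at x)"
  unfolding smooth_on_def using C_k_on_SucE(1) by blast

lemma smooth_on_differentiable: "smooth_on S f \<Longrightarrow> x \<in> S \<Longrightarrow> f differentiable (at x)"
  using smooth_on_has_derivative differentiable_def by blast

lemma smooth_on_linear_derivative:
  "smooth_on S f \<Longrightarrow> x \<in> S \<Longrightarrow> linear (frechet_derivative f (at x))"
  using smooth_on_has_derivative has_derivative_linear by blast

lemma smooth_on_const: "smooth_on S (\<lambda>x. c)"
  unfolding smooth_on_def using C_k_on_const by blast

lemma smooth_on_add:
  "open S \<Longrightarrow> smooth_on S f \<Longrightarrow> smooth_on S g \<Longrightarrow> smooth_on S (\<lambda>x. f x + g x)"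
  unfolding smooth_on_def using C_k_on_add by blast

lemma smooth_on_bounded_linear:
  "open S \<Longrightarrow> bounded_linear l \<Longrightarrow> smooth_on S f \<Longrightarrow> smooth_on S (\<lambda>x. l (f x))"
  unfolding smooth_on_def using C_k_on_bounded_linear by blast

lemma smooth_on_bounded_bilinear:
  "open S \<Longrightarrow> bounded_bilinear p \<Longrightarrow> smooth_on S f \<Longrightarrow> smooth_on S g \<Longrightarrow>
    smooth_on S (\<lambda>x. p (f x) (g x))"
  unfolding smooth_on_def using C_k_on_bounded_bilinear by blast

lemma smooth_on_diff:
  "open S \<Longrightarrow> smooth_on S f \<Longrightarrow> smooth_on S g \<Longrightarrow> smooth_on S (\<lambda>x. f x - g x)"
  using smooth_on_add[of S f "\<lambda>x. - g x"]
    smooth_on_bounded_linear[OF _ bounded_linear_minus[OF bounded_linear_ident], of S g] by simp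

lemma smooth_on_scaleR:
  "open S \<Longrightarrow> smooth_on S f \<Longrightarrow> smooth_on S g \<Longrightarrow> smooth_on S (\<lambda>x. f x *\<^sub>R g x)"
  using smooth_on_bounded_bilinear bounded_bilinear_scaleR by blast

lemma smooth_on_sum:
  "open S \<Longrightarrow> (\<And>i. i \<in> I \<Longrightarrow> smooth_on S (f i)) \<Longrightarrow> smooth_on S (\<lambda>x. \<Sum>i\<in>I. f i x)"
  unfolding smooth_on_def by (intro allI C_k_on_sum) auto

lemma smooth_on_id: "smooth_on S (\<lambda>x. x)"
proof -
  have "C_k_on k UNIV (\<lambda>x. x)" for k
  proof (cases k)
    case (Suc j)
    show ?thesis unfolding Suc by (rule C_k_on_SucI[OF _ has_derivative_ident]) (auto intro: C_k_on_const)
  qed (simp add: continuous_on_id)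
  then show ?thesis
    using smooth_on_subset by (metis smooth_on_def subset_UNIV)
qed

lemma smooth_on_linear:
  fixes l :: "'a::euclidean_space \<Rightarrow> 'b::real_normed_vector"
  shows "open S \<Longrightarrow> linear l \<Longrightarrow> smooth_on S l"
  using smooth_on_bounded_linear[OF _ _ smooth_on_id] linear_conv_bounded_linear by blast

lemma smooth_on_compose:
  fixes g :: "'a::real_normed_vector \<Rightarrow> 'b::euclidean_space"
  shows "open S \<Longrightarrow> open T \<Longrightarrow> g ` S \<subseteq> T \<Longrightarrow> smooth_on T f \<Longrightarrow> smooth_on S g \<Longrightarrow>
    smooth_on S (\<lambda>x. f (g x))"
  unfolding smooth_on_def using C_k_on_compose by blast

lemma smooth_on_linear_compose:
  fixes l :: "'b::euclidean_space \<Rightarrow> 'c::real_normed_vector"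
  shows "open S \<Longrightarrow> linear l \<Longrightarrow> smooth_on S f \<Longrightarrow> smooth_on S (\<lambda>x. l (f x))"
  using smooth_on_bounded_linear linear_conv_bounded_linear by blast

lemma smooth_on_Pair:
  fixes f :: "'a::real_normed_vector \<Rightarrow> 'b::euclidean_space" and g :: "'a \<Rightarrow> 'c::euclidean_space"
  assumes "open S" "smooth_on S f" "smooth_on S g"
  shows "smooth_on S (\<lambda>x. (f x, g x))"
proof -
  have "smooth_on S (\<lambda>x. (f x, 0))" "smooth_on S (\<lambda>x. (0, g x))"
    by (rule smooth_on_linear_compose[OF assms(1) _ assms(2)] smooth_on_linear_compose[OF assms(1) _ assms(3)];
        simp add: linear_iff)+
  from smooth_on_add[OF assms(1) this] show ?thesis by simp
qed

lemma smooth_on_vec_lambda: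
  fixes f :: "'i::finite \<Rightarrow> 'a::real_normed_vector \<Rightarrow> 'b::euclidean_space"
  assumes "open S" "\<And>i. smooth_on S (f i)"
  shows "smooth_on S (\<lambda>x. \<chi> i. f i x)"
proof -
  have "(\<lambda>x. \<chi> i. f i x) = (\<lambda>x. \<Sum>i\<in>UNIV. axis i (f i x))"
    by (auto simp: fun_eq_iff vec_eq_iff axis_def if_distrib cong: if_cong)
  moreover have "linear (axis i :: 'b \<Rightarrow> 'b^'i)" for i
    by (auto intro!: linearI simp: axis_def vec_eq_iff)
  then have "smooth_on S (\<lambda>x. axis i (f i x))" for i
    using smooth_on_linear_compose[OF assms(1) _ assms(2)] by blast
  ultimately show ?thesis
    using smooth_on_sum[OF assms(1), of UNIV "\<lambda>i x. axis i (f i x)"] by simp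
qed

section \<open>Smooth local inverses\<close>

text \<open>
  Where the scalar factor vanishes, the product rule needs only continuity of the other factor, since
  the term \<open>m z *\<^sub>R (P z - P y)\<close> is a bounded multiple of \<open>norm (z - y)\<close> times something tending to 0.
  It yields differentiability of the inverse of the derivative, of which only continuity is known at
  that point.
\<close>

lemma has_derivative_scaleR_vanishing:
  fixes m :: "'a::real_normed_vector \<Rightarrow> real" and P :: "'a \<Rightarrow> 'b::real_normed_vector"
  assumes m: "(m has_derivative m') (at y)" and m0: "m y = 0" and P: "isCont P y"
  shows "((\<lambda>z. m z *\<^sub>R P z) has_derivative (\<lambda>h. m' h *\<^sub>R P y)) (at y)"
proof -
  have bl: "bounded_linear m'" using m has_derivative_bounded_linear by blast
  have *: "((\<lambda>z. m z *\<^sub>R P y) has_derivative (\<lambda>h. m' h *\<^sub>R P y)) (at y)"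
    using has_derivative_scaleR_left[OF m] .
  obtain C where C: "\<And>h. norm (m' h) \<le> norm h * C" "C > 0"
    using bounded_linear.pos_bounded[OF bl] by blast
  have **: "((\<lambda>z. m z *\<^sub>R (P z - P y)) has_derivative (\<lambda>h. 0)) (at y)"
    unfolding has_derivative_at_alt
  proof (intro conjI allI impI)
    show "bounded_linear (\<lambda>h::'a. 0::'b)" by (rule bounded_linear_zero)
    fix e :: real assume e: "e > 0"
    from m have "\<forall>e>0. \<exists>d>0. \<forall>z. norm (z - y) < d \<longrightarrow> norm (m z - m y - m' (z - y)) \<le> e * norm (z - y)"
      unfolding has_derivative_at_alt by blast
    then obtain d1 where d1: "d1 > 0"
      "\<And>z. norm (z - y) < d1 \<Longrightarrow> norm (m z - m y - m' (z - y)) \<le> 1 * norm (z - y)"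
      using zero_less_one by blast
    have "\<exists>d>0. \<forall>z. dist z y < d \<longrightarrow> dist (P z) (P y) < e / (C + 1)"
      using P[unfolded continuous_at_eps_delta, rule_format, of "e / (C + 1)"] e C(2)
      by (simp add: dist_norm)
    then obtain d2 where d2: "d2 > 0" "\<And>z. dist z y < d2 \<Longrightarrow> dist (P z) (P y) < e / (C + 1)" by blast
    show "\<exists>d>0. \<forall>z. norm (z - y) < d \<longrightarrow>
        norm (m z *\<^sub>R (P z - P y) - m y *\<^sub>R (P y - P y) - 0) \<le> e * norm (z - y)"
    proof (intro exI conjI allI impI)
      show "min d1 d2 > 0" using d1 d2 by simp
      fix z assume z: "norm (z - y) < min d1 d2"
      have "norm (m z) \<le> norm (m' (z - y)) + norm (m z - m' (z - y))"
        using norm_triangle_ineq[of "m' (z - y)" "m z - m' (z - y)"] by simp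
      also have "\<dots> \<le> norm (z - y) * C + norm (z - y)"
        using C(1)[of "z - y"] d1(2)[of z] z m0 by simp
      finally have 1: "\<bar>m z\<bar> \<le> (C + 1) * norm (z - y)" by (simp add: algebra_simps)
      have 2: "norm (P z - P y) \<le> e / (C + 1)"
        using d2(2)[of z] z by (simp add: dist_norm)
      have "\<bar>m z\<bar> * norm (P z - P y) \<le> ((C + 1) * norm (z - y)) * (e / (C + 1))"
        using mult_mono[OF 1 2] C(2) by auto
      also have "\<dots> = e * norm (z - y)" using C(2) by simp
      finally show "norm (m z *\<^sub>R (P z - P y) - m y *\<^sub>R (P y - P y) - 0) \<le> e * norm (z - y)"
        using m0 by simp
    qed
  qed
  show ?thesis using has_derivative_add[OF * **] by (simp add: algebra_simps)
qed


text \<open>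
  The inverse function theorem provides the local inverse \<open>K\<close> and its derivative \<open>K'\<close>; what remains is
  smoothness of \<open>K\<close>. For fixed \<open>v\<close> the function \<open>z \<mapsto> K' z v\<close> solves \<open>A (K z) (K' z v) = v\<close>, where \<open>A\<close>
  is the derivative of \<open>H\<close>. Differentiating this equation expresses the derivatives of \<open>z \<mapsto> K' z v\<close>
  as polynomials in the functions \<open>z \<mapsto> K' z b\<close> and the second derivatives of \<open>H\<close> at \<open>K z\<close>. So if
  these functions and \<open>K\<close> are of class \<open>C\<^sup>k\<close>, they are of class \<open>C\<^bsup>k+1\<^esup>\<close>.
\<close>

lemma smooth_local_inverse:
  fixes H :: "'a::euclidean_space \<Rightarrow> 'a"
  assumes S: "open S" and H: "smooth_on S H" and x0: "x0 \<in> S"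
    and inj: "inj (frechet_derivative H (at x0))"
  obtains N T K where "open N" "x0 \<in> N" "N \<subseteq> S" "open T" "homeomorphism N T H K" "smooth_on T K"
    "\<And>y v. y \<in> T \<Longrightarrow> frechet_derivative H (at (K y)) (frechet_derivative K (at y) v) = v"
    "\<And>y v. y \<in> T \<Longrightarrow> frechet_derivative K (at y) (frechet_derivative H (at (K y)) v) = v"
proof -
  define A where "A x = Blinfun (frechet_derivative H (at x))" for x
  have A: "blinfun_apply (A x) = frechet_derivative H (at x)" if "x \<in> S" for x
    unfolding A_def using smooth_on_has_derivative[OF H that] has_derivative_bounded_linear
    by (blast intro: bounded_linear_Blinfun_apply)
  have contA: "continuous_on S A"
  proof (rule continuous_on_blinfun_componentwise)
    fix i :: 'a assume "i \<in> Basis"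
    have "continuous_on S (dir_deriv H i)"
      using smooth_on_imp_continuous_on[OF smooth_on_dir_deriv[OF H]] .
    then show "continuous_on S (\<lambda>x. blinfun_apply (A x) i)"
      by (rule continuous_on_eq) (simp add: A)
  qed
  obtain B where B: "linear B" "B \<circ> frechet_derivative H (at x0) = id"
    using linear_injective_left_inverse[OF smooth_on_linear_derivative[OF H x0] inj] by blast
  have "Blinfun B o\<^sub>L A x0 = id_blinfun"
    using B A[OF x0] by (intro blinfun_eqI)
      (simp add: bounded_linear_Blinfun_apply linear_conv_bounded_linear fun_eq_iff)
  from inverse_function_theorem[OF S _ contA x0 this] A smooth_on_has_derivative[OF H]
  obtain N T K K' where NT: "open N" "N \<subseteq> S" "x0 \<in> N" "open T" "homeomorphism N T H K"
    and K': "\<And>y. y \<in> T \<Longrightarrow> (K has_derivative K' y) (at y)"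
    and K'_inv: "\<And>y. y \<in> T \<Longrightarrow> K' y = inv (blinfun_apply (A (K y)))"
    and bij: "\<And>y. y \<in> T \<Longrightarrow> bij (blinfun_apply (A (K y)))"
    by (metis (no_types, lifting))
  have KT: "K y \<in> N" "K y \<in> S" if "y \<in> T" for y
    using homeomorphism_image2[OF NT(5)] that NT(2) by auto
  have AK: "blinfun_apply (A (K y)) (K' y v) = v" "K' y (blinfun_apply (A (K y)) v) = v"
    if "y \<in> T" for y v
    using bij[OF that] K'_inv[OF that] by (simp_all add: bij_is_surj surj_f_inv_f bij_is_inj inv_f_f)
  have contAK: "continuous_on T (\<lambda>y. A (K y))"
    using continuous_on_compose2[OF contA] NT(5) KT(2)
    by (metis homeomorphism_def image_subsetI)
  \<comment> \<open>Near \<open>y\<close> the operators \<open>A (K z)\<close> stay bounded below, so their inverses stay bounded and continuity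
      follows from that of \<open>z \<mapsto> A (K z)\<close>.\<close>
  have contK': "isCont (\<lambda>z. K' z v) y" if y: "y \<in> T" for v y
  proof -
    have blK: "bounded_linear (K' y)" using K'[OF y] has_derivative_bounded_linear by blast
    obtain c where c: "\<And>h. norm (K' y h) \<le> norm h * c" "c > 0"
      using bounded_linear.pos_bounded[OF blK] by blast
    have icA: "isCont (\<lambda>z. A (K z)) y"
      using contAK y NT(4) continuous_on_eq_continuous_at by blast
    then obtain d where d: "d > 0" "\<And>z. dist z y < d \<Longrightarrow> dist (A (K z)) (A (K y)) < 1 / (2 * c)"
      unfolding continuous_at_eps_delta using c(2) by (metis divide_pos_pos mult_pos_pos zero_less_numeral zero_less_one)
    have bound: "norm x \<le> 2 * c * norm (blinfun_apply (A (K z)) x)" if "dist z y < d" for x z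
    proof -
      have "norm x \<le> norm (blinfun_apply (A (K y)) x) * c"
        using c(1)[of "blinfun_apply (A (K y)) x"] AK(2)[OF y] by simp
      also have "norm (blinfun_apply (A (K y)) x) \<le> norm (blinfun_apply (A (K z)) x)
          + norm (blinfun_apply (A (K z) - A (K y)) x)"
        unfolding blinfun.diff_left
        using norm_triangle_sub[of "blinfun_apply (A (K y)) x" "blinfun_apply (A (K z)) x"]
        by (simp add: norm_minus_commute)
      also have "norm (blinfun_apply (A (K z) - A (K y)) x) \<le> norm (A (K z) - A (K y)) * norm x"
        by (rule norm_blinfun)
      also have "\<dots> \<le> 1 / (2 * c) * norm x"
        using d(2)[OF that] by (intro mult_right_mono) (auto simp: dist_norm)
      finally show ?thesis using c(2) by (simp add: field_simps)
    qed
    have "((\<lambda>z. K' z v - K' y v) \<longlongrightarrow> 0) (at y)"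
    proof (rule Lim_null_comparison)
      have "eventually (\<lambda>z. z \<in> T \<and> dist z y < d) (at y)"
        using eventually_at_in_open'[OF NT(4) y] d(1)
        by (intro eventually_conj) (auto simp: eventually_at)
      then show "\<forall>\<^sub>F z in at y. norm (K' z v - K' y v)
          \<le> 2 * c * norm (v - blinfun_apply (A (K z)) (K' y v))"
      proof eventually_elim
        case (elim z)
        then show ?case using bound[of z "K' z v - K' y v"] AK(1)[of z v]
          by (simp add: blinfun.diff_right)
      qed
      have "((\<lambda>z. blinfun_apply (A (K z)) (K' y v)) \<longlongrightarrow> blinfun_apply (A (K y)) (K' y v)) (at y)"
        using icA unfolding isCont_def by (intro tendsto_intros)
      then have "((\<lambda>z. 2 * c * norm (v - blinfun_apply (A (K z)) (K' y v)))
          \<longlongrightarrow> 2 * c * norm (v - blinfun_apply (A (K y)) (K' y v))) (at y)"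
        by (intro tendsto_mult_left tendsto_norm tendsto_diff tendsto_const)
      then show "((\<lambda>z. 2 * c * norm (v - blinfun_apply (A (K z)) (K' y v))) \<longlongrightarrow> 0) (at y)"
        by (simp add: AK(1)[OF y])
    qed
    then show ?thesis unfolding isCont_def using LIM_zero_iff by blast
  qed
  define D where "D z v w = (\<Sum>b\<in>Basis. (\<Sum>i\<in>Basis. \<Sum>j\<in>Basis.
      (K' z v \<bullet> i) * (K' z w \<bullet> j) * (dir_deriv (dir_deriv H i) j (K z) \<bullet> b)) *\<^sub>R K' z b)" for z v w
  have derK': "((\<lambda>z. K' z v) has_derivative (\<lambda>w. - D y v w)) (at y)" if y: "y \<in> T" for v y
  proof -
    \<comment> \<open>The defect of \<open>K' y v\<close> as a solution of the equation at \<open>z\<close>, in the coordinate \<open>b\<close>; it vanishes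
        at \<open>z = y\<close>, and applying \<open>K' z\<close> to it gives the difference of \<open>K' z v\<close> and \<open>K' y v\<close>.\<close>
    define m where "m b z = (\<Sum>i\<in>Basis. (K' y v \<bullet> i) * (dir_deriv H i (K z) \<bullet> b)) - v \<bullet> b" for b z
    have expand: "(\<Sum>i\<in>Basis. (x \<bullet> i) *\<^sub>R frechet_derivative f (at z) i) = frechet_derivative f (at z) x"
      if "smooth_on S f" "z \<in> S" for f :: "'a \<Rightarrow> 'a" and x z
      using linear_sum[OF smooth_on_linear_derivative[OF that], of "\<lambda>b. (x \<bullet> b) *\<^sub>R b" Basis]
        linear_cmul[OF smooth_on_linear_derivative[OF that]]
      by (simp add: euclidean_representation)
    have m_eq: "m b z = (blinfun_apply (A (K z)) (K' y v) - v) \<bullet> b" if "z \<in> T" for b z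
      using expand[OF H KT(2)[OF that], of "K' y v", symmetric] A[OF KT(2)[OF that]]
      by (simp add: m_def inner_sum_left inner_diff_left)
    have der_m: "(m b has_derivative (\<lambda>w. \<Sum>i\<in>Basis. \<Sum>j\<in>Basis. (K' y v \<bullet> i) * (K' y w \<bullet> j) *
        (dir_deriv (dir_deriv H i) j (K y) \<bullet> b))) (at y)" for b
    proof -
      have "(m b has_derivative (\<lambda>w. (\<Sum>i\<in>Basis. (K' y v \<bullet> i) *
          (frechet_derivative (dir_deriv H i) (at (K y)) (K' y w) \<bullet> b)) - 0)) (at y)"
        unfolding m_def
        by (intro has_derivative_diff has_derivative_sum has_derivative_mult_right
            has_derivative_inner_left has_derivative_const
            has_derivative_compose[OF K'[OF y] smooth_on_has_derivative[OF smooth_on_dir_deriv[OF H] KT(2)[OF y]]])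
      moreover have "frechet_derivative (dir_deriv H i) (at (K y)) (K' y w) \<bullet> b
          = (\<Sum>j\<in>Basis. (K' y w \<bullet> j) * (dir_deriv (dir_deriv H i) j (K y) \<bullet> b))" for i w
        by (subst expand[OF smooth_on_dir_deriv[OF H] KT(2)[OF y], symmetric])
          (simp add: inner_sum_left)
      ultimately show ?thesis
        by (simp only: diff_zero sum_distrib_left mult.assoc)
    qed
    have "((\<lambda>z. K' y v - (\<Sum>b\<in>Basis. m b z *\<^sub>R K' z b)) has_derivative (\<lambda>w. 0 - D y v w)) (at y)"
      unfolding D_def
      by (intro has_derivative_diff has_derivative_const has_derivative_sum
          has_derivative_scaleR_vanishing[OF der_m _ contK'[OF y]])
        (simp add: m_eq[OF y] AK(1)[OF y])
    moreover have "K' z v = K' y v - (\<Sum>b\<in>Basis. m b z *\<^sub>R K' z b)" if "z \<in> T" for z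
    proof -
      have lin: "linear (K' z)" using K'[OF that] has_derivative_linear by blast
      have "(\<Sum>b\<in>Basis. m b z *\<^sub>R K' z b) = K' z (\<Sum>b\<in>Basis. m b z *\<^sub>R b)"
        by (simp add: linear_sum[OF lin] linear_cmul[OF lin])
      also have "\<dots> = K' z (blinfun_apply (A (K z)) (K' y v) - v)"
        by (simp add: m_eq[OF that] euclidean_representation)
      finally show ?thesis by (simp add: linear_diff[OF lin] AK(2)[OF that])
    qed
    ultimately show ?thesis
      using has_derivative_eq_on_open[OF NT(4) y, of "\<lambda>z. K' z v"] by auto
  qed
  have "(\<forall>v. C_k_on k T (\<lambda>z. K' z v)) \<and> C_k_on k T K" for k
  proof (induction k)
    case 0
    show ?case using contK' homeomorphism_cont2[OF NT(5)]
      by (auto intro: continuous_at_imp_continuous_on)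
  next
    case (Suc k)
    then have IH: "\<And>v. C_k_on k T (\<lambda>z. K' z v)" "C_k_on k T K" by auto
    have HK: "C_k_on k T (\<lambda>z. dir_deriv (dir_deriv H i) j (K z))" for i j
      using smooth_on_dir_deriv[OF smooth_on_dir_deriv[OF H]] KT(2)
      by (intro C_k_on_compose[OF NT(4) S _ _ IH(2)]) (auto simp: smooth_on_def)
    have "C_k_on k T (\<lambda>z. D z v w)" for v w
      unfolding D_def
      by (intro C_k_on_sum[OF NT(4)] C_k_on_bounded_bilinear[OF NT(4) bounded_bilinear_scaleR]
          C_k_on_bounded_bilinear[OF NT(4) bounded_bilinear_mult]
          C_k_on_bounded_linear[OF NT(4) bounded_linear_inner_left] IH HK)
    then have "C_k_on (Suc k) T (\<lambda>z. K' z v)" for v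
      by (intro C_k_on_SucI[OF NT(4) derK']
          C_k_on_bounded_linear[OF NT(4) bounded_linear_minus[OF bounded_linear_ident]])
    moreover have "C_k_on (Suc k) T K" by (intro C_k_on_SucI[OF NT(4) K'] IH)
    ultimately show ?case by blast
  qed
  then have smK: "smooth_on T K" unfolding smooth_on_def by blast
  show thesis
    by (rule that[OF NT(1,3,2,4,5) smK])
      (simp_all add: frechet_derivative_eqI[OF K'] AK[unfolded A[OF KT(2)]] flip: A[OF KT(2)])
qed

section \<open>Critical values of real-valued functions\<close>

lemma negligible_countable_UN:
  assumes "countable I" "\<And>i. i \<in> I \<Longrightarrow> negligible (A i)"
  shows "negligible (\<Union>i\<in>I. A i)"
  using assms null_sets_UN'[of I A lebesgue] by (simp add: negligible_iff_null_sets)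

text \<open>
  By the Lindeloef property countably many of the neighbourhoods cover \<open>C\<close>.
\<close>

lemma negligible_image_local:
  fixes f :: "'a::euclidean_space \<Rightarrow> 'b::euclidean_space"
  assumes "\<And>x. x \<in> C \<Longrightarrow> \<exists>N. open N \<and> x \<in> N \<and> negligible (f ` (N \<inter> C))"
  shows "negligible (f ` C)"
proof -
  define \<N> where "\<N> = {N. open N \<and> negligible (f ` (N \<inter> C))}"
  obtain \<N>' where \<N>': "\<N>' \<subseteq> \<N>" "countable \<N>'" "\<Union>\<N>' = \<Union>\<N>"
    using Lindelof[of \<N>] \<N>_def by blast
  have "f ` C \<subseteq> (\<Union>N\<in>\<N>'. f ` (N \<inter> C))"
  proof
    fix y assume "y \<in> f ` C"
    then obtain x where x: "x \<in> C" "y = f x" by blast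
    then have "x \<in> \<Union>\<N>" using assms[OF x(1)] \<N>_def by blast
    then obtain N where "N \<in> \<N>'" "x \<in> N" using \<N>'(3) by blast
    then show "y \<in> (\<Union>N\<in>\<N>'. f ` (N \<inter> C))" using x by blast
  qed
  moreover have "negligible (\<Union>N\<in>\<N>'. f ` (N \<inter> C))"
    using \<N>'(1,2) \<N>_def by (intro negligible_countable_UN) auto
  ultimately show ?thesis using negligible_subset by blast
qed

text \<open>
  Divide the set into cubes of side \<open>1/n\<close>, of which there are about \<open>n\<^sup>d\<close> with \<open>d\<close> the dimension of
  the domain. The image of each cube lies in an interval of length about \<open>n\<^bsup>-(d+1)\<^esup>\<close>, so the total
  length is of order \<open>1/n\<close>. The domain may have any dimension, which is why Lipschitz bounds do
  not suffice.
\<close>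

lemma negligible_image_superlinear:
  fixes h :: "'a::euclidean_space \<Rightarrow> real"
  assumes bdd: "bounded A"
    and C: "\<And>a x. a \<in> A \<Longrightarrow> x \<in> A \<Longrightarrow> \<bar>h x - h a\<bar> \<le> C * norm (x - a) ^ (DIM('a) + 1)"
  shows "negligible (h ` A)"
  unfolding negligible_outer_le
proof (intro allI impI)
  fix e :: real assume e: "e > 0"
  define d where "d = DIM('a)"
  obtain R0 where R0: "\<And>x. x \<in> A \<Longrightarrow> norm x \<le> R0" using bdd bounded_iff by blast
  \<comment> \<open>An integer radius of at least 1, so that the cubes can be counted by \<open>2 n R + 1 \<le> 3 n R\<close>.\<close>
  define R where "R = nat \<lceil>max 1 R0\<rceil>"
  have R: "R \<ge> 1" "\<And>x. x \<in> A \<Longrightarrow> norm x \<le> real R"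
    using R0 unfolding R_def by (linarith, smt (verit) real_nat_ceiling_ge)
  define C' where "C' = \<bar>C\<bar>"
  have C': "C' \<ge> 0" "\<And>a x. a \<in> A \<Longrightarrow> x \<in> A \<Longrightarrow> \<bar>h x - h a\<bar> \<le> C' * norm (x - a) ^ (d + 1)"
    unfolding C'_def d_def by simp (meson C abs_ge_self mult_right_mono order_trans norm_ge_zero zero_le_power)
  \<comment> \<open>The total length of the covering intervals will be at most \<open>Q / n\<close>.\<close>
  define Q where "Q = (3 * real R) ^ d * (2 * (C' * real d ^ (d + 1)))"
  have Q: "Q \<ge> 0" unfolding Q_def using C'(1) by simp
  obtain n :: nat where n: "n \<ge> 1" "Q / e < real n"
    using reals_Archimedean2[of "max 1 (Q / e)"] by (metis less_le_not_le linorder_le_cases max_less_iff_conj of_nat_1 of_nat_less_iff)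
  \<comment> \<open>The index of the cube of side \<open>1/n\<close> containing \<open>x\<close>; its diameter is at most \<open>d/n\<close>.\<close>
  define cell where "cell x = (\<lambda>b\<in>(Basis::'a set). \<lfloor>real n * (x \<bullet> b)\<rfloor>)" for x
  define Idx where "Idx = cell ` A"
  define rep where "rep c = (SOME a. a \<in> A \<and> cell a = c)" for c
  have rep: "rep c \<in> A" "cell (rep c) = c" if "c \<in> Idx" for c
    using that someI_ex[of "\<lambda>a. a \<in> A \<and> cell a = c"] unfolding Idx_def rep_def by auto
  define r where "r = C' * (real d / real n) ^ (d + 1)"
  have r: "r \<ge> 0" unfolding r_def using C'(1) by simp
  have sub: "Idx \<subseteq> (\<Pi>\<^sub>E b\<in>Basis. {- int (n * R)..int (n * R)})"
    unfolding Idx_def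
  proof (rule image_subsetI)
    fix x assume x: "x \<in> A"
    have "\<lfloor>real n * (x \<bullet> b)\<rfloor> \<in> {- int (n * R)..int (n * R)}" if "b \<in> Basis" for b
    proof -
      have "\<bar>x \<bullet> b\<bar> \<le> real R" using Basis_le_norm[OF that, of x] R(2)[OF x] by linarith
      then have "\<bar>real n * (x \<bullet> b)\<bar> \<le> real (n * R)"
        by (simp add: abs_mult mult_left_mono)
      then show ?thesis by (auto simp: le_floor_iff floor_le_iff)
    qed
    then show "cell x \<in> (\<Pi>\<^sub>E b\<in>Basis. {- int (n * R)..int (n * R)})"
      unfolding cell_def by auto
  qed
  have finI: "finite Idx"
    by (rule finite_subset[OF sub]) (auto intro: finite_PiE)
  have "card Idx \<le> card (\<Pi>\<^sub>E b\<in>(Basis::'a set). {- int (n * R)..int (n * R)})"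
    by (rule card_mono[OF _ sub]) (auto intro: finite_PiE)
  also have "\<dots> = (2 * (n * R) + 1) ^ d"
    by (simp add: card_PiE d_def nat_add_distrib nat_mult_distrib mult.commute)
  finally have "real (card Idx) \<le> (2 * (real n * real R) + 1) ^ d"
    by (metis (mono_tags, lifting) of_nat_1 of_nat_add of_nat_le_iff of_nat_mult of_nat_numeral of_nat_power)
  also have "\<dots> \<le> (3 * (real n * real R)) ^ d"
  proof (rule power_mono)
    have "1 * 1 \<le> real n * real R" by (rule mult_mono) (use n(1) R(1) in auto)
    then show "2 * (real n * real R) + 1 \<le> 3 * (real n * real R)" by linarith
  qed simp
  finally have cardI: "real (card Idx) \<le> (3 * (real n * real R)) ^ d" .
  define T where "T = (\<Union>c\<in>Idx. {h (rep c) - r..h (rep c) + r})"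
  have "h ` A \<subseteq> T"
  proof (rule image_subsetI)
    fix x assume x: "x \<in> A"
    let ?a = "rep (cell x)"
    have cI: "cell x \<in> Idx" using x Idx_def by blast
    have "\<bar>(x - ?a) \<bullet> b\<bar> \<le> 1 / real n" if b: "b \<in> Basis" for b
    proof -
      have "\<lfloor>real n * (x \<bullet> b)\<rfloor> = \<lfloor>real n * (?a \<bullet> b)\<rfloor>"
        using fun_cong[OF rep(2)[OF cI], of b] b unfolding cell_def by simp
      then have "\<bar>real n * (x \<bullet> b) - real n * (?a \<bullet> b)\<bar> \<le> 1" by linarith
      then have "real n * \<bar>(x - ?a) \<bullet> b\<bar> \<le> 1"
        by (simp add: inner_diff_left abs_mult flip: right_diff_distrib)
      then show ?thesis using n(1) by (simp add: field_simps)
    qed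
    then have "(\<Sum>b\<in>Basis. \<bar>(x - ?a) \<bullet> b\<bar>) \<le> real d * (1 / real n)"
      unfolding d_def by (rule sum_bounded_above)
    then have "norm (x - ?a) \<le> real d / real n" using norm_le_l1[of "x - ?a"] by simp
    then have "C' * norm (x - ?a) ^ (d + 1) \<le> r"
      unfolding r_def by (intro mult_left_mono power_mono C'(1)) auto
    then have "\<bar>h x - h ?a\<bar> \<le> r" using C'(2)[OF rep(1)[OF cI] x] by linarith
    then show "h x \<in> T" unfolding T_def using cI by (intro UN_I[of "cell x"]) (auto simp: abs_le_iff)
  qed
  moreover have T: "T \<in> lmeasurable" unfolding T_def
    using finI by (intro fmeasurable.finite_UN) auto
  moreover have "measure lebesgue T \<le> e"
  proof -
    have "measure lebesgue T \<le> (\<Sum>c\<in>Idx. measure lebesgue {h (rep c) - r..h (rep c) + r})"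
      unfolding T_def by (rule measure_UNION_le[OF finI]) auto
    also have "\<dots> = real (card Idx) * (2 * r)" using r by simp
    also have "\<dots> \<le> (3 * (real n * real R)) ^ d * (2 * r)"
      using cardI r by (intro mult_right_mono) auto
    also have "\<dots> = Q / real n"
      unfolding Q_def r_def using n(1) by (simp add: power_divide power_mult_distrib field_simps)
    also have "\<dots> \<le> e" using n e Q by (simp add: field_simps)
    finally show ?thesis .
  qed
  ultimately show "\<exists>T. h ` A \<subseteq> T \<and> T \<in> lmeasurable \<and> measure lebesgue T \<le> e" by blast
qed

text \<open>
  The directions are applied from left to right: \<open>vs @ [v]\<close> differentiates once more in the direction
  \<open>v\<close>, whereas \<open>v # vs\<close> takes the iterated derivatives of the first derivative.
\<close>

definition iter_deriv :: "'a list \<Rightarrow> ('a::real_normed_vector \<Rightarrow> 'b::real_normed_vector) \<Rightarrow> 'a \<Rightarrow> 'b" where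
  "iter_deriv vs f = fold (\<lambda>v g. dir_deriv g v) vs f"

lemma iter_deriv_simps [simp]:
  "iter_deriv [] f = f"
  "iter_deriv (v # vs) f = iter_deriv vs (dir_deriv f v)"
  "iter_deriv (vs @ [v]) f = dir_deriv (iter_deriv vs f) v"
  by (simp_all add: iter_deriv_def)

lemma smooth_on_iter_deriv: "smooth_on S f \<Longrightarrow> smooth_on S (iter_deriv vs f)"
  by (induction vs arbitrary: f) (auto intro: smooth_on_dir_deriv)

lemma mean_value_segment:
  fixes h :: "'a::real_normed_vector \<Rightarrow> real"
  assumes h: "smooth_on S h" and seg: "closed_segment a x \<subseteq> S"
  shows "\<exists>y\<in>closed_segment a x. h x - h a = frechet_derivative h (at y) (x - a)"
proof -
  define p where "p t = a + t *\<^sub>R (x - a)" for t :: real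
  have p: "p t \<in> closed_segment a x" if "0 \<le> t" "t \<le> 1" for t
    unfolding closed_segment_def p_def using that by (auto simp: algebra_simps intro!: exI[of _ t])
  have "((\<lambda>t. h (p t)) has_derivative (\<lambda>s. frechet_derivative h (at (p t)) (s *\<^sub>R (x - a))))
      (at t within {0..1})" if "0 \<le> t" "t \<le> 1" for t
  proof (rule has_derivative_at_withinI, rule has_derivative_compose[of p])
    show "(p has_derivative (\<lambda>s. s *\<^sub>R (x - a))) (at t)"
      unfolding p_def by (auto intro!: derivative_eq_intros)
    show "(h has_derivative frechet_derivative h (at (p t))) (at (p t))"
      using smooth_on_has_derivative[OF h] p[OF that] seg by blast
  qed
  from mvt_very_simple[OF zero_le_one this] obtain t where "t \<in> {0..1}"
    "h (p 1) - h (p 0) = frechet_derivative h (at (p t)) ((1 - 0) *\<^sub>R (x - a))" by auto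
  then show ?thesis using p[of t] by (auto simp: p_def)
qed

text \<open>
  Taylor's estimate at points where all derivatives up to order \<open>k\<close> along \<open>span B\<close> vanish, with a
  constant that is uniform in the point. The induction is on \<open>k\<close> for all functions at once: the first
  derivatives satisfy the estimate with one order less and vanish at \<open>a\<close>, and the mean value theorem
  gains a factor \<open>norm (x - a)\<close>. Only directions in \<open>span B\<close> occur because \<open>K\<close> lies in that subspace.
\<close>

lemma flat_estimate:
  fixes h :: "'a::euclidean_space \<Rightarrow> real"
  assumes S: "open S" "K \<subseteq> S" and K: "compact K" "convex K"
    and B: "finite B" "pairwise orthogonal B" "\<And>b. b \<in> B \<Longrightarrow> norm b = 1" "K \<subseteq> span B"
    and h: "smooth_on S h"
  shows "\<exists>C. \<forall>a\<in>K. (\<forall>vs. set vs \<subseteq> B \<and> vs \<noteq> [] \<and> length vs \<le> k \<longrightarrow> iter_deriv vs h a = 0) \<longrightarrow>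
    (\<forall>x\<in>K. \<bar>h x - h a\<bar> \<le> C * norm (x - a) ^ (k + 1))"
proof -
  have step: "\<exists>C. \<forall>a\<in>K. P a \<longrightarrow> (\<forall>x\<in>K. \<bar>h x - h a\<bar> \<le> C * norm (x - a) ^ (j + 1))"
    if h: "smooth_on S h" and "\<And>b. b \<in> B \<Longrightarrow> \<exists>C. \<forall>a\<in>K. P a \<longrightarrow> (\<forall>x\<in>K. \<bar>dir_deriv h b x\<bar> \<le> C * norm (x - a) ^ j)"
    for h :: "'a \<Rightarrow> real" and P and j :: nat
  proof -
    from that(2) obtain C where C: "\<And>b a x. b \<in> B \<Longrightarrow> a \<in> K \<Longrightarrow> P a \<Longrightarrow> x \<in> K \<Longrightarrow>
        \<bar>dir_deriv h b x\<bar> \<le> C b * norm (x - a) ^ j"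
      by metis
    show ?thesis
    proof (intro exI ballI impI)
      fix a x assume a: "a \<in> K" "P a" and x: "x \<in> K"
      have seg: "closed_segment a x \<subseteq> K"
        using K(2) a(1) x by (simp add: closed_segment_subset)
      obtain y where y: "y \<in> closed_segment a x" "h x - h a = frechet_derivative h (at y) (x - a)"
        using mean_value_segment[OF h] seg S(2) by blast
      have yK: "y \<in> K" using seg y(1) by blast
      have "x - a \<in> span B" using a(1) x B(4) span_diff by blast
      from orthonormal_basis_expand[OF B(2,3) this B(1)]
      have "frechet_derivative h (at y) (x - a)
          = frechet_derivative h (at y) (\<Sum>b\<in>B. ((x - a) \<bullet> b) *\<^sub>R b)" by simp
      also have "\<dots> = (\<Sum>b\<in>B. ((x - a) \<bullet> b) * dir_deriv h b y)"
        using smooth_on_linear_derivative[OF h, of y] yK S(2)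
        by (simp add: linear_sum linear_cmul subset_iff)
      finally have "\<bar>h x - h a\<bar> \<le> (\<Sum>b\<in>B. \<bar>((x - a) \<bullet> b) * dir_deriv h b y\<bar>)"
        using y(2) by simp
      also have "\<dots> \<le> (\<Sum>b\<in>B. \<bar>C b\<bar> * norm (x - a) ^ (j + 1))"
      proof (rule sum_mono)
        fix b assume b: "b \<in> B"
        have 1: "\<bar>(x - a) \<bullet> b\<bar> \<le> norm (x - a)"
          using Cauchy_Schwarz_ineq2[of "x - a" b] B(3)[OF b] by simp
        have "\<bar>dir_deriv h b y\<bar> \<le> C b * norm (y - a) ^ j" using C[OF b a yK] .
        also have "\<dots> \<le> \<bar>C b\<bar> * norm (y - a) ^ j" by (intro mult_right_mono) auto
        also have "\<dots> \<le> \<bar>C b\<bar> * norm (x - a) ^ j"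
          using segment_bound(1)[OF y(1)] by (intro mult_left_mono power_mono) auto
        finally have 2: "\<bar>dir_deriv h b y\<bar> \<le> \<bar>C b\<bar> * norm (x - a) ^ j" .
        show "\<bar>((x - a) \<bullet> b) * dir_deriv h b y\<bar> \<le> \<bar>C b\<bar> * norm (x - a) ^ (j + 1)"
          using mult_mono[OF 1 2] by (simp add: abs_mult mult_ac)
      qed
      finally show "\<bar>h x - h a\<bar> \<le> (\<Sum>b\<in>B. \<bar>C b\<bar>) * norm (x - a) ^ (j + 1)"
        by (simp add: sum_distrib_right)
    qed
  qed
  show ?thesis
    using h
  proof (induction k arbitrary: h)
    case 0
    have "\<exists>C. \<forall>a\<in>K. True \<longrightarrow> (\<forall>x\<in>K. \<bar>h x - h a\<bar> \<le> C * norm (x - a) ^ (0 + 1))"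
    proof (rule step[OF 0])
      fix b assume "b \<in> B"
      have "continuous_on K (dir_deriv h b)"
        using smooth_on_imp_continuous_on[OF smooth_on_dir_deriv[OF 0]] S(2) continuous_on_subset by blast
      then have "bounded (dir_deriv h b ` K)" using K(1) compact_continuous_image compact_imp_bounded by blast
      then obtain C where "\<And>x. x \<in> K \<Longrightarrow> \<bar>dir_deriv h b x\<bar> \<le> C" unfolding bounded_iff by auto
      then show "\<exists>C. \<forall>a\<in>K. True \<longrightarrow> (\<forall>x\<in>K. \<bar>dir_deriv h b x\<bar> \<le> C * norm (x - a) ^ 0)" by auto
    qed
    then show ?case by auto
  next
    case (Suc k)
    define P where "P a \<longleftrightarrow> (\<forall>vs. set vs \<subseteq> B \<and> vs \<noteq> [] \<and> length vs \<le> Suc k \<longrightarrow> iter_deriv vs h a = 0)" for a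
    have "\<exists>C. \<forall>a\<in>K. P a \<longrightarrow> (\<forall>x\<in>K. \<bar>h x - h a\<bar> \<le> C * norm (x - a) ^ (Suc k + 1))"
    proof (rule step[OF Suc.prems])
      fix b assume b: "b \<in> B"
      obtain C where C: "\<forall>a\<in>K. (\<forall>vs. set vs \<subseteq> B \<and> vs \<noteq> [] \<and> length vs \<le> k \<longrightarrow> iter_deriv vs (dir_deriv h b) a = 0) \<longrightarrow>
          (\<forall>x\<in>K. \<bar>dir_deriv h b x - dir_deriv h b a\<bar> \<le> C * norm (x - a) ^ (k + 1))"
        using Suc.IH[OF smooth_on_dir_deriv[OF Suc.prems]] by blast
      have "\<bar>dir_deriv h b x\<bar> \<le> C * norm (x - a) ^ Suc k" if a: "a \<in> K" "P a" and x: "x \<in> K" for a x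
      proof -
        have "iter_deriv vs (dir_deriv h b) a = 0" if "set vs \<subseteq> B" "length vs \<le> k" for vs
          using a(2)[unfolded P_def, rule_format, of "b # vs"] b that by simp
        from this[of "[]"] C[rule_format, OF a(1) _ x] this
        have "dir_deriv h b a = 0" "\<bar>dir_deriv h b x - dir_deriv h b a\<bar> \<le> C * norm (x - a) ^ (k + 1)"
          by auto
        then show ?thesis by simp
      qed
      then show "\<exists>C. \<forall>a\<in>K. P a \<longrightarrow> (\<forall>x\<in>K. \<bar>dir_deriv h b x\<bar> \<le> C * norm (x - a) ^ Suc k)" by blast
    qed
    then show ?case unfolding P_def by simp
  qed
qed

text \<open>
  One step of the dimension induction. The map \<open>H\<close> replaces the coordinate in the direction \<open>v\<close> by the
  value of \<open>w\<close>; as \<open>w\<close> has a nonzero derivative in that direction, \<open>H\<close> is a local diffeomorphism. It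
  preserves the subspace \<open>W\<close> and straightens the hypersurface \<open>w = 0\<close> of \<open>W\<close> to the orthogonal
  complement of \<open>v\<close> in \<open>W\<close>. Critical points of \<open>h\<close> along \<open>W\<close> stay critical along the smaller space,
  where the critical values are null by hypothesis.
\<close>

lemma critical_image_on_hypersurface:
  fixes h w :: "'a::euclidean_space \<Rightarrow> real"
  assumes S: "open S" "smooth_on S h" "smooth_on S w" and x0: "x0 \<in> S"
    and W: "subspace W" and v: "v \<in> W" "norm v = 1" and w: "dir_deriv w v x0 \<noteq> 0"
    and IH: "\<And>S (h::'a \<Rightarrow> real). open S \<Longrightarrow> smooth_on S h \<Longrightarrow>
      negligible (h ` {x \<in> S \<inter> (W \<inter> {y. y \<bullet> v = 0}). \<forall>u \<in> W \<inter> {y. y \<bullet> v = 0}. dir_deriv h u x = 0})"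
  shows "\<exists>N. open N \<and> x0 \<in> N \<and>
    negligible (h ` (N \<inter> {x \<in> S \<inter> W. w x = 0 \<and> (\<forall>u\<in>W. dir_deriv h u x = 0)}))"
proof -
  define H where "H x = x + (w x - x \<bullet> v) *\<^sub>R v" for x
  have smH: "smooth_on S H"
    unfolding H_def
    by (intro smooth_on_add smooth_on_scaleR smooth_on_diff S smooth_on_id smooth_on_const
        smooth_on_bounded_linear[OF S(1) bounded_linear_inner_left])
  have DH: "frechet_derivative H (at x) = (\<lambda>u. u + (dir_deriv w u x - u \<bullet> v) *\<^sub>R v)" if "x \<in> S" for x
    unfolding H_def
    by (rule frechet_derivative_eqI)
      (intro has_derivative_add has_derivative_ident has_derivative_scaleR_left has_derivative_diff
        smooth_on_has_derivative[OF S(3) that] has_derivative_inner_left)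
  have inj: "inj (frechet_derivative H (at x0))"
  proof (subst linear_injective_0)
    show "linear (frechet_derivative H (at x0))" using smooth_on_linear_derivative[OF smH x0] .
    show "\<forall>u. frechet_derivative H (at x0) u = 0 \<longrightarrow> u = 0"
    proof (intro allI impI)
      fix u assume "frechet_derivative H (at x0) u = 0"
      then have 0: "u + (dir_deriv w u x0 - u \<bullet> v) *\<^sub>R v = 0" using DH[OF x0] by simp
      define c where "c = - (dir_deriv w u x0 - u \<bullet> v)"
      have uc: "u = c *\<^sub>R v" using 0 unfolding c_def
        by (metis add.commute add_eq_0_iff scaleR_minus_left)
      have wu: "dir_deriv w u x0 = c * dir_deriv w v x0"
        unfolding uc using linear_cmul[OF smooth_on_linear_derivative[OF S(3) x0]] by simp
      have "u \<bullet> v = c" unfolding uc using v(2) by (simp add: dot_square_norm)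
      then have "dir_deriv w u x0 = 0" using c_def by linarith
      then have "c * dir_deriv w v x0 = 0" using wu by simp
      then show "u = 0" using w uc by simp
    qed
  qed
  obtain N T K where N: "open N" "x0 \<in> N" "N \<subseteq> S" "open T" and hom: "homeomorphism N T H K"
    and K: "smooth_on T K"
    and DK: "\<And>y u. y \<in> T \<Longrightarrow> frechet_derivative H (at (K y)) (frechet_derivative K (at y) u) = u"
    by (rule smooth_local_inverse[OF S(1) smH x0 inj]) blast
  let ?W = "W \<inter> {y. y \<bullet> v = 0}"
  have KT: "K y \<in> N" if "y \<in> T" for y using homeomorphism_image2[OF hom] that by blast
  have sm: "smooth_on T (\<lambda>y. h (K y))"
    using KT N(3) by (intro smooth_on_compose[OF N(4) S(1) _ S(2) K]) auto
  have "h ` (N \<inter> {x \<in> S \<inter> W. w x = 0 \<and> (\<forall>u\<in>W. dir_deriv h u x = 0)})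
      \<subseteq> (\<lambda>y. h (K y)) ` {y \<in> T \<inter> ?W. \<forall>u\<in>?W. dir_deriv (\<lambda>y. h (K y)) u y = 0}"
  proof (rule image_subsetI)
    fix x assume "x \<in> N \<inter> {x \<in> S \<inter> W. w x = 0 \<and> (\<forall>u\<in>W. dir_deriv h u x = 0)}"
    then have x: "x \<in> N" "x \<in> S" "x \<in> W" "w x = 0" and crit: "\<And>u. u \<in> W \<Longrightarrow> dir_deriv h u x = 0"
      by auto
    have T: "H x \<in> T" using homeomorphism_image1[OF hom] x(1) by blast
    have KH: "K (H x) = x" using homeomorphism_apply1[OF hom x(1)] .
    have "H x \<in> W" unfolding H_def using W x(3) v(1) by (simp add: subspace_add subspace_scale)
    moreover have "H x \<bullet> v = 0"
      unfolding H_def using x(4) v(2) by (simp add: inner_diff_left dot_square_norm)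
    moreover have "dir_deriv (\<lambda>y. h (K y)) u (H x) = 0" if "u \<in> ?W" for u
    proof -
      let ?e = "frechet_derivative K (at (H x)) u"
      have "((\<lambda>y. h (K y)) has_derivative
          (\<lambda>u. frechet_derivative h (at x) (frechet_derivative K (at (H x)) u))) (at (H x))"
        using has_derivative_compose[OF smooth_on_has_derivative[OF K T],
            of h "frechet_derivative h (at x)"] smooth_on_has_derivative[OF S(2) x(2)] KH by simp
      then have "dir_deriv (\<lambda>y. h (K y)) u (H x) = dir_deriv h ?e x"
        using frechet_derivative_eqI by metis
      \<comment> \<open>The inverse of \<open>H\<close> also preserves \<open>W\<close>, so criticality along \<open>W\<close> applies to \<open>?e\<close>.\<close>
      also have "?e = u - (dir_deriv w ?e x - ?e \<bullet> v) *\<^sub>R v"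
        using DK[OF T, of u] unfolding KH DH[OF x(2)] by (simp add: algebra_simps)
      then have "?e \<in> W"
        using that W v(1) by (metis IntD1 subspace_diff subspace_scale)
      then have "dir_deriv h ?e x = 0" by (rule crit)
      finally show ?thesis .
    qed
    ultimately show "h x \<in> (\<lambda>y. h (K y)) ` {y \<in> T \<inter> ?W. \<forall>u\<in>?W. dir_deriv (\<lambda>y. h (K y)) u y = 0}"
      using T KH by (intro image_eqI[of _ _ "H x"]) auto
  qed
  then show ?thesis using IH[OF N(4) sm] N(1,2) negligible_subset by blast
qed

text \<open>
  Functions are restricted to a subspace \<open>W\<close> of a fixed space rather than defined on spaces of varying
  dimension, so that an induction on the dimension is possible. At a critical point that is not flat,
  take a shortest list of directions with a nonzero iterated derivative. All but the last of these
  directions give a function that vanishes there and has a nonzero derivative in the last direction,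
  so the point lies on a hypersurface of lower dimension. There are only countably many lists of
  directions from a finite basis.
\<close>

theorem sard_real_valued:
  fixes h :: "'a::euclidean_space \<Rightarrow> real"
  assumes "subspace W" "open S" "smooth_on S h"
  shows "negligible (h ` {x \<in> S \<inter> W. \<forall>u\<in>W. dir_deriv h u x = 0})"
  using assms
proof (induction "dim W" arbitrary: W S h rule: less_induct)
  case less
  note W = less.prems(1) and S = less.prems(2) and h = less.prems(3)
  obtain B where B: "B \<subseteq> W" "pairwise orthogonal B" "\<And>b. b \<in> B \<Longrightarrow> norm b = 1"
    "independent B" "span B = W"
    using orthonormal_basis_subspace[OF W] by metis
  have finB: "finite B" using B(4) independent_imp_finite by blast
  define Crit where "Crit = {x \<in> S \<inter> W. \<forall>u\<in>W. dir_deriv h u x = 0}"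
  define Flat where "Flat = {x \<in> S \<inter> W. \<forall>vs. set vs \<subseteq> B \<and> vs \<noteq> [] \<longrightarrow> iter_deriv vs h x = 0}"
  define Cv where "Cv vs v = {x \<in> Crit. iter_deriv vs h x = 0 \<and> dir_deriv (iter_deriv vs h) v x \<noteq> 0}" for vs v
  have "Crit \<subseteq> Flat \<union> (\<Union>(vs, v)\<in>lists B \<times> B. Cv vs v)"
  proof
    fix x assume x: "x \<in> Crit"
    show "x \<in> Flat \<union> (\<Union>(vs, v)\<in>lists B \<times> B. Cv vs v)"
    proof (cases "x \<in> Flat")
      case False
      let ?P = "\<lambda>vs. set vs \<subseteq> B \<and> vs \<noteq> [] \<and> iter_deriv vs h x \<noteq> 0"
      have "\<exists>vs. ?P vs" using False x unfolding Flat_def Crit_def by auto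
      then obtain vs where vs: "?P vs" "\<And>us. ?P us \<Longrightarrow> length vs \<le> length us"
        using ex_has_least_nat[of ?P _ length] by metis
      obtain us v where usv: "vs = us @ [v]" using vs(1) rev_exhaust by blast
      have ne: "us \<noteq> []"
      proof
        assume "us = []"
        then have "dir_deriv h v x \<noteq> 0" "v \<in> B" using vs(1) usv by auto
        then show False using x B(1) unfolding Crit_def by auto
      qed
      then have "iter_deriv us h x = 0" using vs(2)[of us] vs(1) usv by auto
      then have "x \<in> Cv us v" using vs(1) usv x unfolding Cv_def by simp
      then show ?thesis using vs(1) usv by auto
    qed simp
  qed
  then have "h ` Crit \<subseteq> h ` Flat \<union> (\<Union>(vs, v)\<in>lists B \<times> B. h ` Cv vs v)"
    by (fastforce simp: image_iff)
  moreover have "negligible (h ` Flat)"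
  proof (rule negligible_image_local)
    fix x assume "x \<in> Flat"
    then have "x \<in> S" unfolding Flat_def by blast
    then obtain r where r: "r > 0" "cball x r \<subseteq> S" using S open_contains_cball by blast
    let ?K = "cball x r \<inter> W"
    have cpt: "compact ?K" "convex ?K"
      using W by (auto intro: compact_Int_closed closed_subspace convex_Int subspace_imp_convex)
    obtain C where C: "\<forall>a\<in>?K. (\<forall>vs. set vs \<subseteq> B \<and> vs \<noteq> [] \<and> length vs \<le> DIM('a) \<longrightarrow> iter_deriv vs h a = 0) \<longrightarrow>
        (\<forall>x\<in>?K. \<bar>h x - h a\<bar> \<le> C * norm (x - a) ^ (DIM('a) + 1))"
      using flat_estimate[OF S _ cpt finB B(2,3) _ h, of "DIM('a)"] r(2) B(5) by blast
    have "negligible (h ` (ball x r \<inter> Flat))"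
    proof (rule negligible_image_superlinear)
      show "bounded (ball x r \<inter> Flat)" by (intro bounded_Int disjI1 bounded_ball)
      fix a y assume ay: "a \<in> ball x r \<inter> Flat" "y \<in> ball x r \<inter> Flat"
      then have aK: "a \<in> ?K" "y \<in> ?K" unfolding Flat_def by auto
      have "\<forall>vs. set vs \<subseteq> B \<and> vs \<noteq> [] \<and> length vs \<le> DIM('a) \<longrightarrow> iter_deriv vs h a = 0"
        using ay(1) unfolding Flat_def by blast
      then show "\<bar>h y - h a\<bar> \<le> C * norm (y - a) ^ (DIM('a) + 1)" using C aK by blast
    qed
    then show "\<exists>N. open N \<and> x \<in> N \<and> negligible (h ` (N \<inter> Flat))"
      using r(1) by (intro exI[of _ "ball x r"]) auto
  qed
  moreover have "negligible (\<Union>(vs, v)\<in>lists B \<times> B. h ` Cv vs v)"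
  proof (rule negligible_countable_UN)
    show "countable (lists B \<times> B)"
      using finB by (simp add: countable_finite)
    fix i assume i: "i \<in> lists B \<times> B"
    then obtain vs v where i_eq: "i = (vs, v)" and v: "v \<in> B" by auto
    let ?W = "W \<inter> {y. y \<bullet> v = 0}"
    have vW: "v \<in> W" "norm v = 1" using v B(1,3) by auto
    have subW: "subspace ?W" using W by (intro subspace_inter subspace_hyperplane2)
    have "v \<notin> ?W" using vW(2) by (auto simp: dot_square_norm)
    then have "?W \<subset> W" using vW(1) by blast
    then have dimW: "dim ?W < dim W" using W subW by (intro dim_psubset) (simp add: span_eq_iff[THEN iffD2])
    have "negligible (h ` Cv vs v)"
    proof (rule negligible_image_local)
      fix x assume x: "x \<in> Cv vs v"
      have "\<exists>N. open N \<and> x \<in> N \<and>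
          negligible (h ` (N \<inter> {x \<in> S \<inter> W. iter_deriv vs h x = 0 \<and> (\<forall>u\<in>W. dir_deriv h u x = 0)}))"
        using x unfolding Cv_def Crit_def
        by (intro critical_image_on_hypersurface[OF S h smooth_on_iter_deriv[OF h] _ W vW]
            less.hyps[OF dimW subW]) auto
      then obtain N where "open N" "x \<in> N"
        "negligible (h ` (N \<inter> {x \<in> S \<inter> W. iter_deriv vs h x = 0 \<and> (\<forall>u\<in>W. dir_deriv h u x = 0)}))" by blast
      moreover have "Cv vs v \<subseteq> {x \<in> S \<inter> W. iter_deriv vs h x = 0 \<and> (\<forall>u\<in>W. dir_deriv h u x = 0)}"
        unfolding Cv_def Crit_def by blast
      ultimately show "\<exists>N. open N \<and> x \<in> N \<and> negligible (h ` (N \<inter> Cv vs v))"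
        by (meson Int_mono image_mono negligible_subset order_refl)
    qed
    then show "negligible (case i of (vs, v) \<Rightarrow> h ` Cv vs v)" using i_eq by simp
  qed
  ultimately show ?case unfolding Crit_def[symmetric]
    using negligible_Un negligible_subset by blast
qed

section \<open>Sets that are null on all lines in a coordinate direction\<close>

text \<open>
  Fubini's theorem, for the decomposition of the space into lines parallel to a basis vector.
\<close>

lemma negligible_line_sections:
  fixes C :: "'a::euclidean_space set"
  assumes C: "C \<in> sets borel" and b: "b \<in> Basis"
    and sec: "\<And>a. negligible {s::real. a + s *\<^sub>R b \<in> C}"
  shows "negligible C"
proof -
  interpret product_sigma_finite "\<lambda>_::'a. lborel :: real measure" ..
  define g where "g f = (\<Sum>i\<in>Basis. f i *\<^sub>R i)" for f :: "'a \<Rightarrow> real"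
  have ins: "insert b (Basis - {b}) = (Basis::'a set)" using b by blast
  have g_meas: "g \<in> measurable (\<Pi>\<^sub>M i\<in>Basis. lborel) borel" unfolding g_def by measurable
  have "emeasure lborel C = emeasure (distr (\<Pi>\<^sub>M i\<in>Basis. lborel) borel g) C"
    unfolding g_def by (subst lborel_eq) simp
  also have "\<dots> = (\<integral>\<^sup>+x. indicator C x \<partial>(distr (\<Pi>\<^sub>M i\<in>Basis. lborel) borel g))"
    using C by (simp add: nn_integral_indicator)
  also have "\<dots> = (\<integral>\<^sup>+f. indicator C (g f) \<partial>(\<Pi>\<^sub>M i\<in>Basis. lborel))"
    using C by (intro nn_integral_distr g_meas) auto
  also have "\<dots> = (\<integral>\<^sup>+f. indicator C (g f) \<partial>(\<Pi>\<^sub>M i\<in>insert b (Basis - {b}). lborel))"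
    by (simp only: ins)
  also have "\<dots> = (\<integral>\<^sup>+f. (\<integral>\<^sup>+s. indicator C (g (f(b := s))) \<partial>lborel) \<partial>(\<Pi>\<^sub>M i\<in>Basis - {b}. lborel))"
  proof (rule product_nn_integral_insert)
    show "(\<lambda>f. indicator C (g f)) \<in> borel_measurable (\<Pi>\<^sub>M i\<in>insert b (Basis - {b}). lborel)"
      unfolding ins using measurable_compose[OF g_meas, of "indicator C" borel] C by simp
  qed auto
  also have "(\<lambda>f. (\<integral>\<^sup>+s. indicator C (g (f(b := s))) \<partial>lborel)) = (\<lambda>f. 0)"
  proof
    fix f :: "'a \<Rightarrow> real"
    define a where "a = (\<Sum>i\<in>Basis - {b}. f i *\<^sub>R i)"
    have ga: "g (f(b := s)) = a + s *\<^sub>R b" for s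
      unfolding g_def a_def using b
      by (subst sum.remove[OF _ b]) (auto simp: add.commute intro!: sum.cong)
    have "(\<lambda>s. a + s *\<^sub>R b) -` C \<in> sets borel"
      using C measurable_sets_borel[of "\<lambda>s::real. a + s *\<^sub>R b" borel C] by simp
    moreover have "(\<lambda>s. a + s *\<^sub>R b) -` C = {s. a + s *\<^sub>R b \<in> C}" by auto
    ultimately have m: "{s. a + s *\<^sub>R b \<in> C} \<in> sets borel" by simp
    have "(\<integral>\<^sup>+s. indicator C (g (f(b := s))) \<partial>lborel)
        = (\<integral>\<^sup>+s. indicator {s. a + s *\<^sub>R b \<in> C} s \<partial>lborel)"
      unfolding ga by (intro nn_integral_cong) (simp add: indicator_def)
    also have "\<dots> = emeasure lborel {s. a + s *\<^sub>R b \<in> C}" using m by simp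
    also have "\<dots> = emeasure lebesgue {s. a + s *\<^sub>R b \<in> C}" using m by simp
    also have "\<dots> = 0" using sec[of a] negligible_iff_null_sets by blast
    finally show "(\<integral>\<^sup>+s. indicator C (g (f(b := s))) \<partial>lborel) = 0" .
  qed
  finally have "emeasure lborel C = 0" by simp
  then have "C \<in> null_sets lborel" using C by auto
  then show ?thesis
    using negligible_iff_null_sets null_sets_completionI by blast
qed

section \<open>Parametric transversality\<close>

lemma orthogonal_projection_exists:
  fixes W :: "'a::euclidean_space set"
  assumes "subspace W"
  obtains P where "linear P" "\<And>x. P x \<in> W" "\<And>x w. w \<in> W \<Longrightarrow> P x \<bullet> w = x \<bullet> w"
    "\<And>w. w \<in> W \<Longrightarrow> P w = w"
proof -
  obtain B where B: "B \<subseteq> W" "pairwise orthogonal B" "\<And>b. b \<in> B \<Longrightarrow> norm b = 1"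
    "independent B" "span B = W"
    using orthonormal_basis_subspace[OF assms] by metis
  have finB: "finite B" using B(4) independent_imp_finite by blast
  define P where "P x = (\<Sum>b\<in>B. (x \<bullet> b) *\<^sub>R b)" for x
  have Pw: "P w = w" if "w \<in> W" for w
    unfolding P_def using orthonormal_basis_expand[OF B(2,3) _ finB] that B(5) by blast
  have "P x \<bullet> w = x \<bullet> w" if "w \<in> W" for x w
  proof -
    have "P x \<bullet> w = x \<bullet> P w"
      unfolding P_def by (simp add: inner_sum_left inner_sum_right inner_commute mult.commute)
    then show ?thesis using Pw[OF that] by simp
  qed
  moreover have "P x \<in> W" for x
    unfolding P_def using assms B(1) by (intro subspace_sum subspace_scale) auto
  moreover have "linear P"
    unfolding P_def by (intro linear_compose_sum ballI linearI)
      (auto simp: inner_add_left scaleR_add_left)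
  ultimately show thesis using that Pw by blast
qed

lemma linear_Pair_split:
  assumes "linear D"
  shows "D (x, y) = D (x, 0) + D (0, y)"
  using linear_add[OF assms, of "(x, 0)" "(0, y)"] by simp

lemma linear_partial:
  assumes "linear D"
  shows "linear (\<lambda>x. D (x, 0))" "linear (\<lambda>y. D (0, y))"
  using linear_compose[OF _ assms, of "\<lambda>x. (x, 0)"] linear_compose[OF _ assms, of "\<lambda>y. (0, y)"]
  by (auto simp: o_def linear_iff)

lemma not_surj_dim_range:
  fixes A :: "'a::euclidean_space \<Rightarrow> 'b::euclidean_space"
  assumes "linear A" "\<not> surj A"
  shows "dim (range A) < DIM('b)"
proof -
  have "subspace (range A)" using assms(1) linear_subspace_image subspace_UNIV by blast
  then have "dim (range A) \<noteq> DIM('b)" using assms(2) dim_eq_full span_eq_iff by metis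
  then show ?thesis using dim_subset_UNIV[of "range A"] by linarith
qed

text \<open>
  Let \<open>A\<close> be the derivative of \<open>\<Psi>\<close> in the unknowns at \<open>z0\<close>, \<open>W\<close> its kernel, \<open>J\<close> its adjoint, and \<open>u\<close> a
  vector orthogonal to its range. Since the derivative in the parameter is onto, \<open>u \<bullet> \<Psi>\<close> has a nonzero
  derivative in some coordinate direction \<open>b\<close> of the parameter. The map \<open>H\<close> replaces the part of the
  unknowns orthogonal to \<open>W\<close> by \<open>J \<Psi>\<close>, and the coordinate of the parameter along \<open>b\<close> by \<open>u \<bullet> \<Psi>\<close>. It is
  a local diffeomorphism, because \<open>P + J A\<close> is positive definite for the orthogonal projection \<open>P\<close>
  onto \<open>W\<close>. In the new coordinates the zeros of \<open>\<Psi>\<close> lie over \<open>W\<close> times the hyperplane orthogonal to \<open>b\<close>,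
  and \<open>\<sigma>\<close> is the coordinate of their parameter along \<open>b\<close>.

  Every zero \<open>z\<close> of rank \<open>r\<close> is a critical point of \<open>\<sigma>\<close> along \<open>W\<close>: the span of \<open>u\<close> and the range of
  \<open>A\<close> has dimension \<open>r + 1\<close>, hence contains some \<open>\<nu> \<noteq> 0\<close> orthogonal to the range of the derivative in
  the unknowns at \<open>z\<close>. Along \<open>W\<close>, in the new coordinates, \<open>J \<Psi>\<close> and \<open>u \<bullet> \<Psi>\<close> are constant, hence so is
  \<open>\<nu> \<bullet> \<Psi>\<close> to first order. But \<open>\<nu> \<bullet> \<Psi>\<close> is sensitive to the parameter in the direction \<open>b\<close> and
  insensitive to the unknowns, so the parameter does not move along \<open>b\<close>. Therefore the bad
  parameters meet each line parallel to \<open>b\<close> in critical values of a real-valued function.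
\<close>

lemma degenerate_zeros_locally_negligible:
  fixes \<Psi> :: "'e::euclidean_space \<times> 'p::euclidean_space \<Rightarrow> 'g::euclidean_space"
  defines "Dx \<equiv> \<lambda>z \<xi>. frechet_derivative \<Psi> (at z) (\<xi>, 0)"
  assumes S: "open S" and \<Psi>: "smooth_on S \<Psi>" and z0: "z0 \<in> S"
    and surj: "surj (\<lambda>\<pi>. frechet_derivative \<Psi> (at z0) (0, \<pi>))"
    and r: "dim (range (Dx z0)) = r" "r < DIM('g)"
  shows "\<exists>N. open N \<and> z0 \<in> N \<and>
    negligible (snd ` (N \<inter> {z \<in> S. \<Psi> z = 0 \<and> dim (range (Dx z)) = r}))"
proof -
  let ?D = "\<lambda>z. frechet_derivative \<Psi> (at z)"
  have linD: "linear (?D z)" if "z \<in> S" for z using smooth_on_linear_derivative[OF \<Psi> that] .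
  have linDx: "linear (Dx z)" if "z \<in> S" for z
    unfolding Dx_def using linear_partial(1)[OF linD[OF that]] .
  have split: "?D z (\<xi>, \<delta>) = Dx z \<xi> + ?D z (0, \<delta>)" if "z \<in> S" for z \<xi> \<delta>
    unfolding Dx_def using linear_Pair_split[OF linD[OF that]] .
  have scale: "?D z (0, s *\<^sub>R \<delta>) = s *\<^sub>R ?D z (0, \<delta>)" if "z \<in> S" for z s \<delta>
    using linear_cmul[OF linear_partial(2)[OF linD[OF that]]] .
  define A where "A = Dx z0"
  have linA: "linear A" unfolding A_def using linDx[OF z0] .
  define W where "W = {\<xi>. A \<xi> = 0}"
  have W: "subspace W" unfolding W_def using linear_subspace_kernel[OF linA] by simp
  have I: "subspace (range A)" using linA linear_subspace_image subspace_UNIV by blast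
  obtain u where u: "u \<noteq> 0" "\<And>\<xi>. u \<bullet> A \<xi> = 0"
  proof -
    have "dim (range A) < DIM('g)" using r A_def by simp
    from orthogonal_to_subspace_exists[OF this] obtain u
      where "u \<noteq> 0" "\<And>y. y \<in> span (range A) \<Longrightarrow> orthogonal u y" by blast
    then show thesis using that[of u] by (simp add: orthogonal_def span_base)
  qed
  obtain b where b: "b \<in> Basis" "u \<bullet> ?D z0 (0, b) \<noteq> 0"
  proof (rule ccontr)
    assume neg: "\<not> thesis"
    obtain \<pi> where \<pi>: "?D z0 (0, \<pi>) = u" using surj by (metis surjD)
    have "?D z0 (0, \<pi>) = ?D z0 (0, \<Sum>b\<in>Basis. (\<pi> \<bullet> b) *\<^sub>R b)" by (simp add: euclidean_representation)
    also have "\<dots> = (\<Sum>b\<in>Basis. (\<pi> \<bullet> b) *\<^sub>R ?D z0 (0, b))"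
      using linear_sum[OF linear_partial(2)[OF linD[OF z0]], of "\<lambda>b. (\<pi> \<bullet> b) *\<^sub>R b" Basis]
      by (simp add: scale[OF z0])
    finally have "u \<bullet> u = (\<Sum>b\<in>Basis. (\<pi> \<bullet> b) * (u \<bullet> ?D z0 (0, b)))"
      unfolding \<pi> by (metis (no_types, lifting) inner_scaleR_right inner_sum_right sum.cong)
    also have "\<dots> = 0" using neg that by (intro sum.neutral) auto
    finally show False using u(1) by simp
  qed
  obtain P where P: "linear P" "\<And>x. P x \<in> W" "\<And>x w. w \<in> W \<Longrightarrow> P x \<bullet> w = x \<bullet> w"
    "\<And>w. w \<in> W \<Longrightarrow> P w = w"
    using orthogonal_projection_exists[OF W] by blast
  define J where "J = adjoint A"
  have J: "\<xi> \<bullet> J y = A \<xi> \<bullet> y" for \<xi> y unfolding J_def using adjoint_works[OF linA] .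
  have linJ: "linear J" unfolding J_def using adjoint_linear[OF linA] .
  have J_perp: "w \<bullet> J y = 0" if "w \<in> W" for w y using that J W_def by simp
  define H where "H z = (P (fst z) + J (\<Psi> z), snd z - (snd z \<bullet> b) *\<^sub>R b + (u \<bullet> \<Psi> z) *\<^sub>R b)" for z
  have smH: "smooth_on S H"
    unfolding H_def
    by (intro smooth_on_Pair S smooth_on_add smooth_on_diff smooth_on_scaleR smooth_on_const
        smooth_on_bounded_linear[OF S bounded_linear_inner_left]
        smooth_on_bounded_linear[OF S bounded_linear_inner_right]
        smooth_on_linear_compose[OF S P(1)] smooth_on_linear_compose[OF S linJ]
        smooth_on_linear_compose[OF S linear_fst] smooth_on_linear_compose[OF S linear_snd]
        smooth_on_id \<Psi>)
  have DH: "frechet_derivative H (at z) = (\<lambda>v. (P (fst v) + J (?D z v),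
      snd v - (snd v \<bullet> b) *\<^sub>R b + (u \<bullet> ?D z v) *\<^sub>R b))" if "z \<in> S" for z
    unfolding H_def
    by (rule frechet_derivative_eqI)
      (intro has_derivative_Pair has_derivative_add has_derivative_diff has_derivative_scaleR_left
        has_derivative_inner_left has_derivative_inner_right has_derivative_snd has_derivative_ident
        bounded_linear.has_derivative[OF linear_conv_bounded_linear[THEN iffD1, OF P(1)]]
        bounded_linear.has_derivative[OF linear_conv_bounded_linear[THEN iffD1, OF linJ]]
        has_derivative_fst smooth_on_has_derivative[OF \<Psi> that])
  have bb: "b \<bullet> b = 1" using b(1) by simp
  \<comment> \<open>The components of \<open>H\<close> do not interfere: \<open>W\<close> is orthogonal to the range of \<open>J\<close>, so the two summands
      of the first component can be read off separately, and likewise for the second component.\<close>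
  have DH_eq: "P \<xi> = P \<xi>' \<and> J (?D z (\<xi>, \<delta>)) = J y \<and> u \<bullet> ?D z (\<xi>, \<delta>) = t \<and> \<delta> = (\<delta> \<bullet> b) *\<^sub>R b"
    if z: "z \<in> S" and eq: "frechet_derivative H (at z) (\<xi>, \<delta>) = (P \<xi>' + J y, t *\<^sub>R b)" for z \<xi> \<delta> \<xi>' y t
  proof -
    from eq have e1: "P \<xi> + J (?D z (\<xi>, \<delta>)) = P \<xi>' + J y"
      and e2: "\<delta> - (\<delta> \<bullet> b) *\<^sub>R b + (u \<bullet> ?D z (\<xi>, \<delta>)) *\<^sub>R b = t *\<^sub>R b"
      unfolding DH[OF z] by auto
    define w where "w = P \<xi> - P \<xi>'"
    have w: "w \<in> W" unfolding w_def using W P(2) by (simp add: subspace_diff)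
    have w_eq: "w = J y - J (?D z (\<xi>, \<delta>))" using e1 unfolding w_def by (simp add: algebra_simps)
    have "w \<bullet> w = w \<bullet> J y - w \<bullet> J (?D z (\<xi>, \<delta>))"
      using w_eq by (metis inner_diff_right)
    then have "w = 0" using J_perp[OF w] by simp
    then have 1: "P \<xi> = P \<xi>'" "J (?D z (\<xi>, \<delta>)) = J y" using w_def w_eq by simp_all
    have "(\<delta> - (\<delta> \<bullet> b) *\<^sub>R b + (u \<bullet> ?D z (\<xi>, \<delta>)) *\<^sub>R b) \<bullet> b = t"
      unfolding e2 using bb by simp
    then have 2: "u \<bullet> ?D z (\<xi>, \<delta>) = t" using bb by (simp add: inner_add_left inner_diff_left)
    then have "\<delta> = (\<delta> \<bullet> b) *\<^sub>R b" using e2 by simp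
    with 1 2 show ?thesis by blast
  qed
  have inj: "inj (frechet_derivative H (at z0))"
  proof (subst linear_injective_0)
    show "linear (frechet_derivative H (at z0))" using smooth_on_linear_derivative[OF smH z0] .
    show "\<forall>v. frechet_derivative H (at z0) v = 0 \<longrightarrow> v = 0"
    proof (intro allI impI)
      fix v assume v: "frechet_derivative H (at z0) v = 0"
      obtain \<xi> \<delta> where v_eq: "v = (\<xi>, \<delta>)" by fastforce
      have "frechet_derivative H (at z0) (\<xi>, \<delta>) = (P 0 + J 0, 0 *\<^sub>R b)"
        using v v_eq linear_0[OF P(1)] linear_0[OF linJ] by (simp add: zero_prod_def)
      from DH_eq[OF z0 this] have *: "P \<xi> = 0" "J (?D z0 (\<xi>, \<delta>)) = 0" "u \<bullet> ?D z0 (\<xi>, \<delta>) = 0"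
        "\<delta> = (\<delta> \<bullet> b) *\<^sub>R b"
        using linear_0[OF P(1)] linear_0[OF linJ] by auto
      have D_eq: "?D z0 (\<xi>, \<delta>) = A \<xi> + (\<delta> \<bullet> b) *\<^sub>R ?D z0 (0, b)"
        using split[OF z0, of \<xi> \<delta>] scale[OF z0, of "\<delta> \<bullet> b" b] *(4) A_def by simp
      then have "(\<delta> \<bullet> b) * (u \<bullet> ?D z0 (0, b)) = 0"
        using *(3) u(2) by (simp add: inner_add_right)
      then have s0: "\<delta> \<bullet> b = 0" using b(2) by simp
      then have "A \<xi> \<bullet> A \<xi> = 0" using J[of \<xi> "A \<xi>"] *(2) D_eq by simp
      then have "\<xi> \<in> W" unfolding W_def by simp
      then show "v = 0" using *(1,4) P(4) s0 v_eq by (simp add: zero_prod_def)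
    qed
  qed
  obtain N T K where N: "open N" "z0 \<in> N" "N \<subseteq> S" "open T" and hom: "homeomorphism N T H K"
    and K: "smooth_on T K"
    and DK: "\<And>y v. y \<in> T \<Longrightarrow> frechet_derivative H (at (K y)) (frechet_derivative K (at y) v) = v"
    by (rule smooth_local_inverse[OF S smH z0 inj]) blast
  define \<sigma> where "\<sigma> y = snd (K y) \<bullet> b" for y
  have sm\<sigma>: "smooth_on T \<sigma>"
    unfolding \<sigma>_def
    by (intro smooth_on_bounded_linear[OF N(4) bounded_linear_inner_left]
        smooth_on_linear_compose[OF N(4) linear_snd] K)
  have D\<sigma>: "frechet_derivative \<sigma> (at y) v = snd (frechet_derivative K (at y) v) \<bullet> b" if "y \<in> T" for y v
  proof -
    have "(\<sigma> has_derivative (\<lambda>v. snd (frechet_derivative K (at y) v) \<bullet> b)) (at y)"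
      unfolding \<sigma>_def by (intro has_derivative_inner_left has_derivative_snd smooth_on_has_derivative[OF K that])
    then show ?thesis using frechet_derivative_eqI by metis
  qed
  obtain \<rho> where \<rho>: "\<rho> > 0" "cball (H z0) \<rho> \<subseteq> T"
    using N(4) homeomorphism_image1[OF hom] N(2) open_contains_cball by blast
  \<comment> \<open>The critical points are taken in a closed ball, so that the set \<open>C\<close> of parameters is compact and
      Fubini's theorem needs no further measurability argument.\<close>
  define Q where "Q = cball (H z0) \<rho> \<inter> (W \<times> {p. p \<bullet> b = 0}) \<inter>
    (\<Inter>v\<in>W. {y \<in> cball (H z0) \<rho>. dir_deriv \<sigma> (v, 0) y = 0})"
  have "compact Q"
  proof -
    have "closed (\<Inter>v\<in>W. {y \<in> cball (H z0) \<rho>. dir_deriv \<sigma> (v, 0) y = 0})"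
    proof (intro closed_INT ballI)
      fix v assume "v \<in> W"
      have "continuous_on (cball (H z0) \<rho>) (dir_deriv \<sigma> (v, 0))"
        using smooth_on_imp_continuous_on[OF smooth_on_dir_deriv[OF sm\<sigma>]] \<rho>(2) continuous_on_subset by blast
      then show "closed {y \<in> cball (H z0) \<rho>. dir_deriv \<sigma> (v, 0) y = 0}"
        by (intro continuous_closed_preimage_constant) auto
    qed
    moreover have "closed (W \<times> {p. p \<bullet> b = 0})"
      by (intro closed_Times closed_subspace W subspace_hyperplane2)
    ultimately show ?thesis unfolding Q_def
      by (intro compact_Int_closed) auto
  qed
  have QT: "Q \<subseteq> T" unfolding Q_def using \<rho>(2) by blast
  define C where "C = (\<lambda>y. snd (K y)) ` Q"
  have "compact C"
    unfolding C_def using smooth_on_imp_continuous_on[OF K] QT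
    by (intro compact_continuous_image \<open>compact Q\<close> continuous_on_snd) (rule continuous_on_subset)
  have negC: "negligible C"
  proof (rule negligible_line_sections[OF _ b(1)])
    show "C \<in> sets borel" using \<open>compact C\<close> by (simp add: borel_compact)
    fix a :: 'p
    \<comment> \<open>On the line through \<open>a\<close> all parameters have the same component \<open>a'\<close> orthogonal to \<open>b\<close>, and \<open>\<sigma>\<close>
        differs from the position \<open>s\<close> on the line by the constant \<open>a \<bullet> b\<close>.\<close>
    define a' where "a' = a - (a \<bullet> b) *\<^sub>R b"
    define Ta where "Ta = (\<lambda>w. (w, a')) -` T"
    have oTa: "open Ta"
      unfolding Ta_def by (intro open_vimage N(4) continuous_intros)
    have sm: "smooth_on Ta (\<lambda>w. \<sigma> (w, a'))"
      by (rule smooth_on_compose[OF oTa N(4) _ sm\<sigma>])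
        (auto simp: Ta_def intro!: smooth_on_Pair smooth_on_id smooth_on_const oTa[unfolded Ta_def])
    have Da: "dir_deriv (\<lambda>w. \<sigma> (w, a')) v w = dir_deriv \<sigma> (v, 0) (w, a')" if "w \<in> Ta" for v w
    proof -
      have "((\<lambda>w. \<sigma> (w, a')) has_derivative (\<lambda>v. frechet_derivative \<sigma> (at (w, a')) (v, 0))) (at w)"
        using that Ta_def
        by (intro has_derivative_compose[OF has_derivative_Pair[OF has_derivative_ident has_derivative_const]]
            smooth_on_has_derivative[OF sm\<sigma>]) auto
      then show ?thesis using frechet_derivative_eqI by metis
    qed
    have "{s. a + s *\<^sub>R b \<in> C} \<subseteq> (+) (- (a \<bullet> b)) ` (\<lambda>w. \<sigma> (w, a')) ` {w \<in> Ta \<inter> W. \<forall>v\<in>W. dir_deriv (\<lambda>w. \<sigma> (w, a')) v w = 0}"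
    proof
      fix s assume "s \<in> {s. a + s *\<^sub>R b \<in> C}"
      then obtain y where y: "y \<in> Q" "a + s *\<^sub>R b = snd (K y)" unfolding C_def by auto
      obtain w p where wp: "y = (w, p)" by fastforce
      have yT: "y \<in> T" using y(1) QT by blast
      have Hy: "H (K y) = y" using homeomorphism_apply2[OF hom yT] .
      have "p = snd (H (K y))" using Hy wp by simp
      then have "p = (a + s *\<^sub>R b) - ((a + s *\<^sub>R b) \<bullet> b) *\<^sub>R b + (u \<bullet> \<Psi> (K y)) *\<^sub>R b"
        unfolding H_def y(2) by simp
      then have p_eq: "p = a' + (u \<bullet> \<Psi> (K y)) *\<^sub>R b"
        unfolding a'_def using bb by (simp add: inner_add_left algebra_simps)
      moreover have "p \<bullet> b = 0" "a' \<bullet> b = 0"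
        using y(1) wp bb unfolding Q_def a'_def by (auto simp: inner_diff_left)
      ultimately have "u \<bullet> \<Psi> (K y) = 0" using bb by (simp add: inner_add_left)
      then have p: "p = a'" using p_eq by simp
      have "\<sigma> (w, a') = a \<bullet> b + s"
        unfolding \<sigma>_def using y(2) wp p bb by (metis inner_add_left inner_scaleR_left mult.right_neutral)
      moreover have "w \<in> Ta \<inter> W" using yT y(1) wp p unfolding Ta_def Q_def by auto
      moreover have "\<forall>v\<in>W. dir_deriv \<sigma> (v, 0) (w, a') = 0"
        using y(1) wp p unfolding Q_def by auto
      ultimately show "s \<in> (+) (- (a \<bullet> b)) ` (\<lambda>w. \<sigma> (w, a')) ` {w \<in> Ta \<inter> W. \<forall>v\<in>W. dir_deriv (\<lambda>w. \<sigma> (w, a')) v w = 0}"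
        using Da by (intro image_eqI[of _ _ "\<sigma> (w, a')"] image_eqI[of _ _ w]) auto
    qed
    then show "negligible {s. a + s *\<^sub>R b \<in> C}"
      using negligible_subset negligible_translation[OF sard_real_valued[OF W oTa sm]] by blast
  qed
  define N' where "N' = N \<inter> H -` ball (H z0) \<rho>"
  have "open N'"
    unfolding N'_def using homeomorphism_cont1[OF hom] N(1)
    by (intro continuous_open_preimage) auto
  moreover have "z0 \<in> N'" unfolding N'_def using N(2) \<rho>(1) by simp
  moreover have "snd ` (N' \<inter> {z \<in> S. \<Psi> z = 0 \<and> dim (range (Dx z)) = r}) \<subseteq> C"
  proof (rule image_subsetI)
    fix z assume "z \<in> N' \<inter> {z \<in> S. \<Psi> z = 0 \<and> dim (range (Dx z)) = r}"
    then have z: "z \<in> N" "z \<in> S" "H z \<in> ball (H z0) \<rho>" "\<Psi> z = 0" "dim (range (Dx z)) = r"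
      unfolding N'_def by auto
    have Hz: "H z = (P (fst z), snd z - (snd z \<bullet> b) *\<^sub>R b)"
      unfolding H_def using z(4) linear_0[OF linJ] by simp
    have HzT: "H z \<in> T" using homeomorphism_image1[OF hom] z(1) by blast
    have KH: "K (H z) = z" using homeomorphism_apply1[OF hom z(1)] .
    define V where "V = span (insert u (range A))"
    have "u \<notin> span (range A)"
      using u I span_eq_iff[THEN iffD2, OF I] by (metis inner_eq_zero_iff rangeE)
    then have dimV: "dim V = Suc r"
      unfolding V_def using r(1) A_def by (simp add: dim_insert)
    \<comment> \<open>The dimensions of \<open>V\<close> and of the orthogonal complement \<open>Z\<close> of the range at \<open>z\<close> add up to one more
        than the dimension of the target, so the two subspaces share a nonzero vector.\<close>
    define Z where "Z = {y \<in> (UNIV::'g set). \<forall>x\<in>range (Dx z). orthogonal x y}"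
    have subR: "subspace (range (Dx z))" using linDx[OF z(2)] linear_subspace_image subspace_UNIV by blast
    have dimZ: "dim Z + r = DIM('g)"
      using dim_subspace_orthogonal_to_vectors[OF subR subspace_UNIV] z(5) unfolding Z_def by simp
    have subZ: "subspace Z" unfolding Z_def using subspace_orthogonal_to_vectors[of "range (Dx z)"] by simp
    have "dim {x + y |x y. x \<in> V \<and> y \<in> Z} \<le> DIM('g)" by (rule dim_subset_UNIV)
    moreover have "dim {x + y |x y. x \<in> V \<and> y \<in> Z} + dim (V \<inter> Z) = dim V + dim Z"
      by (rule dim_sums_Int[OF _ subZ]) (simp add: V_def)
    ultimately have "dim (V \<inter> Z) \<noteq> 0" using dimV dimZ by linarith
    then obtain \<nu> where \<nu>: "\<nu> \<in> V" "\<nu> \<in> Z" "\<nu> \<noteq> 0" unfolding dim_eq_0 by blast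
    obtain c \<eta> where \<nu>_eq: "\<nu> = A \<eta> + c *\<^sub>R u"
    proof -
      have "\<exists>k. \<nu> - k *\<^sub>R u \<in> span (range A)" using \<nu>(1) unfolding V_def by (simp add: span_insert)
      then obtain c where "\<nu> - c *\<^sub>R u \<in> range A" using span_eq_iff[THEN iffD2, OF I] by auto
      then show thesis using that by (metis add.commute diff_add_cancel rangeE)
    qed
    have \<nu>_J: "\<nu> \<bullet> y = \<eta> \<bullet> J y + c * (u \<bullet> y)" for y
      unfolding \<nu>_eq J by (simp add: inner_add_left)
    have \<nu>_Dx: "\<nu> \<bullet> Dx z \<xi> = 0" for \<xi> using \<nu>(2) unfolding Z_def orthogonal_def by (simp add: inner_commute)
    \<comment> \<open>Otherwise \<open>\<nu>\<close> would annihilate the derivative on the unknowns and on \<open>b\<close>, although \<open>H\<close> being a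
        diffeomorphism allows its components \<open>J \<Psi>\<close> and \<open>u \<bullet> \<Psi>\<close> to be varied as for the value \<open>\<nu>\<close>.\<close>
    have \<nu>_b: "\<nu> \<bullet> ?D z (0, b) \<noteq> 0"
    proof
      assume 0: "\<nu> \<bullet> ?D z (0, b) = 0"
      let ?t = "(P 0 + J \<nu>, (u \<bullet> \<nu>) *\<^sub>R b)"
      obtain \<xi> \<delta> where \<xi>\<delta>: "frechet_derivative K (at (H z)) ?t = (\<xi>, \<delta>)" by fastforce
      have "frechet_derivative H (at z) (\<xi>, \<delta>) = ?t"
        using DK[OF HzT, of ?t] unfolding KH \<xi>\<delta> .
      from DH_eq[OF z(2) this] have *: "J (?D z (\<xi>, \<delta>)) = J \<nu>" "u \<bullet> ?D z (\<xi>, \<delta>) = u \<bullet> \<nu>"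
        "\<delta> = (\<delta> \<bullet> b) *\<^sub>R b" by blast+
      have "\<nu> \<bullet> \<nu> = \<nu> \<bullet> ?D z (\<xi>, \<delta>)" using \<nu>_J * by simp
      also have "\<dots> = (\<delta> \<bullet> b) * (\<nu> \<bullet> ?D z (0, b))"
        using split[OF z(2), of \<xi> \<delta>] scale[OF z(2), of "\<delta> \<bullet> b" b] *(3) \<nu>_Dx
        by (simp add: inner_add_right)
      finally show False using 0 \<nu>(3) by simp
    qed
    have "dir_deriv \<sigma> (v, 0) (H z) = 0" if v: "v \<in> W" for v
    proof -
      obtain \<xi> \<delta> where \<xi>\<delta>: "frechet_derivative K (at (H z)) (v, 0) = (\<xi>, \<delta>)" by fastforce
      have "frechet_derivative H (at z) (\<xi>, \<delta>) = (P v + J 0, 0 *\<^sub>R b)"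
        using DK[OF HzT, of "(v, 0)"] P(4)[OF v] linear_0[OF linJ] unfolding KH \<xi>\<delta> by simp
      from DH_eq[OF z(2) this] have *: "J (?D z (\<xi>, \<delta>)) = 0" "u \<bullet> ?D z (\<xi>, \<delta>) = 0"
        "\<delta> = (\<delta> \<bullet> b) *\<^sub>R b" using linear_0[OF linJ] by auto
      have "0 = \<nu> \<bullet> ?D z (\<xi>, \<delta>)" using \<nu>_J * by simp
      also have "\<dots> = (\<delta> \<bullet> b) * (\<nu> \<bullet> ?D z (0, b))"
        using split[OF z(2), of \<xi> \<delta>] scale[OF z(2), of "\<delta> \<bullet> b" b] *(3) \<nu>_Dx
        by (simp add: inner_add_right)
      finally have "\<delta> \<bullet> b = 0" using \<nu>_b by simp
      then show ?thesis using D\<sigma>[OF HzT, of "(v, 0)"] \<xi>\<delta> by simp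
    qed
    then have "H z \<in> Q"
      unfolding Q_def using z(3) Hz P(2) bb by (auto simp: inner_diff_left)
    then show "snd z \<in> C" unfolding C_def using KH by (intro image_eqI[of _ _ "H z"]) auto
  qed
  ultimately show ?thesis using negC negligible_subset by blast
qed

text \<open>
  Degenerate zeros are sorted by the rank of the derivative in the unknowns, because the local
  argument compares zeros of equal rank only.
\<close>

theorem parametric_transversality:
  fixes \<Psi> :: "'e::euclidean_space \<times> 'p::euclidean_space \<Rightarrow> 'g::euclidean_space"
  assumes S: "open S" and \<Psi>: "smooth_on S \<Psi>"
    and surj: "\<And>z. z \<in> S \<Longrightarrow> \<Psi> z = 0 \<Longrightarrow> surj (\<lambda>\<pi>. frechet_derivative \<Psi> (at z) (0, \<pi>))"
  shows "negligible {\<pi>. \<exists>x. (x, \<pi>) \<in> S \<and> \<Psi> (x, \<pi>) = 0 \<and>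
    \<not> surj (\<lambda>\<xi>. frechet_derivative \<Psi> (at (x, \<pi>)) (\<xi>, 0))}"
proof -
  define R where "R z = dim (range (\<lambda>\<xi>. frechet_derivative \<Psi> (at z) (\<xi>, 0)))" for z
  define Z where "Z r = {z \<in> S. \<Psi> z = 0 \<and> R z = r}" for r
  have "negligible (snd ` Z r)" if r: "r < DIM('g)" for r
  proof (rule negligible_image_local)
    fix z assume z: "z \<in> Z r"
    then have z': "z \<in> S" "\<Psi> z = 0" "R z = r" unfolding Z_def by auto
    show "\<exists>N. open N \<and> z \<in> N \<and> negligible (snd ` (N \<inter> Z r))"
      unfolding Z_def R_def
      by (rule degenerate_zeros_locally_negligible[OF S \<Psi> z'(1) surj[OF z'(1,2)] z'(3)[unfolded R_def] r])
  qed
  then have "negligible (\<Union>r\<in>{..<DIM('g)}. snd ` Z r)"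
    by (intro negligible_countable_UN) auto
  moreover have "{\<pi>. \<exists>x. (x, \<pi>) \<in> S \<and> \<Psi> (x, \<pi>) = 0 \<and>
    \<not> surj (\<lambda>\<xi>. frechet_derivative \<Psi> (at (x, \<pi>)) (\<xi>, 0))} \<subseteq> (\<Union>r\<in>{..<DIM('g)}. snd ` Z r)"
  proof
    fix \<pi> assume "\<pi> \<in> {\<pi>. \<exists>x. (x, \<pi>) \<in> S \<and> \<Psi> (x, \<pi>) = 0 \<and>
      \<not> surj (\<lambda>\<xi>. frechet_derivative \<Psi> (at (x, \<pi>)) (\<xi>, 0))}"
    then obtain x where x: "(x, \<pi>) \<in> S" "\<Psi> (x, \<pi>) = 0"
      "\<not> surj (\<lambda>\<xi>. frechet_derivative \<Psi> (at (x, \<pi>)) (\<xi>, 0))" by blast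
    have "R (x, \<pi>) < DIM('g)"
      unfolding R_def
      by (rule not_surj_dim_range[OF linear_partial(1)[OF smooth_on_linear_derivative[OF \<Psi> x(1)]] x(3)])
    then show "\<pi> \<in> (\<Union>r\<in>{..<DIM('g)}. snd ` Z r)"
      using x(1,2) unfolding Z_def by (intro UN_I[of "R (x, \<pi>)"] image_eqI[of _ _ "(x, \<pi>)"]) auto
  qed
  ultimately show ?thesis using negligible_subset by blast
qed

section \<open>Generic linear perturbations in a chart\<close>

abbreviation deriv_matrix :: "(real^'n \<Rightarrow> real^'l) \<Rightarrow> real^'n \<Rightarrow> real^'n^'l" where
  "deriv_matrix f x \<equiv> matrix (frechet_derivative f (at x))"

lemma smooth_on_deriv_matrix:
  assumes "open S" "smooth_on S f"
  shows "smooth_on S (deriv_matrix f)"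
  unfolding matrix_def
  by (intro smooth_on_vec_lambda assms(1)
      smooth_on_bounded_linear[OF assms(1) bounded_linear_vec_nth] smooth_on_dir_deriv assms(2))

lemma bounded_bilinear_matrix_mult:
  "bounded_bilinear (\<lambda>(A::real^'m^'l) (B::real^'n^'m). A ** B)"
  unfolding bilinear_conv_bounded_bilinear[symmetric] bilinear_def
  by (auto intro!: linearI simp: matrix_add_ldistrib matrix_scalar_ac scalar_matrix_assoc
      scalar_mult_eq_scaleR[symmetric] vec_eq_iff matrix_matrix_mult_def sum.distrib
      sum_distrib_left algebra_simps)

lemmas matrix_mult_zero = bounded_bilinear.zero_left[OF bounded_bilinear_matrix_mult]
  bounded_bilinear.zero_right[OF bounded_bilinear_matrix_mult]

text \<open>
  Tangent vectors of a subset as velocities of smooth curves in it, the form in which tangent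
  subspaces of submanifolds are defined.
\<close>

definition tangent_to :: "'a::euclidean_space set \<Rightarrow> 'a \<Rightarrow> 'a \<Rightarrow> bool" where
  "tangent_to M y c \<longleftrightarrow> (\<exists>\<gamma> \<epsilon>. \<epsilon> > 0 \<and> smooth_on {-\<epsilon><..<\<epsilon>} \<gamma> \<and> \<gamma> 0 = y \<and>
     \<gamma> ` {-\<epsilon><..<\<epsilon>} \<subseteq> M \<and> (\<gamma> has_vector_derivative c) (at 0))"

text \<open>
  The curve is the image of a straight line in the flat model.
\<close>

lemma tangent_to_flattened:
  fixes S M T L :: "'a::euclidean_space set"
  assumes diffeo: "diffeomorphism S T h h'" and L: "subspace L" and hM: "h ` (S \<inter> M) = T \<inter> L"
    and y: "y \<in> T \<inter> L" and v: "v \<in> L"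
  shows "tangent_to M (h' y) (frechet_derivative h' (at y) v)"
proof -
  have oT: "open T" and hom: "homeomorphism S T h h'" and h': "smooth_on T h'"
    using diffeo unfolding diffeomorphism_def by auto
  define p where "p t = y + t *\<^sub>R v" for t :: real
  have "open (p -` T)" unfolding p_def by (intro open_vimage oT continuous_intros)
  moreover have "0 \<in> p -` T" unfolding p_def using y by simp
  ultimately obtain \<epsilon> where \<epsilon>: "\<epsilon> > 0" "ball 0 \<epsilon> \<subseteq> p -` T"
    using open_contains_ball by blast
  have p: "p t \<in> T \<inter> L" if "t \<in> {-\<epsilon><..<\<epsilon>}" for t
  proof -
    have "t \<in> ball 0 \<epsilon>" using that by (auto simp: dist_real_def)
    then show ?thesis using \<epsilon>(2) L y v unfolding p_def by (auto intro: subspace_add subspace_scale)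
  qed
  have "smooth_on {-\<epsilon><..<\<epsilon>} (\<lambda>t. h' (p t))"
  proof (rule smooth_on_compose[OF _ oT _ h'])
    show "smooth_on {-\<epsilon><..<\<epsilon>} p"
      unfolding p_def by (intro smooth_on_add smooth_on_const smooth_on_scaleR smooth_on_id) auto
  qed (use p in auto)
  moreover have "h' ` (T \<inter> L) \<subseteq> M"
    unfolding hM[symmetric] using homeomorphism_apply1[OF hom] by auto
  then have "(\<lambda>t. h' (p t)) ` {-\<epsilon><..<\<epsilon>} \<subseteq> M" using p by auto
  moreover have "((\<lambda>t. h' (p t)) has_vector_derivative frechet_derivative h' (at y) v) (at 0)"
  proof -
    have D: "(h' has_derivative frechet_derivative h' (at y)) (at (p 0))"
      using smooth_on_has_derivative[OF h', of y] y unfolding p_def by simp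
    have "(p has_derivative (\<lambda>t. t *\<^sub>R v)) (at 0)"
      unfolding p_def by (auto intro!: derivative_eq_intros)
    from has_derivative_compose[OF this D] show ?thesis
      unfolding has_vector_derivative_def
      using linear_cmul[OF has_derivative_linear[OF D]] by simp
  qed
  moreover have "h' (p 0) = h' y" unfolding p_def by simp
  ultimately show ?thesis unfolding tangent_to_def using \<epsilon>(1) by blast
qed

text \<open>
  Parametric transversality for \<open>\<Psi>((x, y), \<pi>) = \<mu> \<pi> x - h' (P y)\<close>. Inserting the projection \<open>P\<close> onto
  \<open>L\<close> lets \<open>y\<close> range over an open set of the full space; the derivative in \<open>y\<close> then still runs through
  exactly the tangent vectors \<open>Dh'(y) v\<close> with \<open>v \<in> L\<close>.
\<close>

lemma generic_deriv_matrix_transversality_patch: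
  fixes f :: "real^'n \<Rightarrow> real^'m" and G :: "real^'n \<Rightarrow> real^'l"
    and M S T L :: "(real^'n^'l) set"
  assumes V: "open V" and f: "smooth_on V f" and inj: "\<And>x. x \<in> V \<Longrightarrow> inj (frechet_derivative f (at x))"
    and G: "smooth_on V G"
    and diffeo: "diffeomorphism S T h h'" and L: "subspace L" and hM: "h ` (S \<inter> M) = T \<inter> L"
  defines "\<mu> \<equiv> \<lambda>\<pi> x. deriv_matrix G x + \<pi> ** deriv_matrix f x"
  defines "Bad \<equiv> \<lambda>S. {\<pi>. \<exists>x\<in>V. \<mu> \<pi> x \<in> S \<inter> M \<and>
    (\<exists>Q. \<forall>\<xi> c. tangent_to M (\<mu> \<pi> x) c \<longrightarrow> Q \<noteq> frechet_derivative (\<mu> \<pi>) (at x) \<xi> + c)}"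
  shows "negligible (Bad S)"
proof -
  have oT: "open T" and hom: "homeomorphism S T h h'" and h': "smooth_on T h'"
    using diffeo unfolding diffeomorphism_def by auto
  obtain P where P: "linear P" "\<And>x. P x \<in> L" "\<And>x w. w \<in> L \<Longrightarrow> P x \<bullet> w = x \<bullet> w"
    "\<And>w. w \<in> L \<Longrightarrow> P w = w"
    by (rule orthogonal_projection_exists[OF L]) (rule that)
  have blP: "bounded_linear P" using P(1) linear_conv_bounded_linear by blast
  define Z where "Z = (\<lambda>z::((real^'n) \<times> (real^'n^'l)) \<times> (real^'m^'l). fst (fst z)) -` V \<inter> (\<lambda>z. P (snd (fst z))) -` T"
  define \<Psi> where "\<Psi> z = deriv_matrix G (fst (fst z)) + snd z ** deriv_matrix f (fst (fst z)) - h' (P (snd (fst z)))"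
    for z :: "((real^'n) \<times> (real^'n^'l)) \<times> (real^'m^'l)"
  have oZ: "open Z"
    unfolding Z_def
    by (intro open_Int open_vimage V oT continuous_intros
        linear_continuous_on_compose[OF _ P(1)])
  have smx: "smooth_on Z (\<lambda>z. fst (fst z))" and smy: "smooth_on Z (\<lambda>z. P (snd (fst z)))"
    and smp: "smooth_on Z (\<lambda>z. snd z)"
    by (intro smooth_on_linear_compose[OF oZ linear_fst] smooth_on_linear_compose[OF oZ linear_snd]
        smooth_on_linear_compose[OF oZ P(1)] smooth_on_id)+
  have sm_jac: "smooth_on Z (\<lambda>z. deriv_matrix g (fst (fst z)))" if "smooth_on V g" for g :: "real^'n \<Rightarrow> real^'i"
    by (rule smooth_on_compose[OF oZ V _ smooth_on_deriv_matrix[OF V that] smx]) (auto simp: Z_def)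
  have sm\<Psi>: "smooth_on Z \<Psi>"
    unfolding \<Psi>_def
  proof (intro smooth_on_diff smooth_on_add oZ)
    show "smooth_on Z (\<lambda>z. h' (P (snd (fst z))))"
      by (rule smooth_on_compose[OF oZ oT _ h' smy]) (auto simp: Z_def)
  qed (intro smooth_on_bounded_bilinear[OF oZ bounded_bilinear_matrix_mult] smp sm_jac f G)+
  have D\<mu>: "(\<mu> \<pi> has_derivative (\<lambda>\<xi>. frechet_derivative (deriv_matrix G) (at x) \<xi>
      + \<pi> ** frechet_derivative (deriv_matrix f) (at x) \<xi>)) (at x)" if "x \<in> V" for \<pi> x
    unfolding \<mu>_def
    by (intro has_derivative_add smooth_on_has_derivative[OF smooth_on_deriv_matrix[OF V G] that]
        bounded_linear.has_derivative[OF
          bounded_bilinear.bounded_linear_right[OF bounded_bilinear_matrix_mult]]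
        smooth_on_has_derivative[OF smooth_on_deriv_matrix[OF V f] that])
  have D\<Psi>: "frechet_derivative \<Psi> (at ((x, y), \<pi>)) v = frechet_derivative (deriv_matrix G) (at x) (fst (fst v))
      + (\<pi> ** frechet_derivative (deriv_matrix f) (at x) (fst (fst v)) + snd v ** deriv_matrix f x)
      - frechet_derivative h' (at (P y)) (P (snd (fst v)))"
    if z: "((x, y), \<pi>) \<in> Z" for x y \<pi> v
  proof -
    let ?z = "((x, y), \<pi>)"
    have xV: "x \<in> V" and yT: "P y \<in> T" using z unfolding Z_def by auto
    have 1: "((\<lambda>z. deriv_matrix g (fst (fst z))) has_derivative
        (\<lambda>v. frechet_derivative (deriv_matrix g) (at x) (fst (fst v)))) (at ?z)"
      if "smooth_on V g" for g :: "real^'n \<Rightarrow> real^'i"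
    proof (rule has_derivative_compose[where f = "\<lambda>z. fst (fst z)"])
      show "((\<lambda>z. fst (fst z)) has_derivative (\<lambda>v. fst (fst v))) (at ?z)"
        by (intro has_derivative_fst has_derivative_ident)
    qed (use smooth_on_has_derivative[OF smooth_on_deriv_matrix[OF V that] xV] in simp)
    have 2: "((\<lambda>z. h' (P (snd (fst z)))) has_derivative
        (\<lambda>v. frechet_derivative h' (at (P y)) (P (snd (fst v))))) (at ?z)"
    proof -
      have "((\<lambda>z. P (snd (fst z))) has_derivative (\<lambda>v. P (snd (fst v)))) (at ?z)"
        by (intro bounded_linear.has_derivative[OF blP] has_derivative_snd has_derivative_fst
            has_derivative_ident)
      from has_derivative_compose[OF this, of h'] smooth_on_has_derivative[OF h' yT]
      show ?thesis by simp
    qed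
    have "((\<lambda>z. snd z ** deriv_matrix f (fst (fst z))) has_derivative
        (\<lambda>v. snd ?z ** frechet_derivative (deriv_matrix f) (at x) (fst (fst v))
          + snd v ** deriv_matrix f (fst (fst ?z)))) (at ?z)"
      by (intro bounded_bilinear.FDERIV[OF bounded_bilinear_matrix_mult] 1 f has_derivative_snd
          has_derivative_ident)
    from has_derivative_diff[OF has_derivative_add[OF 1[OF G] this] 2]
    show ?thesis unfolding \<Psi>_def[abs_def]
      by (subst frechet_derivative_eqI) auto
  qed
  have "surj (\<lambda>\<delta>. frechet_derivative \<Psi> (at z) (0, \<delta>))" if z: "z \<in> Z" for z
  proof -
    obtain x y \<pi> where z_eq: "z = ((x, y), \<pi>)" by (metis surj_pair)
    have xV: "x \<in> V" and yT: "P y \<in> T" using z z_eq unfolding Z_def by auto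
    have lin: "linear (frechet_derivative f (at x))" using smooth_on_linear_derivative[OF f xV] .
    obtain B where B: "B ** deriv_matrix f x = mat 1"
      using inj[OF xV] matrix_left_invertible_injective[of "deriv_matrix f x"] matrix_works[of "frechet_derivative f (at x)"] lin
      by (auto simp: linear_matrix_vector_mul_eq)
    have lins: "linear (frechet_derivative (deriv_matrix G) (at x))" "linear (frechet_derivative (deriv_matrix f) (at x))"
      "linear (frechet_derivative h' (at (P y)))"
      by (intro smooth_on_linear_derivative[OF smooth_on_deriv_matrix[OF V]] f G xV
          smooth_on_linear_derivative[OF h' yT])+
    have "frechet_derivative \<Psi> (at z) (0, \<delta>) = \<delta> ** deriv_matrix f x" for \<delta>
      using D\<Psi>[of x y \<pi> "(0, \<delta>)"] z linear_0[OF lins(1)] linear_0[OF lins(2)] linear_0[OF lins(3)]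
        linear_0[OF P(1)] unfolding z_eq
      by (simp only: fst_zero snd_zero fst_conv snd_conv matrix_mult_zero add_0_left diff_zero)
    moreover have "(Q ** B) ** deriv_matrix f x = Q" for Q :: "real^'n^'l"
      by (simp only: matrix_mul_assoc[symmetric] B matrix_mul_rid)
    ultimately show ?thesis by (intro surjI[of _ "\<lambda>Q. Q ** B"]) simp
  qed
  from parametric_transversality[OF oZ sm\<Psi> this]
  have neg: "negligible {\<pi>. \<exists>x. (x, \<pi>) \<in> Z \<and> \<Psi> (x, \<pi>) = 0 \<and>
    \<not> surj (\<lambda>\<xi>. frechet_derivative \<Psi> (at (x, \<pi>)) (\<xi>, 0))}" by blast
  show ?thesis
  proof (rule negligible_subset[OF neg], rule subsetI)
    fix \<pi> assume "\<pi> \<in> Bad S"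
    then obtain x Q where x: "x \<in> V" "\<mu> \<pi> x \<in> S \<inter> M"
      and Q: "\<And>\<xi> c. tangent_to M (\<mu> \<pi> x) c \<Longrightarrow> Q \<noteq> frechet_derivative (\<mu> \<pi>) (at x) \<xi> + c"
      unfolding Bad_def by blast
    define y where "y = h (\<mu> \<pi> x)"
    have y: "y \<in> T \<inter> L" unfolding y_def using hM x(2) by blast
    have h'y: "h' y = \<mu> \<pi> x" unfolding y_def using homeomorphism_apply1[OF hom] x(2) by blast
    have Py: "P y = y" using P(4) y by blast
    have z: "((x, y), \<pi>) \<in> Z" unfolding Z_def using x(1) y Py by simp
    have "\<Psi> ((x, y), \<pi>) = 0" unfolding \<Psi>_def using Py h'y by (simp add: \<mu>_def)
    moreover have "Q \<noteq> frechet_derivative \<Psi> (at ((x, y), \<pi>)) (v, 0)" for v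
    proof -
      obtain \<xi> \<eta> where v: "v = (\<xi>, \<eta>)" by fastforce
      have lin: "linear (frechet_derivative h' (at y))" using smooth_on_linear_derivative[OF h'] y by blast
      have "frechet_derivative \<Psi> (at ((x, y), \<pi>)) (v, 0)
          = frechet_derivative (\<mu> \<pi>) (at x) \<xi> + frechet_derivative h' (at y) (- P \<eta>)"
        using D\<Psi>[OF z, of "(v, 0)"] unfolding v Py frechet_derivative_eqI[OF D\<mu>[OF x(1)]] linear_neg[OF lin]
        by (simp only: fst_conv snd_conv matrix_mult_zero add_0_right diff_conv_add_uminus)
      moreover have "tangent_to M (\<mu> \<pi> x) (frechet_derivative h' (at y) (- P \<eta>))"
        using tangent_to_flattened[OF diffeo L hM y, of "- P \<eta>"] h'y L P(2) subspace_neg by metis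
      ultimately show ?thesis using Q by metis
    qed
    then have "\<not> surj (\<lambda>\<xi>. frechet_derivative \<Psi> (at ((x, y), \<pi>)) (\<xi>, 0))"
      unfolding surj_def by blast
    ultimately show "\<pi> \<in> {\<pi>. \<exists>x. (x, \<pi>) \<in> Z \<and> \<Psi> (x, \<pi>) = 0 \<and>
      \<not> surj (\<lambda>\<xi>. frechet_derivative \<Psi> (at (x, \<pi>)) (\<xi>, 0))}" using z by blast
  qed
qed

text \<open>
  Countably many flattening neighbourhoods cover \<open>M\<close>.
\<close>

theorem generic_deriv_matrix_transversality:
  fixes f :: "real^'n \<Rightarrow> real^'m" and G :: "real^'n \<Rightarrow> real^'l" and M :: "(real^'n^'l) set"
  assumes V: "open V" and f: "smooth_on V f" and inj: "\<And>x. x \<in> V \<Longrightarrow> inj (frechet_derivative f (at x))"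
    and G: "smooth_on V G" and M: "euclidean_submanifold k M"
  defines "\<mu> \<equiv> \<lambda>\<pi> x. deriv_matrix G x + \<pi> ** deriv_matrix f x"
  shows "negligible {\<pi>. \<exists>x\<in>V. \<mu> \<pi> x \<in> M \<and>
    (\<exists>Q. \<forall>\<xi> c. tangent_to M (\<mu> \<pi> x) c \<longrightarrow> Q \<noteq> frechet_derivative (\<mu> \<pi>) (at x) \<xi> + c)}"
proof -
  define Bad where "Bad = (\<lambda>S. {\<pi>. \<exists>x\<in>V. \<mu> \<pi> x \<in> S \<inter> M \<and>
    (\<exists>Q. \<forall>\<xi> c. tangent_to M (\<mu> \<pi> x) c \<longrightarrow> Q \<noteq> frechet_derivative (\<mu> \<pi>) (at x) \<xi> + c)})"
  define \<N> where "\<N> = {S. open S \<and> negligible (Bad S)}"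
  have cover: "\<exists>S\<in>\<N>. y \<in> S" if y: "y \<in> M" for y
  proof -
    obtain S and T :: "(real^'n^'l) set" and h h' L where
      y: "y \<in> S" and p: "diffeomorphism S T h h'" "subspace L" "h ` (S \<inter> M) = T \<inter> L"
      using M y unfolding euclidean_submanifold_def by metis
    have "negligible (Bad S)"
      unfolding Bad_def \<mu>_def by (rule generic_deriv_matrix_transversality_patch[OF V f inj G p])
    then show ?thesis using y p(1) unfolding \<N>_def diffeomorphism_def by blast
  qed
  obtain \<N>' where \<N>': "\<N>' \<subseteq> \<N>" "countable \<N>'" "\<Union>\<N>' = \<Union>\<N>"
    using Lindelof[of \<N>] \<N>_def by blast
  have "negligible (\<Union>S\<in>\<N>'. Bad S)"
    using \<N>'(1,2) unfolding \<N>_def by (intro negligible_countable_UN) auto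
  moreover have "{\<pi>. \<exists>x\<in>V. \<mu> \<pi> x \<in> M \<and>
    (\<exists>Q. \<forall>\<xi> c. tangent_to M (\<mu> \<pi> x) c \<longrightarrow> Q \<noteq> frechet_derivative (\<mu> \<pi>) (at x) \<xi> + c)} \<subseteq> (\<Union>S\<in>\<N>'. Bad S)"
  proof
    fix \<pi> assume "\<pi> \<in> {\<pi>. \<exists>x\<in>V. \<mu> \<pi> x \<in> M \<and>
      (\<exists>Q. \<forall>\<xi> c. tangent_to M (\<mu> \<pi> x) c \<longrightarrow> Q \<noteq> frechet_derivative (\<mu> \<pi>) (at x) \<xi> + c)}"
    then obtain x where x: "x \<in> V" "\<mu> \<pi> x \<in> M"
      "\<exists>Q. \<forall>\<xi> c. tangent_to M (\<mu> \<pi> x) c \<longrightarrow> Q \<noteq> frechet_derivative (\<mu> \<pi>) (at x) \<xi> + c" by blast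
    have "\<mu> \<pi> x \<in> \<Union>\<N>'" using cover[OF x(2)] \<N>'(3) by blast
    then obtain S where "S \<in> \<N>'" "\<mu> \<pi> x \<in> S" by blast
    then show "\<pi> \<in> (\<Union>S\<in>\<N>'. Bad S)" unfolding Bad_def using x by blast
  qed
  ultimately show ?thesis by (rule negligible_subset)
qed

section \<open>Charts, curves and tangent vectors\<close>

lemma smooth_atlasD:
  assumes "smooth_atlas A" "(V, \<phi>) \<in> A"
  shows "inj_on \<phi> V" "open (\<phi> ` V)"
    and "(V', \<phi>') \<in> A \<Longrightarrow> open (\<phi> ` (V \<inter> V'))"
    and "(V', \<phi>') \<in> A \<Longrightarrow> smooth_on (\<phi> ` (V \<inter> V')) (\<phi>' \<circ> inv_into V \<phi>)"
  using assms unfolding smooth_atlas_def by fast+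

lemma smooth_atlas_euclidean: "smooth_atlas (euclidean_atlas UNIV)"
  unfolding smooth_atlas_def euclidean_atlas_def
  by (auto simp: inv_id o_def id_def intro: smooth_on_id)

lemma smooth_at_euclidean:
  "smooth_at (euclidean_atlas UNIV) g x \<longleftrightarrow> (\<exists>S. open S \<and> x \<in> S \<and> smooth_on S g)"
  unfolding smooth_at_def euclidean_atlas_def by (auto simp: inv_id)

lemma coordinate_change_eq:
  assumes A: "smooth_atlas A" "(V, \<phi>) \<in> A" "(V', \<phi>') \<in> A" and x: "x \<in> \<phi> ` (V \<inter> V')"
  shows "(g \<circ> inv_into V \<phi>) x = (g \<circ> inv_into V' \<phi>') ((\<phi>' \<circ> inv_into V \<phi>) x)"
    and "(\<phi>' \<circ> inv_into V \<phi>) x \<in> \<phi>' ` (V \<inter> V')"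
  using x smooth_atlasD(1)[OF A(1,2)] smooth_atlasD(1)[OF A(1,3)] by (auto simp: inv_into_f_f)

lemma transition_has_derivative:
  assumes A: "smooth_atlas A" "(V, \<phi>) \<in> A" "(V', \<phi>') \<in> A" and q: "q \<in> V" "q \<in> V'"
  shows "((\<phi>' \<circ> inv_into V \<phi>) has_derivative
    frechet_derivative (\<phi>' \<circ> inv_into V \<phi>) (at (\<phi> q))) (at (\<phi> q))"
  using smooth_on_has_derivative[OF smooth_atlasD(4)[OF A]] q by blast

lemma coordinate_change_derivative:
  assumes A: "smooth_atlas A" "(V, \<phi>) \<in> A" "(V', \<phi>') \<in> A" and q: "q \<in> V" "q \<in> V'"
    and D: "((g \<circ> inv_into V' \<phi>') has_derivative D) (at (\<phi>' q))"
  shows "((g \<circ> inv_into V \<phi>) has_derivative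
    (\<lambda>v. D (frechet_derivative (\<phi>' \<circ> inv_into V \<phi>) (at (\<phi> q)) v))) (at (\<phi> q))"
proof -
  have "(\<phi>' \<circ> inv_into V \<phi>) (\<phi> q) = \<phi>' q"
    using smooth_atlasD(1)[OF A(1,2)] q(1) by (simp add: inv_into_f_f)
  with D have "((g \<circ> inv_into V' \<phi>') has_derivative D) (at ((\<phi>' \<circ> inv_into V \<phi>) (\<phi> q)))" by simp
  from has_derivative_compose[OF transition_has_derivative[OF A q] this]
  moreover have "\<phi> q \<in> \<phi> ` (V \<inter> V')" using q by blast
  ultimately show ?thesis
    using has_derivative_eq_on_open[OF smooth_atlasD(3)[OF A], of "\<phi> q" "g \<circ> inv_into V \<phi>"
        "\<lambda>x. (g \<circ> inv_into V' \<phi>') ((\<phi>' \<circ> inv_into V \<phi>) x)", OF _ coordinate_change_eq(1)[OF A]]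
    by (simp only: simp_thms)
qed

text \<open>
  The coordinate change rule applied to the chart itself, whose own coordinate expression is the
  identity.
\<close>

lemma transition_derivative_inverse:
  assumes A: "smooth_atlas A" "(V, \<phi>) \<in> A" "(V', \<phi>') \<in> A" and q: "q \<in> V" "q \<in> V'"
  shows "frechet_derivative (\<phi> \<circ> inv_into V' \<phi>') (at (\<phi>' q))
    (frechet_derivative (\<phi>' \<circ> inv_into V \<phi>) (at (\<phi> q)) v) = v"
proof -
  have "((\<phi> \<circ> inv_into V \<phi>) has_derivative (\<lambda>v. v)) (at (\<phi> q))"
    using has_derivative_eq_on_open[OF smooth_atlasD(2)[OF A(1,2)], of "\<phi> q" "\<phi> \<circ> inv_into V \<phi>" "\<lambda>x. x"]
      q(1) by (auto simp: f_inv_into_f)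
  moreover have "((\<phi> \<circ> inv_into V \<phi>) has_derivative (\<lambda>v. frechet_derivative (\<phi> \<circ> inv_into V' \<phi>') (at (\<phi>' q))
      (frechet_derivative (\<phi>' \<circ> inv_into V \<phi>) (at (\<phi> q)) v))) (at (\<phi> q))"
    by (rule coordinate_change_derivative[OF A q transition_has_derivative[OF A(1,3,2) q(2,1)]])
  ultimately show ?thesis using has_derivative_unique by metis
qed

lemma smooth_at_in_chart:
  assumes A: "smooth_atlas A" "(V, \<phi>) \<in> A" and q: "q \<in> V" and g: "smooth_at A g q"
  shows "\<exists>S. open S \<and> \<phi> q \<in> S \<and> S \<subseteq> \<phi> ` V \<and> smooth_on S (g \<circ> inv_into V \<phi>)"
proof -
  obtain V' \<phi>' S' where A': "(V', \<phi>') \<in> A" and q': "q \<in> V'" and S': "open S'" "\<phi>' q \<in> S'" "S' \<subseteq> \<phi>' ` V'"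
    "smooth_on S' (g \<circ> inv_into V' \<phi>')"
    using g unfolding smooth_at_def by blast
  define S where "S = \<phi> ` (V \<inter> V') \<inter> (\<phi>' \<circ> inv_into V \<phi>) -` S'"
  have oS: "open S"
    unfolding S_def
    using smooth_on_imp_continuous_on[OF smooth_atlasD(4)[OF A A']] smooth_atlasD(3)[OF A A'] S'(1)
    by (rule continuous_open_preimage)
  have "\<phi> q \<in> S" unfolding S_def
    using q q' S'(2) smooth_atlasD(1)[OF A] by (auto simp: inv_into_f_f)
  moreover have "smooth_on S (g \<circ> inv_into V \<phi>)"
  proof -
    have "smooth_on S (\<lambda>x. (g \<circ> inv_into V' \<phi>') ((\<phi>' \<circ> inv_into V \<phi>) x))"
    proof (rule smooth_on_compose[OF oS S'(1) _ S'(4)])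
      show "smooth_on S (\<phi>' \<circ> inv_into V \<phi>)"
        using smooth_on_subset[OF smooth_atlasD(4)[OF A A']] unfolding S_def by blast
    qed (auto simp: S_def)
    then show ?thesis
      using smooth_on_cong[OF oS] coordinate_change_eq(1)[OF A A'] unfolding S_def by (metis IntD1)
  qed
  ultimately show ?thesis using oS unfolding S_def by blast
qed

lemma smooth_at_has_derivative:
  assumes "smooth_atlas A" "(V, \<phi>) \<in> A" "q \<in> V" "smooth_at A g q"
  shows "((g \<circ> inv_into V \<phi>) has_derivative frechet_derivative (g \<circ> inv_into V \<phi>) (at (\<phi> q))) (at (\<phi> q))"
  using smooth_at_in_chart[OF assms] smooth_on_has_derivative by blast

lemma smooth_in_chart:
  assumes A: "smooth_atlas A" "(V, \<phi>) \<in> A" and g: "\<And>q. q \<in> V \<Longrightarrow> smooth_at A g q"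
  shows "smooth_on (\<phi> ` V) (g \<circ> inv_into V \<phi>)"
proof (rule smooth_on_local)
  fix x assume "x \<in> \<phi> ` V"
  then obtain q where "q \<in> V" "x = \<phi> q" by blast
  then show "\<exists>T. open T \<and> x \<in> T \<and> smooth_on T (g \<circ> inv_into V \<phi>)"
    using smooth_at_in_chart[OF A _ g] by blast
qed

lemma smooth_atI:
  assumes "(V, \<phi>) \<in> A" "q \<in> V" "open (\<phi> ` V)" "smooth_on (\<phi> ` V) (g \<circ> inv_into V \<phi>)"
  shows "smooth_at A g q"
  unfolding smooth_at_def using assms by blast

lemma smooth_curve_in_chart:
  assumes A: "smooth_atlas A" "(V, \<phi>) \<in> A" and p: "p \<in> V" and c: "smooth_curve A c p"
  shows "\<exists>\<epsilon>>0. c ` {-\<epsilon><..<\<epsilon>} \<subseteq> V \<and> smooth_on {-\<epsilon><..<\<epsilon>} (\<phi> \<circ> c)"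
proof -
  obtain \<delta> V' \<phi>' where c0: "c 0 = p" and \<delta>: "\<delta> > 0" and A': "(V', \<phi>') \<in> A"
    and c': "c ` {-\<delta><..<\<delta>} \<subseteq> V'" "smooth_on {-\<delta><..<\<delta>} (\<phi>' \<circ> c)"
    using c unfolding smooth_curve_def by blast
  \<comment> \<open>The parameters for which the curve lies in both chart domains, expressed by an open condition on
      the coordinates.\<close>
  define U where "U = {-\<delta><..<\<delta>} \<inter> (\<phi>' \<circ> c) -` (\<phi>' ` (V' \<inter> V))"
  have "open U"
    unfolding U_def
    by (rule continuous_open_preimage[OF smooth_on_imp_continuous_on[OF c'(2)]])
      (auto intro: smooth_atlasD(3)[OF A(1) A' A(2)])
  moreover have "c 0 \<in> V'" using c'(1) \<delta> by (auto simp: image_subset_iff)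
  then have "0 \<in> U" unfolding U_def using c0 p \<delta> by auto
  ultimately obtain \<epsilon> where \<epsilon>: "\<epsilon> > 0" "ball 0 \<epsilon> \<subseteq> U" using open_contains_ball by blast
  have eU: "{-\<epsilon><..<\<epsilon>} \<subseteq> U" using \<epsilon>(2) by (auto simp: dist_real_def subset_iff)
  have cV: "c t \<in> V' \<inter> V" if "t \<in> U" for t
  proof -
    from that obtain x where x: "x \<in> V' \<inter> V" "\<phi>' (c t) = \<phi>' x" and "c t \<in> V'"
      using c'(1) unfolding U_def by (auto simp: image_subset_iff)
    then have "c t = x" using inj_onD[OF smooth_atlasD(1)[OF A(1) A']] by blast
    then show ?thesis using x(1) by simp
  qed
  have "smooth_on {-\<epsilon><..<\<epsilon>} (\<lambda>t. (\<phi> \<circ> inv_into V' \<phi>') ((\<phi>' \<circ> c) t))"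
  proof (rule smooth_on_compose[OF _ smooth_atlasD(3)[OF A(1) A' A(2)] _ smooth_atlasD(4)[OF A(1) A' A(2)]])
    show "smooth_on {-\<epsilon><..<\<epsilon>} (\<phi>' \<circ> c)" using smooth_on_subset[OF c'(2)] eU unfolding U_def by blast
    show "(\<phi>' \<circ> c) ` {-\<epsilon><..<\<epsilon>} \<subseteq> \<phi>' ` (V' \<inter> V)" using eU unfolding U_def by blast
  qed auto
  moreover have "(\<phi> \<circ> inv_into V' \<phi>') ((\<phi>' \<circ> c) t) = (\<phi> \<circ> c) t" if "t \<in> {-\<epsilon><..<\<epsilon>}" for t
    using cV[of t] eU that smooth_atlasD(1)[OF A(1) A'] by (auto simp: inv_into_f_f)
  ultimately have "smooth_on {-\<epsilon><..<\<epsilon>} (\<phi> \<circ> c)"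
    using smooth_on_cong[of "{-\<epsilon><..<\<epsilon>}"] by (metis (no_types, lifting) open_greaterThanLessThan)
  then show ?thesis using \<epsilon>(1) cV eU by blast
qed

text \<open>
  The tangent vector with coordinates \<open>\<xi>\<close> in the chart \<open>\<kappa>\<close>: its coordinates in the other charts around
  \<open>p\<close> are dictated by the derivatives of the transition maps. This describes the tangent space
  without curves.
\<close>

definition tangent_of_coords ::
    "('p, 'e::euclidean_space) atlas \<Rightarrow> ('p, 'e) chart \<Rightarrow> 'p \<Rightarrow> 'e \<Rightarrow> ('p, 'e) tangent" where
  "tangent_of_coords A \<kappa> p \<xi> = (\<lambda>(V, \<psi>). if (V, \<psi>) \<in> A \<and> p \<in> V
     then frechet_derivative (\<psi> \<circ> inv_into (fst \<kappa>) (snd \<kappa>)) (at (snd \<kappa> p)) \<xi> else 0)"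

text \<open>
  The curve may be smooth with respect to a chart other than \<open>\<phi>\<close>; near 0 it nevertheless runs inside
  \<open>V\<close>, where the chain rule applies.
\<close>

lemma has_vector_derivative_along_curve:
  assumes A: "smooth_atlas A" "(V, \<phi>) \<in> A" and p: "p \<in> V" and c: "smooth_curve A c p"
    and \<xi>: "((\<phi> \<circ> c) has_vector_derivative \<xi>) (at 0)"
    and D: "((g \<circ> inv_into V \<phi>) has_derivative D) (at (\<phi> p))"
  shows "((g \<circ> c) has_vector_derivative D \<xi>) (at 0)"
proof -
  have c0: "c 0 = p" using c unfolding smooth_curve_def by blast
  obtain \<epsilon> where \<epsilon>: "\<epsilon> > 0" "c ` {-\<epsilon><..<\<epsilon>} \<subseteq> V"
    using smooth_curve_in_chart[OF A p c] by blast
  have "((g \<circ> inv_into V \<phi>) has_derivative D) (at ((\<phi> \<circ> c) 0))"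
    using D c0 by (simp only: o_apply)
  from has_derivative_compose[OF \<xi>[unfolded has_vector_derivative_def] this]
  have "((\<lambda>t. (g \<circ> inv_into V \<phi>) ((\<phi> \<circ> c) t)) has_derivative (\<lambda>t. D (t *\<^sub>R \<xi>))) (at 0)" .
  moreover have "(g \<circ> inv_into V \<phi>) ((\<phi> \<circ> c) t) = (g \<circ> c) t" if "t \<in> {-\<epsilon><..<\<epsilon>}" for t
    using \<epsilon>(2) that inv_into_f_f[OF smooth_atlasD(1)[OF A], of "c t"]
    by (simp add: image_subset_iff)
  ultimately have "((g \<circ> c) has_derivative (\<lambda>t. D (t *\<^sub>R \<xi>))) (at 0)"
    using has_derivative_eq_on_open[of "{-\<epsilon><..<\<epsilon>}" 0 "\<lambda>t. (g \<circ> inv_into V \<phi>) ((\<phi> \<circ> c) t)" "g \<circ> c"]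
      \<epsilon>(1) by (simp del: o_apply)
  then show ?thesis
    unfolding has_vector_derivative_def using linear_cmul[OF has_derivative_linear[OF D]] by simp
qed

lemma velocity_eq_tangent_of_coords:
  fixes A :: "('a, 'b::euclidean_space) atlas"
  assumes A: "smooth_atlas A" "(V, \<phi>) \<in> A" and p: "p \<in> V" and c: "smooth_curve A c p"
    and \<xi>: "((\<phi> \<circ> c) has_vector_derivative \<xi>) (at 0)"
  shows "velocity A c = tangent_of_coords A (V, \<phi>) p \<xi>"
proof (rule ext)
  fix \<kappa> :: "('a, 'b) chart"
  obtain V' \<psi> where \<kappa>: "\<kappa> = (V', \<psi>)" by fastforce
  have c0: "c 0 = p" using c unfolding smooth_curve_def by blast
  show "velocity A c \<kappa> = tangent_of_coords A (V, \<phi>) p \<xi> \<kappa>"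
  proof (cases "(V', \<psi>) \<in> A \<and> p \<in> V'")
    case True
    have "((\<psi> \<circ> inv_into V \<phi>) has_derivative
        frechet_derivative (\<psi> \<circ> inv_into V \<phi>) (at (\<phi> p))) (at (\<phi> p))"
      using transition_has_derivative[OF A _ p, of V' \<psi>] True by blast
    from vector_derivative_at[OF has_vector_derivative_along_curve[OF A p c \<xi> this]]
    show ?thesis
      unfolding velocity_def tangent_of_coords_def \<kappa> using True c0 by simp
  qed (auto simp: velocity_def tangent_of_coords_def \<kappa> c0)
qed

text \<open>
  Curves in the image of a chart lift to curves in the manifold; this is the source of all tangent
  vectors constructed below.
\<close>

lemma curve_of_coords:
  assumes A: "(V, \<phi>) \<in> A" "inj_on \<phi> V" and p: "p \<in> V"
    and \<gamma>: "\<epsilon> > 0" "smooth_on {-\<epsilon><..<\<epsilon>} \<gamma>" "\<gamma> ` {-\<epsilon><..<\<epsilon>} \<subseteq> \<phi> ` V" "\<gamma> 0 = \<phi> p"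
    and \<xi>: "(\<gamma> has_vector_derivative \<xi>) (at 0)"
  shows "smooth_curve A (inv_into V \<phi> \<circ> \<gamma>) p"
    and "((\<phi> \<circ> (inv_into V \<phi> \<circ> \<gamma>)) has_vector_derivative \<xi>) (at 0)"
proof -
  have eq: "(\<phi> \<circ> (inv_into V \<phi> \<circ> \<gamma>)) t = \<gamma> t" if "t \<in> {-\<epsilon><..<\<epsilon>}" for t
    using \<gamma>(3) that by (auto simp: f_inv_into_f image_subset_iff)
  have "smooth_on {-\<epsilon><..<\<epsilon>} (\<phi> \<circ> (inv_into V \<phi> \<circ> \<gamma>))"
    using smooth_on_cong[of "{-\<epsilon><..<\<epsilon>}" "\<phi> \<circ> (inv_into V \<phi> \<circ> \<gamma>)" \<gamma>] eq \<gamma>(2) by simp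
  moreover have "(inv_into V \<phi> \<circ> \<gamma>) ` {-\<epsilon><..<\<epsilon>} \<subseteq> V"
    using \<gamma>(3) by (auto simp: image_subset_iff inv_into_into)
  moreover have "(inv_into V \<phi> \<circ> \<gamma>) 0 = p" using \<gamma>(4) A(2) p by simp
  ultimately show "smooth_curve A (inv_into V \<phi> \<circ> \<gamma>) p"
    unfolding smooth_curve_def using A(1) \<gamma>(1) by blast
  show "((\<phi> \<circ> (inv_into V \<phi> \<circ> \<gamma>)) has_vector_derivative \<xi>) (at 0)"
    using has_derivative_eq_on_open[of "{-\<epsilon><..<\<epsilon>}" 0 \<gamma>] eq \<gamma>(1) \<xi>
    unfolding has_vector_derivative_def by (metis greaterThanLessThan_iff neg_less_0_iff_less open_greaterThanLessThan)
qed

lemma line_in_open: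
  fixes x v :: "'a::real_normed_vector"
  assumes "open S" "x \<in> S"
  obtains \<epsilon> where "\<epsilon> > 0" "\<And>t. t \<in> {-\<epsilon><..<\<epsilon>} \<Longrightarrow> x + t *\<^sub>R v \<in> S"
proof -
  have "open ((\<lambda>t::real. x + t *\<^sub>R v) -` S)" by (intro open_vimage assms(1) continuous_intros)
  moreover have "0 \<in> (\<lambda>t::real. x + t *\<^sub>R v) -` S" using assms(2) by simp
  ultimately obtain \<epsilon> where "\<epsilon> > 0" "ball 0 \<epsilon> \<subseteq> (\<lambda>t::real. x + t *\<^sub>R v) -` S"
    using open_contains_ball by blast
  then show thesis by (intro that[of \<epsilon>]) (auto simp: subset_iff dist_real_def)
qed

lemma smooth_on_line: "open S \<Longrightarrow> smooth_on S (\<lambda>t::real. x + t *\<^sub>R v)"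
  by (intro smooth_on_add smooth_on_const smooth_on_scaleR smooth_on_id)

lemma line_has_vector_derivative: "((\<lambda>t. x + t *\<^sub>R v) has_vector_derivative v) (at 0)"
  unfolding has_vector_derivative_def by (auto intro!: derivative_eq_intros)

lemma tangent_space_eq_range:
  assumes A: "smooth_atlas A" "(V, \<phi>) \<in> A" and p: "p \<in> V"
  shows "tangent_space A p = range (tangent_of_coords A (V, \<phi>) p)"
proof (intro equalityI subsetI)
  fix v assume "v \<in> tangent_space A p"
  then obtain c where c: "smooth_curve A c p" "v = velocity A c" unfolding tangent_space_def by blast
  obtain \<epsilon> where \<epsilon>: "\<epsilon> > 0" "smooth_on {-\<epsilon><..<\<epsilon>} (\<phi> \<circ> c)"
    using smooth_curve_in_chart[OF A p c(1)] by blast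
  then have "(\<phi> \<circ> c) differentiable (at 0)" by (intro smooth_on_differentiable) auto
  then have "((\<phi> \<circ> c) has_vector_derivative vector_derivative (\<phi> \<circ> c) (at 0)) (at 0)"
    by (simp add: vector_derivative_works)
  from velocity_eq_tangent_of_coords[OF A p c(1) this] c(2)
  show "v \<in> range (tangent_of_coords A (V, \<phi>) p)" by simp
next
  fix v assume "v \<in> range (tangent_of_coords A (V, \<phi>) p)"
  then obtain \<xi> where v: "v = tangent_of_coords A (V, \<phi>) p \<xi>" by blast
  obtain \<epsilon> where \<epsilon>: "\<epsilon> > 0" "\<And>t. t \<in> {-\<epsilon><..<\<epsilon>} \<Longrightarrow> \<phi> p + t *\<^sub>R \<xi> \<in> \<phi> ` V"
    using line_in_open[OF smooth_atlasD(2)[OF A]] p by blast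
  note c = curve_of_coords[OF A(2) smooth_atlasD(1)[OF A] p \<epsilon>(1) smooth_on_line _ _ line_has_vector_derivative, of "\<phi> p" \<xi>]
  have "smooth_curve A (inv_into V \<phi> \<circ> (\<lambda>t. \<phi> p + t *\<^sub>R \<xi>)) p"
    "((\<phi> \<circ> (inv_into V \<phi> \<circ> (\<lambda>t. \<phi> p + t *\<^sub>R \<xi>))) has_vector_derivative \<xi>) (at 0)"
    using \<epsilon>(2) by (auto intro!: c)
  from velocity_eq_tangent_of_coords[OF A p this] this(1)
  show "v \<in> tangent_space A p" unfolding tangent_space_def v by (metis (mono_tags, lifting) mem_Collect_eq)
qed

lemma tangent_of_coords_add:
  assumes A: "smooth_atlas A" "(V, \<phi>) \<in> A" and p: "p \<in> V"
  shows "tangent_of_coords A (V, \<phi>) p (\<xi> + \<eta>)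
    = (\<lambda>\<kappa>. tangent_of_coords A (V, \<phi>) p \<xi> \<kappa> + tangent_of_coords A (V, \<phi>) p \<eta> \<kappa>)"
  unfolding tangent_of_coords_def
  using has_derivative_linear[OF transition_has_derivative[OF A _ p]]
  by (auto simp: fun_eq_iff linear_add)

lemma tangent_of_coords_self:
  assumes A: "smooth_atlas A" "(V, \<phi>) \<in> A" and p: "p \<in> V"
  shows "tangent_of_coords A (V, \<phi>) p \<xi> (V, \<phi>) = \<xi>"
proof -
  have "((\<phi> \<circ> inv_into V \<phi>) has_derivative (\<lambda>v. v)) (at (\<phi> p))"
    using has_derivative_eq_on_open[OF smooth_atlasD(2)[OF A], of "\<phi> p" "\<phi> \<circ> inv_into V \<phi>" "\<lambda>x. x"]
      p by (auto simp: f_inv_into_f)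
  then show ?thesis
    unfolding tangent_of_coords_def using A(2) p frechet_derivative_eqI by fastforce
qed

text \<open>
  The differential is defined with a chosen curve representing the tangent vector. All that matters
  is that the chosen curve has the prescribed coordinate velocity, which determines the velocity of
  its image for every smooth map.
\<close>

lemma differential_of_coords:
  assumes A: "smooth_atlas A" "(V, \<phi>) \<in> A" and p: "p \<in> V"
  obtains c where "smooth_curve A c p" "((\<phi> \<circ> c) has_vector_derivative \<xi>) (at 0)"
    "differential A B g p (tangent_of_coords A (V, \<phi>) p \<xi>) = velocity B (g \<circ> c)"
proof -
  let ?v = "tangent_of_coords A (V, \<phi>) p \<xi>"
  define c where "c = (SOME c. smooth_curve A c p \<and> velocity A c = ?v)"
  have "?v \<in> tangent_space A p" unfolding tangent_space_eq_range[OF A p] by blast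
  then have "\<exists>c. ?v = velocity A c \<and> smooth_curve A c p"
    unfolding tangent_space_def by (rule CollectD)
  then have "\<exists>c. smooth_curve A c p \<and> velocity A c = ?v" by metis
  then have c: "smooth_curve A c p" "velocity A c = ?v"
    using someI_ex[of "\<lambda>c. smooth_curve A c p \<and> velocity A c = ?v"] unfolding c_def by simp_all
  obtain \<epsilon> where \<epsilon>: "\<epsilon> > 0" "smooth_on {-\<epsilon><..<\<epsilon>} (\<phi> \<circ> c)"
    using smooth_curve_in_chart[OF A p c(1)] by blast
  then have "(\<phi> \<circ> c) differentiable (at 0)" by (intro smooth_on_differentiable) auto
  then have d: "((\<phi> \<circ> c) has_vector_derivative vector_derivative (\<phi> \<circ> c) (at 0)) (at 0)"
    by (simp add: vector_derivative_works)
  have "tangent_of_coords A (V, \<phi>) p (vector_derivative (\<phi> \<circ> c) (at 0)) = ?v"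
    using velocity_eq_tangent_of_coords[OF A p c(1) d] c(2) by simp
  then have "vector_derivative (\<phi> \<circ> c) (at 0) = \<xi>"
    using tangent_of_coords_self[OF A p] by metis
  then show thesis using that[OF c(1)] d unfolding differential_def c_def by simp
qed

section \<open>The manifold of 1-jets\<close>

lemma jet_rep_jet1:
  assumes "smooth_at A g q"
  shows "fst (jet1 A g q) = q" "smooth_at A (jet_rep (jet1 A g q)) q" "jet_rep (jet1 A g q) q = g q"
    and "(V, \<phi>) \<in> A \<Longrightarrow> q \<in> V \<Longrightarrow>
      frechet_derivative (jet_rep (jet1 A g q) \<circ> inv_into V \<phi>) (at (\<phi> q))
      = frechet_derivative (g \<circ> inv_into V \<phi>) (at (\<phi> q))"
proof -
  have "g \<in> snd (jet1 A g q)" using assms unfolding jet1_def by auto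
  then have "jet_rep (jet1 A g q) \<in> snd (jet1 A g q)" unfolding jet_rep_def by (rule someI[of "\<lambda>h. h \<in> snd (jet1 A g q)"])
  then show "fst (jet1 A g q) = q" "smooth_at A (jet_rep (jet1 A g q)) q" "jet_rep (jet1 A g q) q = g q"
    "(V, \<phi>) \<in> A \<Longrightarrow> q \<in> V \<Longrightarrow>
      frechet_derivative (jet_rep (jet1 A g q) \<circ> inv_into V \<phi>) (at (\<phi> q))
      = frechet_derivative (g \<circ> inv_into V \<phi>) (at (\<phi> q))"
    unfolding jet1_def by auto
qed

text \<open>
  Equality of the derivatives in one chart implies it in all charts.
\<close>

lemma jet1_eqI:
  assumes A: "smooth_atlas A" "(V, \<phi>) \<in> A" and q: "q \<in> V"
    and g: "smooth_at A g q" "smooth_at A g' q" "g q = g' q"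
      "frechet_derivative (g \<circ> inv_into V \<phi>) (at (\<phi> q)) = frechet_derivative (g' \<circ> inv_into V \<phi>) (at (\<phi> q))"
  shows "jet1 A g q = jet1 A g' q"
proof -
  have "frechet_derivative (g \<circ> inv_into V' \<phi>') (at (\<phi>' q)) = frechet_derivative (g' \<circ> inv_into V' \<phi>') (at (\<phi>' q))"
    if "(V', \<phi>') \<in> A" "q \<in> V'" for V' \<phi>'
    using coordinate_change_derivative[OF A(1) that(1) A(2) that(2) q smooth_at_has_derivative[OF A q g(1)]]
      coordinate_change_derivative[OF A(1) that(1) A(2) that(2) q smooth_at_has_derivative[OF A q g(2)]]
      g(4) frechet_derivative_eqI by metis
  then show ?thesis unfolding jet1_def using g(3) by (auto split: prod.splits)
qed

lemma jet_matrix_jet1: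
  assumes "smooth_at (euclidean_atlas UNIV) g 0"
  shows "jet_matrix (jet1_euclidean g 0) = matrix (frechet_derivative g (at 0))"
  using jet_rep_jet1(4)[OF assms, of UNIV id] unfolding jet_matrix_def
  by (simp add: euclidean_atlas_def inv_id)

lemma linear_eq_if_matrix_eq:
  fixes f g :: "real^'n \<Rightarrow> real^'l"
  assumes "linear f" "linear g" "matrix f = matrix g"
  shows "f = g"
  using matrix_vector_mul(2)[OF assms(1)] matrix_vector_mul(2)[OF assms(2)] assms(3) by metis

lemma inj_on_jet_matrix: "inj_on jet_matrix (jet_fiber :: (real^'n, real^'l) jet set)"
proof (rule inj_onI)
  fix z z' :: "(real^'n, real^'l) jet"
  assume "z \<in> jet_fiber" "z' \<in> jet_fiber" and eq: "jet_matrix z = jet_matrix z'"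
  then obtain g g' where z: "z = jet1_euclidean g 0" "z' = jet1_euclidean g' 0"
    and g: "smooth_at (euclidean_atlas UNIV) g 0" "smooth_at (euclidean_atlas UNIV) g' 0" "g 0 = 0" "g' 0 = 0"
    unfolding jet_fiber_def by auto
  have U: "(UNIV, id) \<in> euclidean_atlas (UNIV :: (real^'n) set)" unfolding euclidean_atlas_def by simp
  have lin: "linear (frechet_derivative h (at 0))" if "smooth_at (euclidean_atlas UNIV) h 0"
    for h :: "real^'n \<Rightarrow> real^'l"
    using smooth_at_has_derivative[OF smooth_atlas_euclidean U _ that] has_derivative_linear
    by (auto simp: inv_id)
  have "frechet_derivative g (at 0) = frechet_derivative g' (at 0)"
    by (rule linear_eq_if_matrix_eq[OF lin[OF g(1)] lin[OF g(2)]])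
      (use eq z jet_matrix_jet1[OF g(1)] jet_matrix_jet1[OF g(2)] in simp)
  then show "z = z'"
    unfolding z by (intro jet1_eqI[OF smooth_atlas_euclidean U]) (auto simp: g inv_id)
qed

text \<open>
  The trivialization is defined with a chosen representative of the jet; its coordinates depend only on
  the jet, and the translations do not affect the derivative.
\<close>

lemma jet_triv_jet1:
  fixes A :: "('p, real^'n) atlas" and g :: "'p \<Rightarrow> real^'l"
  assumes A: "smooth_atlas A" "(V, \<phi>) \<in> A" and q: "q \<in> V" and g: "smooth_at A g q"
  shows "\<exists>j\<in>jet_fiber. jet_triv (V, \<phi>) (jet1 A g q) = (\<phi> q, g q, j)
    \<and> jet_matrix j = deriv_matrix (g \<circ> inv_into V \<phi>) (\<phi> q)"
proof -
  define r where "r = jet_rep (jet1 A g q)"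
  note r = jet_rep_jet1[OF g, folded r_def]
  define \<gamma> where "\<gamma> = (\<lambda>y. y - r q) \<circ> r \<circ> inv_into V \<phi> \<circ> (\<lambda>x. x + \<phi> q)"
  obtain S where S: "open S" "\<phi> q \<in> S" "smooth_on S (r \<circ> inv_into V \<phi>)"
    using smooth_at_in_chart[OF A q r(2)] by blast
  define S0 where "S0 = (\<lambda>x. x + \<phi> q) -` S"
  have oS0: "open S0" unfolding S0_def by (intro open_vimage S(1) continuous_intros)
  have \<gamma>_eq: "\<gamma> = (\<lambda>x. (r \<circ> inv_into V \<phi>) (x + \<phi> q) - r q)" unfolding \<gamma>_def by auto
  have "smooth_on S0 (\<lambda>x. (r \<circ> inv_into V \<phi>) (x + \<phi> q))"
    by (rule smooth_on_compose[OF oS0 S(1) _ S(3)])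
      (auto simp: S0_def intro!: smooth_on_add smooth_on_id smooth_on_const oS0[unfolded S0_def])
  then have "smooth_on S0 \<gamma>"
    unfolding \<gamma>_eq by (intro smooth_on_diff oS0 smooth_on_const)
  then have sm: "smooth_at (euclidean_atlas UNIV) \<gamma> 0"
    unfolding smooth_at_euclidean using oS0 S(2) by (intro exI[of _ S0]) (auto simp: S0_def)
  have \<gamma>0: "\<gamma> 0 = 0" unfolding \<gamma>_def using smooth_atlasD(1)[OF A] q by (simp add: inv_into_f_f)
  have "(\<gamma> has_derivative (\<lambda>v. frechet_derivative (r \<circ> inv_into V \<phi>) (at (\<phi> q)) v - 0)) (at 0)"
    unfolding \<gamma>_eq
  proof (intro has_derivative_diff has_derivative_const)
    have 1: "((\<lambda>x. x + \<phi> q) has_derivative (\<lambda>v. v)) (at 0)" by (auto intro!: derivative_eq_intros)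
    have "((r \<circ> inv_into V \<phi>) has_derivative frechet_derivative (r \<circ> inv_into V \<phi>) (at (\<phi> q))) (at (0 + \<phi> q))"
      using smooth_on_has_derivative[OF S(3,2)] by simp
    from has_derivative_compose[OF 1 this]
    show "((\<lambda>x. (r \<circ> inv_into V \<phi>) (x + \<phi> q)) has_derivative
        (\<lambda>v. frechet_derivative (r \<circ> inv_into V \<phi>) (at (\<phi> q)) v)) (at 0)" by simp
  qed
  then have "frechet_derivative \<gamma> (at 0) = frechet_derivative (g \<circ> inv_into V \<phi>) (at (\<phi> q))"
    using frechet_derivative_eqI r(4)[OF A(2) q] by fastforce
  then have "jet_matrix (jet1_euclidean \<gamma> 0) = deriv_matrix (g \<circ> inv_into V \<phi>) (\<phi> q)"
    using jet_matrix_jet1[OF sm] by simp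
  moreover have "jet1_euclidean \<gamma> 0 \<in> jet_fiber"
    unfolding jet_fiber_def using sm \<gamma>0 by blast
  moreover have "jet_triv (V, \<phi>) (jet1 A g q) = (\<phi> q, g q, jet1_euclidean \<gamma> 0)"
    unfolding jet_triv_def \<gamma>_def Let_def r_def[symmetric] using r(1,3) by simp
  ultimately show ?thesis by blast
qed

lemma jet_chart_jet1:
  fixes A :: "('p, real^'n) atlas" and g :: "'p \<Rightarrow> real^'l"
  assumes "smooth_atlas A" "(V, \<phi>) \<in> A" "q \<in> V" "smooth_at A g q"
  shows "jet_chart (V, \<phi>) (jet1 A g q) = (\<phi> q, g q, deriv_matrix (g \<circ> inv_into V \<phi>) (\<phi> q))"
  using jet_triv_jet1[OF assms] unfolding jet_chart_def by auto

lemma jet_domE: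
  assumes "z \<in> jet_dom A (V, \<phi>)"
  obtains g q where "z = jet1 A g q" "q \<in> V" "smooth_at A g q"
  using assms jet_rep_jet1(1) unfolding jet_dom_def jet_space_def by fastforce

lemma jet_domI:
  assumes "(V, \<phi>) \<in> A" "q \<in> V" "smooth_at A g q"
  shows "jet1 A g q \<in> jet_dom A (V, \<phi>)"
  using assms jet_rep_jet1(1)[OF assms(3)] unfolding jet_dom_def jet_space_def carrier_of_def by fastforce

text \<open>
  A change of charts of \<open>N\<close> multiplies the derivative matrix from the right by an invertible matrix.
  This gives both the transition maps of the jet manifold and, through the invariance of \<open>X\<close>, the
  independence of the subbundle from the chart.
\<close>

lemma deriv_matrix_coordinate_change:
  fixes A :: "('p, real^'n) atlas" and g :: "'p \<Rightarrow> real^'l"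
  assumes A: "smooth_atlas A" "(V, \<phi>) \<in> A" "(V', \<phi>') \<in> A" and q: "q \<in> V" "q \<in> V'"
    and g: "smooth_at A g q"
  shows "deriv_matrix (g \<circ> inv_into V' \<phi>') (\<phi>' q)
    = deriv_matrix (g \<circ> inv_into V \<phi>) (\<phi> q) ** deriv_matrix (\<phi> \<circ> inv_into V' \<phi>') (\<phi>' q)"
proof -
  note D = smooth_at_has_derivative[OF A(1,2) q(1) g]
  note T = transition_has_derivative[OF A(1,3,2) q(2,1)]
  have "frechet_derivative (g \<circ> inv_into V' \<phi>') (at (\<phi>' q)) =
      frechet_derivative (g \<circ> inv_into V \<phi>) (at (\<phi> q)) \<circ>
      frechet_derivative (\<phi> \<circ> inv_into V' \<phi>') (at (\<phi>' q))"
    using frechet_derivative_eqI[OF coordinate_change_derivative[OF A(1,3,2) q(2,1) D]]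
    by (simp add: o_def)
  then show ?thesis
    using matrix_compose[OF has_derivative_linear[OF T] has_derivative_linear[OF D]] by simp
qed

lemma deriv_matrix_transition_invertible:
  fixes A :: "('p, real^'n) atlas"
  assumes A: "smooth_atlas A" "(V, \<phi>) \<in> A" "(V', \<phi>') \<in> A" and q: "q \<in> V" "q \<in> V'"
  shows "invertible (deriv_matrix (\<phi> \<circ> inv_into V' \<phi>') (\<phi>' q))"
proof -
  note T = transition_has_derivative[OF A(1,3,2) q(2,1)]
  note T' = transition_has_derivative[OF A q]
  have "deriv_matrix (\<phi> \<circ> inv_into V' \<phi>') (\<phi>' q) ** deriv_matrix (\<phi>' \<circ> inv_into V \<phi>) (\<phi> q) = mat 1"
  proof -
    have "frechet_derivative (\<phi> \<circ> inv_into V' \<phi>') (at (\<phi>' q)) \<circ>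
        frechet_derivative (\<phi>' \<circ> inv_into V \<phi>) (at (\<phi> q)) = id"
      using transition_derivative_inverse[OF A q] by (simp add: fun_eq_iff)
    then show ?thesis
      using matrix_compose[OF has_derivative_linear[OF T'] has_derivative_linear[OF T]] matrix_id_mat_1
      by (metis id_def)
  qed
  then show ?thesis using invertible_right_inverse by blast
qed

text \<open>
  Every point of the coordinate domain comes from the jet of a map that is affine in the chart.
\<close>

definition jet_of_coords ::
    "('p, real^'n) atlas \<Rightarrow> ('p, real^'n) chart \<Rightarrow> (real^'n) \<times> (real^'l) \<times> (real^'n^'l) \<Rightarrow> ('p, real^'l) jet" where
  "jet_of_coords A = (\<lambda>(V, \<phi>) (x, y, M). jet1 A (\<lambda>p. y + M *v (\<phi> p - x)) (inv_into V \<phi> x))"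

lemma affine_smooth_at:
  fixes A :: "('p, real^'n) atlas" and M :: "real^'n^'l"
  assumes A: "smooth_atlas A" "(V, \<phi>) \<in> A" and q: "q \<in> V"
  shows "smooth_at A (\<lambda>p. y + M *v (\<phi> p - x)) q"
    and "deriv_matrix ((\<lambda>p. y + M *v (\<phi> p - x)) \<circ> inv_into V \<phi>) (\<phi> q) = M"
proof -
  have eq: "((\<lambda>p. y + M *v (\<phi> p - x)) \<circ> inv_into V \<phi>) u = y + M *v (u - x)" if "u \<in> \<phi> ` V" for u
    using that by (simp add: f_inv_into_f)
  have "smooth_on (\<phi> ` V) (\<lambda>u. y + M *v (u - x))"
    by (intro smooth_on_add smooth_on_const smooth_on_linear_compose[OF _ matrix_vector_mul_linear]
        smooth_on_diff smooth_on_id smooth_atlasD(2)[OF A])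
  then show "smooth_at A (\<lambda>p. y + M *v (\<phi> p - x)) q"
    by (intro smooth_atI[OF A(2) q smooth_atlasD(2)[OF A]])
      (simp only: smooth_on_cong[OF smooth_atlasD(2)[OF A] eq])
  have "((\<lambda>u. y + M *v (u - x)) has_derivative (\<lambda>v. 0 + M *v (v - 0))) (at (\<phi> q))"
    by (intro has_derivative_add has_derivative_diff has_derivative_const has_derivative_ident
        bounded_linear.has_derivative[OF matrix_vector_mul_bounded_linear])
  then have "frechet_derivative (\<lambda>u. y + M *v (u - x)) (at (\<phi> q)) = (\<lambda>v. M *v v)"
    using frechet_derivative_eqI by fastforce
  then have "frechet_derivative ((\<lambda>p. y + M *v (\<phi> p - x)) \<circ> inv_into V \<phi>) (at (\<phi> q)) = (\<lambda>v. M *v v)"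
    by (simp only: frechet_derivative_eq_on_open[OF smooth_atlasD(2)[OF A] imageI[OF q] eq])
  then show "deriv_matrix ((\<lambda>p. y + M *v (\<phi> p - x)) \<circ> inv_into V \<phi>) (\<phi> q) = M" by simp
qed

lemma jet_of_coords:
  fixes A :: "('p, real^'n) atlas" and M :: "real^'n^'l"
  assumes A: "smooth_atlas A" "(V, \<phi>) \<in> A" and q: "q \<in> V"
  shows "jet_of_coords A (V, \<phi>) (\<phi> q, y, M) = jet1 A (\<lambda>p. y + M *v (\<phi> p - \<phi> q)) q"
    and "jet_of_coords A (V, \<phi>) (\<phi> q, y, M) \<in> jet_dom A (V, \<phi>)"
    and "jet_chart (V, \<phi>) (jet_of_coords A (V, \<phi>) (\<phi> q, y, M)) = (\<phi> q, y, M)"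
proof -
  show 1: "jet_of_coords A (V, \<phi>) (\<phi> q, y, M) = jet1 A (\<lambda>p. y + M *v (\<phi> p - \<phi> q)) q"
    unfolding jet_of_coords_def using smooth_atlasD(1)[OF A] q by simp
  show "jet_of_coords A (V, \<phi>) (\<phi> q, y, M) \<in> jet_dom A (V, \<phi>)"
    unfolding 1 by (rule jet_domI[OF A(2) q affine_smooth_at(1)[OF A q]])
  show "jet_chart (V, \<phi>) (jet_of_coords A (V, \<phi>) (\<phi> q, y, M)) = (\<phi> q, y, M)"
    unfolding 1 jet_chart_jet1[OF A q affine_smooth_at(1)[OF A q]] affine_smooth_at(2)[OF A q] by simp
qed

lemma inj_on_jet_chart:
  fixes A :: "('p, real^'n) atlas"
  assumes A: "smooth_atlas A" "(V, \<phi>) \<in> A"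
  shows "inj_on (jet_chart (V, \<phi>)) (jet_dom A (V, \<phi>) :: ('p, real^'l) jet set)"
proof (rule inj_onI)
  fix z z' :: "('p, real^'l) jet"
  assume "z \<in> jet_dom A (V, \<phi>)" "z' \<in> jet_dom A (V, \<phi>)"
    and eq: "jet_chart (V, \<phi>) z = jet_chart (V, \<phi>) z'"
  then obtain g q g' q' where z: "z = jet1 A g q" "q \<in> V" "smooth_at A g q"
    and z': "z' = jet1 A g' q'" "q' \<in> V" "smooth_at A g' q'"
    by (metis jet_domE)
  have *: "\<phi> q = \<phi> q'" "g q = g' q'"
    "deriv_matrix (g \<circ> inv_into V \<phi>) (\<phi> q) = deriv_matrix (g' \<circ> inv_into V \<phi>) (\<phi> q')"
    using eq jet_chart_jet1[OF A z(2,3)] jet_chart_jet1[OF A z'(2,3)] z(1) z'(1) by auto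
  have qq: "q = q'" using *(1) smooth_atlasD(1)[OF A] z(2) z'(2) by (auto dest: inj_onD)
  have "frechet_derivative (g \<circ> inv_into V \<phi>) (at (\<phi> q)) = frechet_derivative (g' \<circ> inv_into V \<phi>) (at (\<phi> q))"
    using linear_eq_if_matrix_eq[OF has_derivative_linear[OF smooth_at_has_derivative[OF A z(2,3)]]
        has_derivative_linear[OF smooth_at_has_derivative[OF A z'(2,3)]]] *(3) qq by simp
  then show "z = z'"
    unfolding z(1) z'(1) qq using jet1_eqI[OF A z'(2)] z(3) z'(3) *(2) qq by blast
qed

lemma jet_chart_image:
  fixes A :: "('p, real^'n) atlas"
  assumes A: "smooth_atlas A" "(V, \<phi>) \<in> A"
  shows "jet_chart (V, \<phi>) ` (jet_dom A (V, \<phi>) \<inter> jet_dom A (V', \<phi>') :: ('p, real^'l) jet set)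
    = \<phi> ` (V \<inter> V') \<times> UNIV"
proof (intro equalityI subsetI)
  fix w assume "w \<in> jet_chart (V, \<phi>) ` (jet_dom A (V, \<phi>) \<inter> jet_dom A (V', \<phi>') :: ('p, real^'l) jet set)"
  then obtain z :: "('p, real^'l) jet" where z: "z \<in> jet_dom A (V, \<phi>)" "z \<in> jet_dom A (V', \<phi>')"
    "w = jet_chart (V, \<phi>) z" by blast
  obtain g q where g: "z = jet1 A g q" "q \<in> V" "smooth_at A g q" using jet_domE[OF z(1)] .
  have "q \<in> V'" using z(2) g(1) jet_rep_jet1(1)[OF g(3)] unfolding jet_dom_def by simp
  then show "w \<in> \<phi> ` (V \<inter> V') \<times> UNIV"
    using jet_chart_jet1[OF A g(2,3)] z(3) g(1,2) by auto
next
  fix w :: "(real^'n) \<times> (real^'l) \<times> (real^'n^'l)"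
  assume "w \<in> \<phi> ` (V \<inter> V') \<times> UNIV"
  then obtain q y M where w: "w = (\<phi> q, y, M)" and q: "q \<in> V" "q \<in> V'" by auto
  have "jet_of_coords A (V, \<phi>) w \<in> jet_dom A (V', \<phi>')"
    using jet_of_coords(1,2)[OF A q(1), of y M] jet_rep_jet1(1)[OF affine_smooth_at(1)[OF A q(1)], of y M "\<phi> q"] q(2)
    unfolding w jet_dom_def by simp
  then show "w \<in> jet_chart (V, \<phi>) ` (jet_dom A (V, \<phi>) \<inter> jet_dom A (V', \<phi>') :: ('p, real^'l) jet set)"
    using jet_of_coords(2,3)[OF A q(1), of y M] unfolding w by (metis IntI imageI)
qed

text \<open>
  The transition maps are \<open>(x, y, M) \<mapsto> (\<tau> x, y, M D(\<tau>\<inverse>)(\<tau> x))\<close>, where \<open>\<tau>\<close> and \<open>\<tau>\<inverse>\<close> are transition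
  maps of \<open>N\<close>, so no smoothness of matrix inversion is involved.
\<close>

lemma smooth_atlas_jet:
  fixes A :: "('p, real^'n) atlas"
  assumes A: "smooth_atlas A"
  shows "smooth_atlas (jet_atlas A :: (('p, real^'l) jet, _) atlas)"
proof -
  have "inj_on (jet_chart (V, \<phi>)) (jet_dom A (V, \<phi>) :: ('p, real^'l) jet set)
      \<and> open (jet_chart (V, \<phi>) ` (jet_dom A (V, \<phi>) :: ('p, real^'l) jet set))"
    if "(V, \<phi>) \<in> A" for V \<phi>
    using inj_on_jet_chart[where 'l='l, OF A that] jet_chart_image[where 'l='l, OF A that, of V \<phi>] smooth_atlasD(2)[OF A that]
    by (simp add: open_Times)
  moreover have "open (jet_chart (V, \<phi>) ` (jet_dom A (V, \<phi>) \<inter> jet_dom A (V', \<phi>') :: ('p, real^'l) jet set))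
      \<and> smooth_on (jet_chart (V, \<phi>) ` (jet_dom A (V, \<phi>) \<inter> jet_dom A (V', \<phi>') :: ('p, real^'l) jet set))
          (jet_chart (V', \<phi>') \<circ> inv_into (jet_dom A (V, \<phi>)) (jet_chart (V, \<phi>)))"
    if V: "(V, \<phi>) \<in> A" and V': "(V', \<phi>') \<in> A" for V \<phi> V' \<phi>'
  proof -
    let ?W = "\<phi> ` (V \<inter> V') \<times> (UNIV :: ((real^'l) \<times> (real^'n^'l)) set)"
    let ?\<tau> = "\<phi>' \<circ> inv_into V \<phi>"
    have oV: "open (\<phi> ` (V \<inter> V'))" "open (\<phi>' ` (V \<inter> V'))"
      using smooth_atlasD(3)[OF A V V'] smooth_atlasD(3)[OF A V' V] by (simp_all add: Int_commute)
    have oW: "open ?W" using oV(1) by (simp add: open_Times)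
    have eq: "(jet_chart (V', \<phi>') \<circ> inv_into (jet_dom A (V, \<phi>)) (jet_chart (V, \<phi>))) w
        = (?\<tau> (fst w), fst (snd w), snd (snd w) ** deriv_matrix (\<phi> \<circ> inv_into V' \<phi>') (?\<tau> (fst w)))"
      if "w \<in> ?W" for w
    proof -
      obtain q y M where w: "w = (\<phi> q, y, M)" and q: "q \<in> V" "q \<in> V'" using \<open>w \<in> ?W\<close> by auto
      have "inv_into (jet_dom A (V, \<phi>)) (jet_chart (V, \<phi>)) w = jet_of_coords A (V, \<phi>) w"
        using jet_of_coords(2,3)[OF A V q(1), of y M] unfolding w
        by (intro inv_into_f_eq inj_on_jet_chart[OF A V])
      also have "\<dots> = jet1 A (\<lambda>p. y + M *v (\<phi> p - \<phi> q)) q"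
        unfolding w by (rule jet_of_coords(1)[OF A V q(1)])
      finally have i: "inv_into (jet_dom A (V, \<phi>)) (jet_chart (V, \<phi>)) w = jet1 A (\<lambda>p. y + M *v (\<phi> p - \<phi> q)) q" .
      have "?\<tau> (\<phi> q) = \<phi>' q" using smooth_atlasD(1)[OF A V] q by simp
      moreover have "jet_chart (V', \<phi>') (inv_into (jet_dom A (V, \<phi>)) (jet_chart (V, \<phi>)) w)
          = (\<phi>' q, y, M ** deriv_matrix (\<phi> \<circ> inv_into V' \<phi>') (\<phi>' q))"
        unfolding i jet_chart_jet1[OF A V' q(2) affine_smooth_at(1)[OF A V q(1)]]
          deriv_matrix_coordinate_change[OF A V V' q affine_smooth_at(1)[OF A V q(1)]]
          affine_smooth_at(2)[OF A V q(1)] by simp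
      ultimately show ?thesis by (simp only: o_apply[of "jet_chart (V', \<phi>')"] w fst_conv snd_conv)
    qed
    have fst: "smooth_on ?W fst" by (rule smooth_on_linear[OF oW linear_fst])
    have snd: "smooth_on ?W snd" by (rule smooth_on_linear[OF oW linear_snd])
    have \<tau>: "smooth_on ?W (\<lambda>w. ?\<tau> (fst w))"
      by (rule smooth_on_compose[OF oW oV(1) _ smooth_atlasD(4)[OF A V V'] fst]) auto
    have jac: "smooth_on ?W (\<lambda>w. deriv_matrix (\<phi> \<circ> inv_into V' \<phi>') (?\<tau> (fst w)))"
    proof (rule smooth_on_compose[OF oW oV(2) _ smooth_on_deriv_matrix[OF oV(2)] \<tau>])
      show "(\<lambda>w. ?\<tau> (fst w)) ` ?W \<subseteq> \<phi>' ` (V \<inter> V')"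
        using coordinate_change_eq(2)[OF A V V'] by fastforce
      show "smooth_on (\<phi>' ` (V \<inter> V')) (\<phi> \<circ> inv_into V' \<phi>')"
        using smooth_atlasD(4)[OF A V' V] by (simp add: Int_commute)
    qed
    have "smooth_on ?W (\<lambda>w. (?\<tau> (fst w), fst (snd w), snd (snd w) ** deriv_matrix (\<phi> \<circ> inv_into V' \<phi>') (?\<tau> (fst w))))"
      by (intro smooth_on_Pair oW \<tau> smooth_on_linear_compose[OF oW linear_fst snd]
          smooth_on_bounded_bilinear[OF oW bounded_bilinear_matrix_mult]
          smooth_on_linear_compose[OF oW linear_snd snd] jac)
    then have "smooth_on ?W (jet_chart (V', \<phi>') \<circ> inv_into (jet_dom A (V, \<phi>)) (jet_chart (V, \<phi>)))"
      by (simp only: smooth_on_cong[OF oW eq])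
    then show ?thesis
      unfolding jet_chart_image[OF A V] using oW by (rule conjI[rotated])
  qed
  ultimately show ?thesis
    unfolding smooth_atlas_def jet_atlas_def by (auto split: prod.splits)
qed

section \<open>The subbundle of an invariant submanifold\<close>

lemma diffeo_germ_linear:
  fixes l l' :: "'e::euclidean_space \<Rightarrow> 'e"
  assumes "linear l" "linear l'" "\<And>x. l' (l x) = x" "\<And>x. l (l' x) = x"
  shows "diffeo_germ l l'"
proof -
  have "homeomorphism UNIV UNIV l l'"
    using assms by (intro homeomorphismI)
      (auto intro: linear_continuous_on simp: linear_conv_bounded_linear)
  then have "diffeomorphism UNIV UNIV l l'"
    unfolding diffeomorphism_def using assms(1,2) smooth_on_linear open_UNIV by blast
  then show ?thesis unfolding diffeo_germ_def using linear_0[OF assms(1)] by blast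
qed

text \<open>
  A right factor is a linear change of coordinates in the source; it suffices to apply the invariance
  to linear germs.
\<close>

lemma A1_invariant_mult_invertible:
  fixes X :: "(real^'n, real^'l) jet set"
  assumes X: "A1_invariant X" and M: "M \<in> jet_matrix ` X" and C: "invertible C"
  shows "M ** C \<in> jet_matrix ` X"
proof -
  obtain j where j: "j \<in> X" "M = jet_matrix j" using M by blast
  then obtain g where g: "j = jet1_euclidean g 0" "smooth_at (euclidean_atlas UNIV) g 0" "g 0 = 0"
    using X unfolding A1_invariant_def jet_fiber_def by blast
  obtain C' where C': "C ** C' = mat 1" "C' ** C = mat 1" using C unfolding invertible_def by blast
  have "diffeo_germ ((*v) C') ((*v) C)"
    by (rule diffeo_germ_linear) (simp_all add: matrix_vector_mul_assoc C')
  moreover have "diffeo_germ id (id :: real^'l \<Rightarrow> real^'l)"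
    using diffeo_germ_linear[of id id] linear_id by auto
  ultimately have inX: "jet1_euclidean (id \<circ> g \<circ> (*v) C) 0 \<in> X"
    using X g j(1) unfolding A1_invariant_def by blast
  obtain S where S: "open S" "0 \<in> S" "smooth_on S g" using g(2) smooth_at_euclidean by blast
  define S' where "S' = (*v) C -` S"
  have oS': "open S'" unfolding S'_def
    by (intro open_vimage S(1) linear_continuous_on matrix_vector_mul_bounded_linear)
  have 0: "0 \<in> S'" unfolding S'_def using S(2) by simp
  have "smooth_on S' (\<lambda>x. g (C *v x))"
    by (rule smooth_on_compose[OF oS' S(1) _ S(3) smooth_on_linear[OF oS' matrix_vector_mul_linear]])
      (auto simp: S'_def)
  then have sm: "smooth_at (euclidean_atlas UNIV) (id \<circ> g \<circ> (*v) C) 0"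
    unfolding smooth_at_euclidean using oS' 0 by (auto simp: o_def)
  have Dg: "(g has_derivative frechet_derivative g (at 0)) (at (C *v 0))"
    using smooth_on_has_derivative[OF S(3,2)] by simp
  have "((\<lambda>x. g (C *v x)) has_derivative (\<lambda>v. frechet_derivative g (at 0) (C *v v))) (at 0)"
    by (rule has_derivative_compose[OF bounded_linear_imp_has_derivative[OF matrix_vector_mul_bounded_linear] Dg])
  then have "frechet_derivative (id \<circ> g \<circ> (*v) C) (at 0) = frechet_derivative g (at 0) \<circ> (*v) C"
    using frechet_derivative_eqI by (fastforce simp: o_def)
  then have "jet_matrix (jet1_euclidean (id \<circ> g \<circ> (*v) C) 0) = matrix (frechet_derivative g (at 0) \<circ> (*v) C)"
    using jet_matrix_jet1[OF sm] by simp
  also have "\<dots> = matrix (frechet_derivative g (at 0)) ** C"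
    using matrix_compose[OF matrix_vector_mul_linear has_derivative_linear[OF Dg], of C] by simp
  also have "\<dots> = M ** C" using jet_matrix_jet1[OF g(2)] g(1) j(2) by simp
  finally show ?thesis using inX by (metis imageI)
qed

text \<open>
  Membership can be tested in any chart around the source point. This is what allows the countable
  subatlas in the theorem, since the subbundle is defined with all charts.
\<close>

lemma jet1_in_subbundle_iff:
  fixes A :: "('p, real^'n) atlas" and g :: "'p \<Rightarrow> real^'l"
  assumes A: "smooth_atlas A" "(V, \<phi>) \<in> A" and q: "q \<in> V" and g: "smooth_at A g q" and X: "A1_invariant X"
  shows "jet1 A g q \<in> jet_subbundle A X \<longleftrightarrow> deriv_matrix (g \<circ> inv_into V \<phi>) (\<phi> q) \<in> jet_matrix ` X"
proof -
  have XF: "X \<subseteq> jet_fiber" using X unfolding A1_invariant_def by blast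
  have *: "jet_triv (V', \<phi>') (jet1 A g q) \<in> \<phi>' ` V' \<times> UNIV \<times> X
      \<longleftrightarrow> deriv_matrix (g \<circ> inv_into V' \<phi>') (\<phi>' q) \<in> jet_matrix ` X"
    if V': "(V', \<phi>') \<in> A" and q': "q \<in> V'" for V' \<phi>'
  proof -
    obtain j where j: "j \<in> jet_fiber" "jet_triv (V', \<phi>') (jet1 A g q) = (\<phi>' q, g q, j)"
      "jet_matrix j = deriv_matrix (g \<circ> inv_into V' \<phi>') (\<phi>' q)"
      using jet_triv_jet1[OF A(1) V' q' g] by blast
    have "j \<in> X \<longleftrightarrow> jet_matrix j \<in> jet_matrix ` X"
      using inj_on_image_mem_iff[OF inj_on_jet_matrix j(1) XF] by simp
    then show ?thesis using j(2,3) q' by simp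
  qed
  show ?thesis
  proof
    assume "jet1 A g q \<in> jet_subbundle A X"
    then obtain V' \<phi>' where V': "(V', \<phi>') \<in> A" "jet1 A g q \<in> jet_dom A (V', \<phi>')"
      "jet_triv (V', \<phi>') (jet1 A g q) \<in> \<phi>' ` V' \<times> UNIV \<times> X"
      unfolding jet_subbundle_def by auto
    have q': "q \<in> V'" using V'(2) jet_rep_jet1(1)[OF g] unfolding jet_dom_def by simp
    have "deriv_matrix (g \<circ> inv_into V' \<phi>') (\<phi>' q) \<in> jet_matrix ` X" using *[OF V'(1) q'] V'(3) by blast
    then show "deriv_matrix (g \<circ> inv_into V \<phi>) (\<phi> q) \<in> jet_matrix ` X"
      unfolding deriv_matrix_coordinate_change[OF A(1) V'(1) A(2) q' q g]
      by (rule A1_invariant_mult_invertible[OF X _ deriv_matrix_transition_invertible[OF A(1) V'(1) A(2) q' q]])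
  next
    assume "deriv_matrix (g \<circ> inv_into V \<phi>) (\<phi> q) \<in> jet_matrix ` X"
    then have "jet1 A g q \<in> {z \<in> jet_dom A (V, \<phi>). jet_triv (V, \<phi>) z \<in> \<phi> ` V \<times> UNIV \<times> X}"
      using *[OF A(2) q] jet_domI[OF A(2) q g] by simp
    then show "jet1 A g q \<in> jet_subbundle A X"
      unfolding jet_subbundle_def by (intro UN_I[OF A(2)]) simp
  qed
qed

section \<open>Transversality of the jet extension\<close>

text \<open>
  In the bundle chart the jet extension is \<open>x \<mapsto> (x, \<gamma> x, D\<gamma> x)\<close>, so its differential is the derivative
  of this map.
\<close>

lemma tangent_of_coords_jet_curve:
  fixes A :: "('p, real^'n) atlas" and g :: "'p \<Rightarrow> real^'l"
  assumes A: "smooth_atlas A" "(V, \<phi>) \<in> A" and q: "q \<in> V"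
    and g: "\<And>p. p \<in> V \<Longrightarrow> smooth_at A g p"
    and c: "smooth_curve A c q" "((\<phi> \<circ> c) has_vector_derivative \<xi>) (at 0)"
  defines "\<gamma> \<equiv> g \<circ> inv_into V \<phi>"
  shows "velocity (jet_atlas A) (jet1 A g \<circ> c)
    = tangent_of_coords (jet_atlas A) (jet_dom A (V, \<phi>), jet_chart (V, \<phi>)) (jet1 A g q)
        (\<xi>, frechet_derivative \<gamma> (at (\<phi> q)) \<xi>, frechet_derivative (deriv_matrix \<gamma>) (at (\<phi> q)) \<xi>)"
proof -
  let ?j = "jet1 A g" and ?\<chi> = "jet_chart (V, \<phi>) :: ('p, real^'l) jet \<Rightarrow> _"
  define \<Gamma> where "\<Gamma> x = (x, \<gamma> x, deriv_matrix \<gamma> x)" for x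
  have oV: "open (\<phi> ` V)" by (rule smooth_atlasD(2)[OF A])
  have sm\<gamma>: "smooth_on (\<phi> ` V) \<gamma>" unfolding \<gamma>_def by (rule smooth_in_chart[OF A g])
  have sm\<Gamma>: "smooth_on (\<phi> ` V) \<Gamma>"
    unfolding \<Gamma>_def by (intro smooth_on_Pair oV smooth_on_id sm\<gamma> smooth_on_deriv_matrix)
  have xV: "\<phi> q \<in> \<phi> ` V" using q by blast
  have D\<Gamma>: "(\<Gamma> has_derivative (\<lambda>v. (v, frechet_derivative \<gamma> (at (\<phi> q)) v,
      frechet_derivative (deriv_matrix \<gamma>) (at (\<phi> q)) v))) (at (\<phi> q))"
    unfolding \<Gamma>_def
    by (intro has_derivative_Pair has_derivative_ident smooth_on_has_derivative[OF sm\<gamma> xV]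
        smooth_on_has_derivative[OF smooth_on_deriv_matrix[OF oV sm\<gamma>] xV])
  have chart: "?\<chi> (?j p) = \<Gamma> (\<phi> p)" if "p \<in> V" for p
    unfolding \<Gamma>_def \<gamma>_def jet_chart_jet1[OF A that g[OF that]]
    using smooth_atlasD(1)[OF A] that by simp
  have D\<chi>: "((?\<chi> \<circ> ?j \<circ> inv_into V \<phi>) has_derivative (\<lambda>v. (v, frechet_derivative \<gamma> (at (\<phi> q)) v,
      frechet_derivative (deriv_matrix \<gamma>) (at (\<phi> q)) v))) (at (\<phi> q))"
  proof -
    have "(?\<chi> \<circ> ?j \<circ> inv_into V \<phi>) x = \<Gamma> x" if "x \<in> \<phi> ` V" for x
      using chart[of "inv_into V \<phi> x"] that by (simp add: inv_into_into f_inv_into_f)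
    then show ?thesis using has_derivative_eq_on_open[OF oV xV, of "?\<chi> \<circ> ?j \<circ> inv_into V \<phi>" \<Gamma>] D\<Gamma> by blast
  qed
  obtain \<epsilon> where \<epsilon>: "\<epsilon> > 0" "c ` {-\<epsilon><..<\<epsilon>} \<subseteq> V" "smooth_on {-\<epsilon><..<\<epsilon>} (\<phi> \<circ> c)"
    using smooth_curve_in_chart[OF A q c(1)] by blast
  have \<kappa>: "(jet_dom A (V, \<phi>), ?\<chi>) \<in> jet_atlas A" unfolding jet_atlas_def using A(2) by blast
  have dom: "?j p \<in> jet_dom A (V, \<phi>)" if "p \<in> V" for p using jet_domI[OF A(2) that g[OF that]] .
  have curve: "smooth_curve (jet_atlas A) (?j \<circ> c) (?j q)"
  proof -
    have "smooth_on {-\<epsilon><..<\<epsilon>} (\<lambda>t. \<Gamma> ((\<phi> \<circ> c) t))"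
      by (rule smooth_on_compose[OF _ oV _ sm\<Gamma> \<epsilon>(3)]) (use \<epsilon>(2) in auto)
    moreover have eq: "(?\<chi> \<circ> (?j \<circ> c)) t = \<Gamma> ((\<phi> \<circ> c) t)" if "t \<in> {-\<epsilon><..<\<epsilon>}" for t
      using chart[of "c t"] \<epsilon>(2) that by (simp add: image_subset_iff)
    have "smooth_on {-\<epsilon><..<\<epsilon>} (?\<chi> \<circ> (?j \<circ> c)) \<longleftrightarrow> smooth_on {-\<epsilon><..<\<epsilon>} (\<lambda>t. \<Gamma> ((\<phi> \<circ> c) t))"
      by (rule smooth_on_cong[OF open_greaterThanLessThan eq])
    ultimately have "smooth_on {-\<epsilon><..<\<epsilon>} (?\<chi> \<circ> (?j \<circ> c))" by (simp only:)
    moreover have "(?j \<circ> c) ` {-\<epsilon><..<\<epsilon>} \<subseteq> jet_dom A (V, \<phi>)" using dom \<epsilon>(2) by auto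
    moreover have "(?j \<circ> c) 0 = ?j q" using c(1) unfolding smooth_curve_def by simp
    ultimately show ?thesis unfolding smooth_curve_def using \<epsilon>(1) \<kappa> by blast
  qed
  have "((?\<chi> \<circ> (?j \<circ> c)) has_vector_derivative (\<xi>, frechet_derivative \<gamma> (at (\<phi> q)) \<xi>,
      frechet_derivative (deriv_matrix \<gamma>) (at (\<phi> q)) \<xi>)) (at 0)"
    using has_vector_derivative_along_curve[OF A q c, of "?\<chi> \<circ> ?j"] D\<chi> by (simp only: comp_assoc)
  from velocity_eq_tangent_of_coords[OF smooth_atlas_jet[OF A(1)] \<kappa> dom[OF q] curve this]
  show ?thesis .
qed

text \<open>
  Over the chart the subbundle is a product, so a curve in it may move arbitrarily in source and
  target while its matrix component follows a curve in \<open>jet_matrix ` X\<close>.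
\<close>

lemma tangent_of_coords_subbundle:
  fixes A :: "('p, real^'n) atlas" and g :: "'p \<Rightarrow> real^'l"
  assumes A: "smooth_atlas A" "(V, \<phi>) \<in> A" and q: "q \<in> V" and g: "smooth_at A g q"
    and X: "A1_invariant X"
    and c: "tangent_to (jet_matrix ` X) (deriv_matrix (g \<circ> inv_into V \<phi>) (\<phi> q)) c"
  shows "tangent_of_coords (jet_atlas A) (jet_dom A (V, \<phi>), jet_chart (V, \<phi>)) (jet1 A g q) (a, b, c)
    \<in> tangent_subspace (jet_atlas A) (jet_subbundle A X) (jet1 A g q)"
proof -
  let ?D = "jet_dom A (V, \<phi>) :: ('p, real^'l) jet set" and ?\<chi> = "jet_chart (V, \<phi>) :: ('p, real^'l) jet \<Rightarrow> _"
  have \<kappa>: "(?D, ?\<chi>) \<in> jet_atlas A" unfolding jet_atlas_def using A(2) by blast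
  note J = smooth_atlas_jet[where 'l='l, OF A(1)]
  have dom: "jet1 A g q \<in> ?D" using jet_domI[OF A(2) q g] .
  obtain \<mu> \<delta> where \<mu>: "\<delta> > 0" "smooth_on {-\<delta><..<\<delta>} \<mu>" "\<mu> 0 = deriv_matrix (g \<circ> inv_into V \<phi>) (\<phi> q)"
    "\<mu> ` {-\<delta><..<\<delta>} \<subseteq> jet_matrix ` X" "(\<mu> has_vector_derivative c) (at 0)"
    using c unfolding tangent_to_def by blast
  obtain \<epsilon>' where \<epsilon>': "\<epsilon>' > 0" "\<And>t. t \<in> {-\<epsilon>'<..<\<epsilon>'} \<Longrightarrow> \<phi> q + t *\<^sub>R a \<in> \<phi> ` V"
    using line_in_open[OF smooth_atlasD(2)[OF A]] q by blast
  define \<epsilon> where "\<epsilon> = min \<delta> \<epsilon>'"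
  define \<omega> where "\<omega> t = (\<phi> q + t *\<^sub>R a, g q + t *\<^sub>R b, \<mu> t)" for t :: real
  have e: "\<epsilon> > 0" unfolding \<epsilon>_def using \<mu>(1) \<epsilon>'(1) by simp
  have sm: "smooth_on {-\<epsilon><..<\<epsilon>} \<omega>"
    unfolding \<omega>_def
    by (intro smooth_on_Pair open_greaterThanLessThan smooth_on_line smooth_on_subset[OF \<mu>(2)])
      (auto simp: \<epsilon>_def)
  have range: "\<omega> ` {-\<epsilon><..<\<epsilon>} \<subseteq> ?\<chi> ` ?D"
    using jet_chart_image[where 'l='l, OF A, of V \<phi>] \<epsilon>'(2) unfolding \<omega>_def \<epsilon>_def by auto
  have \<omega>0: "\<omega> 0 = ?\<chi> (jet1 A g q)"
    unfolding \<omega>_def jet_chart_jet1[OF A q g] using \<mu>(3) by simp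
  have D\<omega>: "(\<omega> has_vector_derivative (a, b, c)) (at 0)"
    unfolding \<omega>_def by (intro has_vector_derivative_Pair line_has_vector_derivative \<mu>(5))
  let ?c = "inv_into ?D ?\<chi> \<circ> \<omega>"
  note cw = curve_of_coords[OF \<kappa> smooth_atlasD(1)[OF J \<kappa>] dom e sm range \<omega>0 D\<omega>]
  have "?c t \<in> jet_subbundle A X" if t: "t \<in> {-\<epsilon><..<\<epsilon>}" for t
  proof -
    have \<omega>t: "\<omega> t \<in> ?\<chi> ` ?D" using range t by blast
    have "?c t \<in> ?D" using inv_into_into[OF \<omega>t] by simp
    then obtain h q' where h: "?c t = jet1 A h q'" "q' \<in> V" "smooth_at A h q'"
      by (metis jet_domE)
    have "?\<chi> (?c t) = \<omega> t" using f_inv_into_f[OF \<omega>t] by simp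
    then have "deriv_matrix (h \<circ> inv_into V \<phi>) (\<phi> q') = \<mu> t"
      unfolding h(1) jet_chart_jet1[OF A h(2,3)] \<omega>_def by (elim Pair_inject)
    also have "\<dots> \<in> jet_matrix ` X" using \<mu>(4) t unfolding \<epsilon>_def by auto
    finally show ?thesis unfolding h(1) jet1_in_subbundle_iff[OF A h(2,3) X] .
  qed
  then have "?c ` {-\<epsilon><..<\<epsilon>} \<subseteq> jet_subbundle A X" by blast
  moreover have "velocity (jet_atlas A) ?c = tangent_of_coords (jet_atlas A) (?D, ?\<chi>) (jet1 A g q) (a, b, c)"
    by (rule velocity_eq_tangent_of_coords[OF J \<kappa> dom cw])
  ultimately show ?thesis
    unfolding tangent_subspace_def using cw(1) e
    by (metis (mono_tags, lifting) mem_Collect_eq)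
qed

text \<open>
  Tangent vectors of the jet manifold are identified with their coordinates \<open>(a, b, Q)\<close>. Source and
  target components are absorbed by the subbundle, so only \<open>Q\<close> has to be split.
\<close>

lemma jet_extension_transverse_at:
  fixes A :: "('p, real^'n) atlas" and g :: "'p \<Rightarrow> real^'l"
  assumes A: "smooth_atlas A" "(V, \<phi>) \<in> A" and q: "q \<in> V"
    and g: "\<And>p. p \<in> V \<Longrightarrow> smooth_at A g p" and X: "A1_invariant X"
  defines "\<gamma> \<equiv> g \<circ> inv_into V \<phi>"
  assumes tr: "\<And>Q. \<exists>\<xi> c. tangent_to (jet_matrix ` X) (deriv_matrix \<gamma> (\<phi> q)) c \<and>
    Q = frechet_derivative (deriv_matrix \<gamma>) (at (\<phi> q)) \<xi> + c"
  shows "{\<lambda>\<kappa>. u \<kappa> + w \<kappa> |u w. u \<in> differential A (jet_atlas A) (jet1 A g) q ` tangent_space A q \<and>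
      w \<in> tangent_subspace (jet_atlas A) (jet_subbundle A X) (jet1 A g q)}
    = tangent_space (jet_atlas A) (jet1 A g q)"
proof -
  let ?B = "jet_atlas A :: (('p, real^'l) jet, _) atlas"
  let ?D = "jet_dom A (V, \<phi>) :: ('p, real^'l) jet set" and ?\<chi> = "jet_chart (V, \<phi>) :: ('p, real^'l) jet \<Rightarrow> _"
  let ?p = "jet1 A g q"
  let ?T = "tangent_of_coords ?B (?D, ?\<chi>) ?p"
  let ?\<Gamma> = "\<lambda>\<xi>. (\<xi>, frechet_derivative \<gamma> (at (\<phi> q)) \<xi>, frechet_derivative (deriv_matrix \<gamma>) (at (\<phi> q)) \<xi>)"
  have \<kappa>: "(?D, ?\<chi>) \<in> ?B" unfolding jet_atlas_def using A(2) by blast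
  note J = smooth_atlas_jet[where 'l='l, OF A(1)]
  have dom: "?p \<in> ?D" using jet_domI[OF A(2) q g[OF q]] .
  have TB: "tangent_space ?B ?p = range ?T" by (rule tangent_space_eq_range[OF J \<kappa> dom])
  have diff: "differential A ?B (jet1 A g) q (tangent_of_coords A (V, \<phi>) q \<xi>) = ?T (?\<Gamma> \<xi>)" for \<xi>
  proof -
    obtain c where c: "smooth_curve A c q" "((\<phi> \<circ> c) has_vector_derivative \<xi>) (at 0)"
      "differential A ?B (jet1 A g) q (tangent_of_coords A (V, \<phi>) q \<xi>) = velocity ?B (jet1 A g \<circ> c)"
      by (rule differential_of_coords[OF A q])
    show ?thesis
      unfolding c(3) \<gamma>_def by (rule tangent_of_coords_jet_curve[OF A q g c(1,2)])
  qed
  have TA: "tangent_space A q = range (tangent_of_coords A (V, \<phi>) q)" by (rule tangent_space_eq_range[OF A q])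
  have add: "?T (s + t) = (\<lambda>\<kappa>. ?T s \<kappa> + ?T t \<kappa>)" for s t by (rule tangent_of_coords_add[OF J \<kappa> dom])
  show ?thesis
  proof (intro equalityI subsetI)
    fix v assume "v \<in> {\<lambda>\<kappa>. u \<kappa> + w \<kappa> |u w. u \<in> differential A ?B (jet1 A g) q ` tangent_space A q \<and>
      w \<in> tangent_subspace ?B (jet_subbundle A X) ?p}"
    then obtain u w where v: "v = (\<lambda>\<kappa>. u \<kappa> + w \<kappa>)"
      and u: "u \<in> differential A ?B (jet1 A g) q ` tangent_space A q"
      and w: "w \<in> tangent_subspace ?B (jet_subbundle A X) ?p" by blast
    obtain \<xi> where "u = ?T (?\<Gamma> \<xi>)" using u diff unfolding TA by auto
    moreover have "w \<in> tangent_space ?B ?p" using w unfolding tangent_subspace_def tangent_space_def by blast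
    then obtain t where "w = ?T t" unfolding TB by blast
    ultimately have "v = ?T (?\<Gamma> \<xi> + t)" unfolding v add by simp
    then show "v \<in> tangent_space ?B ?p" unfolding TB by blast
  next
    fix v assume "v \<in> tangent_space ?B ?p"
    then obtain a b Q where v: "v = ?T (a, b, Q)" unfolding TB by auto
    obtain \<xi> c where c: "tangent_to (jet_matrix ` X) (deriv_matrix \<gamma> (\<phi> q)) c"
      and Q: "Q = frechet_derivative (deriv_matrix \<gamma>) (at (\<phi> q)) \<xi> + c" using tr by blast
    let ?w = "?T (a - \<xi>, b - frechet_derivative \<gamma> (at (\<phi> q)) \<xi>, c)"
    have "(a, b, Q) = ?\<Gamma> \<xi> + (a - \<xi>, b - frechet_derivative \<gamma> (at (\<phi> q)) \<xi>, c)"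
      unfolding Q by simp
    then have "v = (\<lambda>\<kappa>. ?T (?\<Gamma> \<xi>) \<kappa> + ?w \<kappa>)" unfolding v by (simp only: add)
    moreover have "?T (?\<Gamma> \<xi>) \<in> differential A ?B (jet1 A g) q ` tangent_space A q"
      unfolding TA diff[symmetric] by blast
    moreover have "?w \<in> tangent_subspace ?B (jet_subbundle A X) ?p"
      by (rule tangent_of_coords_subbundle[OF A q g[OF q] X c[unfolded \<gamma>_def]])
    ultimately show "v \<in> {\<lambda>\<kappa>. u \<kappa> + w \<kappa> |u w. u \<in> differential A ?B (jet1 A g) q ` tangent_space A q \<and>
      w \<in> tangent_subspace ?B (jet_subbundle A X) ?p}"
      unfolding mem_Collect_eq by (intro exI[of _ "?T (?\<Gamma> \<xi>)"] exI[of _ ?w] conjI)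
  qed
qed

section \<open>Reduction to countably many charts\<close>

text \<open>
  The chart domains form an open cover of a Lindeloef space.
\<close>

lemma countable_subatlas:
  fixes A :: "('p, 'e::euclidean_space) atlas"
  assumes "second_countable (atlas_topology A)"
  obtains A0 where "A0 \<subseteq> A" "countable A0" "carrier_of A0 = carrier_of A"
proof -
  let ?\<G> = "{V \<inter> \<psi> -` S |V \<psi> S. (V, \<psi>) \<in> A \<and> open S}"
  have gen: "V \<in> ?\<G>" if "(V, \<phi>) \<in> A" for V \<phi>
    unfolding mem_Collect_eq using that
    by (intro exI[of _ V] exI[of _ \<phi>] exI[of _ UNIV]) simp
  have "\<Union>?\<G> = carrier_of A"
  proof (intro equalityI subsetI)
    fix x assume "x \<in> \<Union>?\<G>"
    then show "x \<in> carrier_of A" unfolding carrier_of_def by auto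
  next
    fix x assume "x \<in> carrier_of A"
    then obtain V \<phi> where "(V, \<phi>) \<in> A" "x \<in> V" unfolding carrier_of_def by auto
    then show "x \<in> \<Union>?\<G>" using gen by (intro UnionI)
  qed
  then have top: "topspace (atlas_topology A) = carrier_of A"
    unfolding atlas_topology_def topology_generated_by_topspace .
  have "openin (atlas_topology A) V" if "(V, \<phi>) \<in> A" for V \<phi>
    unfolding atlas_topology_def by (rule topology_generated_by_Basis[OF gen[OF that]])
  then have "\<forall>V\<in>fst ` A. openin (atlas_topology A) V" by auto
  moreover have "\<Union>(fst ` A) = carrier_of A" unfolding carrier_of_def by auto
  ultimately obtain \<V> where \<V>: "countable \<V>" "\<V> \<subseteq> fst ` A" "\<Union>\<V> = carrier_of A"
    using second_countable_imp_Lindelof_space[OF assms] top unfolding Lindelof_space_def by metis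
  then obtain A0 where "countable A0" "A0 \<subseteq> A" "\<V> = fst ` A0"
    by (meson countable_subset_image)
  then show thesis using that[of A0] \<V>(3) unfolding carrier_of_def by (auto simp: split_beta)
qed

lemma immersion_inj_derivative:
  fixes A :: "('p, real^'n) atlas" and f :: "'p \<Rightarrow> real^'m"
  assumes A: "smooth_atlas A" "(V, \<phi>) \<in> A" and q: "q \<in> V" and f: "immersion_into A U f"
  shows "inj (frechet_derivative (f \<circ> inv_into V \<phi>) (at (\<phi> q)))"
proof (rule injI)
  let ?D = "frechet_derivative (f \<circ> inv_into V \<phi>) (at (\<phi> q))"
  let ?T = "tangent_of_coords A (V, \<phi>) q"
  have qA: "q \<in> carrier_of A" unfolding carrier_of_def using A(2) q by blast
  then have sm: "smooth_at A f q"
    and inj: "inj_on (differential A (euclidean_atlas U) f q) (tangent_space A q)"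
    using f unfolding immersion_into_def by auto
  have diff: "differential A (euclidean_atlas U) f q (?T \<xi>)
      = (\<lambda>(V', \<psi>). if (V', \<psi>) = (U, id) \<and> f q \<in> U then ?D \<xi> else 0)" for \<xi>
  proof -
    obtain c where c: "smooth_curve A c q" "((\<phi> \<circ> c) has_vector_derivative \<xi>) (at 0)"
      "differential A (euclidean_atlas U) f q (?T \<xi>) = velocity (euclidean_atlas U) (f \<circ> c)"
      by (rule differential_of_coords[OF A q])
    have "vector_derivative (f \<circ> c) (at 0) = ?D \<xi>"
      by (rule vector_derivative_at[OF has_vector_derivative_along_curve[OF A q c(1,2)
            smooth_at_has_derivative[OF A q sm]]])
    moreover have "c 0 = q" using c(1) unfolding smooth_curve_def by blast
    ultimately have "velocity (euclidean_atlas U) (f \<circ> c)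
        = (\<lambda>(V', \<psi>). if (V', \<psi>) = (U, id) \<and> f q \<in> U then ?D \<xi> else 0)"
      unfolding velocity_def euclidean_atlas_def by (intro ext) auto
    then show ?thesis using c(3) by simp
  qed
  fix \<xi> \<eta> assume "?D \<xi> = ?D \<eta>"
  then have "differential A (euclidean_atlas U) f q (?T \<xi>) = differential A (euclidean_atlas U) f q (?T \<eta>)"
    unfolding diff by (simp only:)
  moreover have "?T \<xi> \<in> tangent_space A q" "?T \<eta> \<in> tangent_space A q"
    unfolding tangent_space_eq_range[OF A q] by auto
  ultimately have "?T \<xi> = ?T \<eta>" using inj by (auto dest: inj_onD)
  then show "\<xi> = \<eta>" using tangent_of_coords_self[OF A q] by metis
qed

theorem theorem1:
  fixes A :: "('p, real^'n) atlas"
    and U :: "(real^'m) set"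
    and f :: "'p \<Rightarrow> real^'m"
    and F :: "real^'m \<Rightarrow> real^'l"
    and X :: "(real^'n, real^'l) jet set"
    and k :: nat
  assumes "manifold A"
    and "open U"
    and "immersion_into A U f"
    and "smooth_on U F"
    and "submanifold jet_fiber_atlas k X"
    and "A1_invariant X"
  shows "\<exists>\<Sigma> \<subseteq> {\<pi> :: real^'m \<Rightarrow> real^'l. linear \<pi>}.
           matrix ` \<Sigma> \<in> null_sets lebesgue \<and>
           (\<forall>\<pi> \<in> {\<pi>. linear \<pi>} - \<Sigma>.
              transverse A (jet_atlas A) (jet1 A (perturb F \<pi> \<circ> f)) (jet_subbundle A X))"
proof -
  have A: "smooth_atlas A" and sc: "second_countable (atlas_topology A)"
    using \<open>manifold A\<close> unfolding manifold_def by auto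
  define M where "M = jet_matrix ` X"
  have M: "euclidean_submanifold k M"
  proof -
    have "X \<subseteq> jet_fiber" "euclidean_submanifold k (jet_matrix ` (X \<inter> jet_fiber))"
      using \<open>submanifold jet_fiber_atlas k X\<close>
      unfolding submanifold_def jet_fiber_atlas_def carrier_of_def by auto
    then show ?thesis unfolding M_def by (simp add: Int_absorb2)
  qed
  have fU: "f q \<in> U" "smooth_at A f q" if "(V, \<phi>) \<in> A" "q \<in> V" for V \<phi> q
  proof -
    have "q \<in> carrier_of A" unfolding carrier_of_def using that by blast
    then show "f q \<in> U" "smooth_at A f q"
      using \<open>immersion_into A U f\<close> unfolding immersion_into_def by auto
  qed
  define fc :: "('p, real^'n) chart \<Rightarrow> real^'n \<Rightarrow> real^'m" where "fc = (\<lambda>(V, \<phi>). f \<circ> inv_into V \<phi>)"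
  define G where "G \<kappa> = F \<circ> fc \<kappa>" for \<kappa>
  define \<mu> where "\<mu> \<kappa> \<pi> x = deriv_matrix (G \<kappa>) x + \<pi> ** deriv_matrix (fc \<kappa>) x" for \<kappa> \<pi> x
  have smf: "smooth_on (\<phi> ` V) (fc (V, \<phi>))" if "(V, \<phi>) \<in> A" for V \<phi>
    unfolding fc_def prod.case by (rule smooth_in_chart[OF A that fU(2)[OF that]])
  have smG: "smooth_on (\<phi> ` V) (G (V, \<phi>))" if "(V, \<phi>) \<in> A" for V \<phi>
    unfolding G_def o_def[of F]
  proof (rule smooth_on_compose[OF smooth_atlasD(2)[OF A that] \<open>open U\<close> _ \<open>smooth_on U F\<close> smf[OF that]])
    show "fc (V, \<phi>) ` \<phi> ` V \<subseteq> U"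
      using fU(1)[OF that] unfolding fc_def by (auto simp: inv_into_into)
  qed
  define Bad where "Bad = (\<lambda>(V, \<phi>). {\<pi>. \<exists>x\<in>\<phi> ` V. \<mu> (V, \<phi>) \<pi> x \<in> M \<and>
    (\<exists>Q. \<forall>\<xi> c. tangent_to M (\<mu> (V, \<phi>) \<pi> x) c \<longrightarrow> Q \<noteq> frechet_derivative (\<mu> (V, \<phi>) \<pi>) (at x) \<xi> + c)})"
  have negB: "negligible (Bad (V, \<phi>))" if V: "(V, \<phi>) \<in> A" for V \<phi>
  proof -
    have "inj (frechet_derivative (fc (V, \<phi>)) (at x))" if "x \<in> \<phi> ` V" for x
      using that immersion_inj_derivative[OF A V _ \<open>immersion_into A U f\<close>] unfolding fc_def by auto
    from generic_deriv_matrix_transversality[OF smooth_atlasD(2)[OF A V] smf[OF V] this smG[OF V] M]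
    show ?thesis unfolding Bad_def prod.case \<mu>_def .
  qed
  obtain A0 where A0: "A0 \<subseteq> A" "countable A0" "carrier_of A0 = carrier_of A"
    using countable_subatlas[OF sc] .
  define \<Sigma> where "\<Sigma> = {\<pi> :: real^'m \<Rightarrow> real^'l. linear \<pi> \<and> matrix \<pi> \<in> (\<Union>\<kappa>\<in>A0. Bad \<kappa>)}"
  have "negligible (\<Union>\<kappa>\<in>A0. Bad \<kappa>)"
    using A0(1,2) negB by (intro negligible_countable_UN) auto
  then have "negligible (matrix ` \<Sigma>)" by (rule negligible_subset) (auto simp: \<Sigma>_def)
  then have null: "matrix ` \<Sigma> \<in> null_sets lebesgue" by (simp add: negligible_iff_null_sets)
  have "transverse A (jet_atlas A) (jet1 A (perturb F \<pi> \<circ> f)) (jet_subbundle A X)"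
    if \<pi>: "linear \<pi>" "\<pi> \<notin> \<Sigma>" for \<pi>
  proof -
    let ?g = "perturb F \<pi> \<circ> f"
    have g_eq: "?g \<circ> inv_into V \<phi> = (\<lambda>x. G (V, \<phi>) x + \<pi> (fc (V, \<phi>) x))" for V \<phi>
      unfolding perturb_def G_def fc_def by auto
    have smg: "smooth_on (\<phi> ` V) (?g \<circ> inv_into V \<phi>)" if "(V, \<phi>) \<in> A" for V \<phi>
      unfolding g_eq
      by (rule smooth_on_add[OF smooth_atlasD(2)[OF A that] smG[OF that]
            smooth_on_linear_compose[OF smooth_atlasD(2)[OF A that] \<pi>(1) smf[OF that]]])
    have g: "smooth_at A ?g q" if "(V, \<phi>) \<in> A" "q \<in> V" for V \<phi> q
      by (rule smooth_atI[OF that smooth_atlasD(2)[OF A that(1)] smg[OF that(1)]])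
    have jac: "deriv_matrix (?g \<circ> inv_into V \<phi>) x = \<mu> (V, \<phi>) (matrix \<pi>) x"
      if V: "(V, \<phi>) \<in> A" and x: "x \<in> \<phi> ` V" for V \<phi> x
    proof -
      note Df = smooth_on_has_derivative[OF smf[OF V] x] and DG = smooth_on_has_derivative[OF smG[OF V] x]
      have bl: "bounded_linear \<pi>" using \<pi>(1) linear_conv_bounded_linear by blast
      have "frechet_derivative (?g \<circ> inv_into V \<phi>) (at x) = (\<lambda>v. frechet_derivative (G (V, \<phi>)) (at x) v
          + (\<pi> \<circ> frechet_derivative (fc (V, \<phi>)) (at x)) v)"
        unfolding g_eq o_apply
        by (rule frechet_derivative_eqI[OF has_derivative_add[OF DG bounded_linear.has_derivative[OF bl Df]]])
      moreover have "matrix (\<lambda>v. a v + b v) = matrix a + matrix b" for a b :: "real^'n \<Rightarrow> real^'l"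
        by (simp add: matrix_def vec_eq_iff)
      ultimately show ?thesis
        unfolding \<mu>_def by (simp only: matrix_compose[OF has_derivative_linear[OF Df] \<pi>(1)])
    qed
    show ?thesis
      unfolding transverse_def
    proof (intro ballI disj_imp[THEN iffD2] impI conjI)
      fix q assume "q \<in> carrier_of A" and "\<not> jet1 A ?g q \<notin> jet_subbundle A X"
      then have inW: "jet1 A ?g q \<in> jet_subbundle A X" by blast
      then show "jet1 A ?g q \<in> jet_subbundle A X" .
      have "q \<in> carrier_of A0" using \<open>q \<in> carrier_of A\<close> A0(3) by simp
      then obtain V \<phi> where V0: "(V, \<phi>) \<in> A0" and q: "q \<in> V"
        unfolding carrier_of_def by auto
      then have V: "(V, \<phi>) \<in> A" using A0(1) by blast
      have x: "\<phi> q \<in> \<phi> ` V" using q by blast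
      let ?\<gamma> = "?g \<circ> inv_into V \<phi>"
      have "\<mu> (V, \<phi>) (matrix \<pi>) (\<phi> q) \<in> M"
        using inW jet1_in_subbundle_iff[OF A V q g[OF V q] \<open>A1_invariant X\<close>] jac[OF V x] M_def by simp
      moreover have "matrix \<pi> \<notin> Bad (V, \<phi>)" using \<pi> V0 unfolding \<Sigma>_def by blast
      ultimately have "\<exists>\<xi> c. tangent_to M (\<mu> (V, \<phi>) (matrix \<pi>) (\<phi> q)) c \<and>
          Q = frechet_derivative (\<mu> (V, \<phi>) (matrix \<pi>)) (at (\<phi> q)) \<xi> + c" for Q
        using x unfolding Bad_def by blast
      moreover have "frechet_derivative (deriv_matrix ?\<gamma>) (at (\<phi> q)) = frechet_derivative (\<mu> (V, \<phi>) (matrix \<pi>)) (at (\<phi> q))"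
        by (rule frechet_derivative_eq_on_open[OF smooth_atlasD(2)[OF A V] x jac[OF V]])
      ultimately have "\<exists>\<xi> c. tangent_to (jet_matrix ` X) (deriv_matrix ?\<gamma> (\<phi> q)) c \<and>
          Q = frechet_derivative (deriv_matrix ?\<gamma>) (at (\<phi> q)) \<xi> + c" for Q
        using jac[OF V x] M_def by simp
      from jet_extension_transverse_at[OF A V q g[OF V] \<open>A1_invariant X\<close> this]
      show "{\<lambda>\<kappa>. u \<kappa> + w \<kappa> |u w. u \<in> differential A (jet_atlas A) (jet1 A ?g) q ` tangent_space A q \<and>
          w \<in> tangent_subspace (jet_atlas A) (jet_subbundle A X) (jet1 A ?g q)}
        = tangent_space (jet_atlas A) (jet1 A ?g q)" .
    qed
  qed
  then show ?thesis using null by (intro exI[of _ \<Sigma>]) (auto simp: \<Sigma>_def)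
qed

end
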